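(* Let $\kappa:[0,1]\times[-\pi,\pi]\to\mathbb C$ be measurable and let $\{A_n\}_n$ be a matrix-sequence. If $\{A_n\}_n\sim_{\rm GLT}\kappa$ and the matrices $A_n$ are normal, then $\{A_n\}_n\sim_\lambda\kappa$.
   Context: A matrix-sequence is a sequence $\{A_n\}_n$ with $A_n\in\mathbb C^{n\times n}$ for every $n$. All measure-theoretic notions refer to Lebesgue measure; $\mu_k$ is the Lebesgue measure in $\mathbb R^k$; $\|\cdot\|$ is the spectral norm. Spectral distribution: for a matrix-sequence $\{A_n\}_n$ and a measurable $f:D\subset\mathbb R^k\to\mathbb C$ with $0<\mu_k(D)<\infty$, $\{A_n\}_n\sim_\lambda f$ means $\lim_{n\to\infty}\frac1n\sum_{i=1}^nF(\lambda_i(A_n))=\frac1{\mu_k(D)}\int_DF(f(\mathbf x))\,d\mathbf x$ for all continuous $F:\mathbb C\to\mathbb C$ with bounded support, where $\lambda_i(A_n)$ are the eigenvalues of $A_n$. Approximating class of sequences (a.c.s.): given a matrix-sequence $\{A_n\}_n$ and matrix-sequences $\{B_{n,m}\}_n$ ($m\in\mathbb N$), we write $\{B_{n,m}\}_n\xrightarrow{\rm a.c.s.}\{A_n\}_n$ if for every $m$ there exists $n_m$ such that, for $n\ge n_m$, $A_n=B_{n,m}+R_{n,m}+N_{n,m}$ with $\mathrm{rank}(R_{n,m})\le c(m)n$ and $\|N_{n,m}\|\le\omega(m)$, where $n_m,c(m),\omega(m)$ depend only on $m$ and $\lim_{m\to\infty}c(m)=\lim_{m\to\infty}\omega(m)=0$.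 Diagonal sampling and Toeplitz matrices: for $a:[0,1]\to\mathbb C$, $D_n(a)=\mathrm{diag}_{i=1,\ldots,n}a(i/n)$. For $f\in L^1([-\pi,\pi])$, $T_n(f)=[f_{i-j}]_{i,j=1}^n$ with $f_k=\frac1{2\pi}\int_{-\pi}^\pi f(\theta)e^{-\mathrm i k\theta}d\theta$. GLT sequences: for a matrix-sequence $\{A_n\}_n$ and a measurable $\kappa:[0,1]\times[-\pi,\pi]\to\mathbb C$, $\{A_n\}_n$ is a GLT sequence with symbol $\kappa$, written $\{A_n\}_n\sim_{\rm GLT}\kappa$, if there exist functions $a_{i,m},f_{i,m}$, $i=1,\ldots,N_m$, with $a_{i,m}:[0,1]\to\mathbb C$ continuous a.e. and $f_{i,m}\in L^1([-\pi,\pi])$, such that $\sum_{i=1}^{N_m}a_{i,m}(x)f_{i,m}(\theta)\to\kappa(x,\theta)$ in measure over $[0,1]\times[-\pi,\pi]$ as $m\to\infty$, and $\{\sum_{i=1}^{N_m}D_n(a_{i,m})T_n(f_{i,m})\}_n\xrightarrow{\rm a.c.s.}\{A_n\}_n$. *)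

theory Defs
  imports
    "HOL-Analysis.Analysis"
    "Jordan_Normal_Form.Schur_Decomposition"
    "Jordan_Normal_Form.DL_Rank"
begin

hide_const (open) Finite_Cartesian_Product.mat Finite_Cartesian_Product.vec

definition matrix_sequence :: "(nat \<Rightarrow> complex mat) \<Rightarrow> bool" where
  "matrix_sequence A \<longleftrightarrow> (\<forall>n. A n \<in> carrier_mat n n)"

definition normal_mat :: "complex mat \<Rightarrow> bool" where
  "normal_mat A \<longleftrightarrow> A * mat_adjoint A = mat_adjoint A * A"

definition euclid_norm :: "complex vec \<Rightarrow> real" where
  "euclid_norm v = L2_set (\<lambda>i. cmod (vec_index v i)) {..<dim_vec v}"

(* The supremum runs over the closed unit ball, so that the 0 x 0 matrix has norm 0. *)
definition spectral_norm :: "complex mat \<Rightarrow> real" where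
  "spectral_norm A =
     (SUP v\<in>{v \<in> carrier_vec (dim_col A). euclid_norm v \<le> 1}. euclid_norm (A *\<^sub>v v))"

(* The eigenvalues are counted with algebraic multiplicity: proots is the multiset of roots. *)
definition spectral_distribution ::
  "(nat \<Rightarrow> complex mat) \<Rightarrow> 'a::euclidean_space set \<Rightarrow> ('a \<Rightarrow> complex) \<Rightarrow> bool" where
  "spectral_distribution A D f \<longleftrightarrow>
     matrix_sequence A \<and>
     D \<in> lmeasurable \<and> measure lebesgue D > 0 \<and>
     f \<in> borel_measurable (lebesgue_on D) \<and>
     (\<forall>F :: complex \<Rightarrow> complex. continuous_on UNIV F \<and> bounded {z. F z \<noteq> 0} \<longrightarrow>
        (\<lambda>n. (1 / of_nat n) * (\<Sum>z\<in>#proots (char_poly (A n)). F z))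
          \<longlonglongrightarrow> (1 / of_real (measure lebesgue D)) * (LINT x:D|lebesgue. F (f x)))"

definition acs :: "(nat \<Rightarrow> nat \<Rightarrow> complex mat) \<Rightarrow> (nat \<Rightarrow> complex mat) \<Rightarrow> bool" where
  "acs B A \<longleftrightarrow>
     matrix_sequence A \<and> (\<forall>m. matrix_sequence (\<lambda>n. B n m)) \<and>
     (\<exists>(n\<^sub>0 :: nat \<Rightarrow> nat) (c :: nat \<Rightarrow> real) (\<omega> :: nat \<Rightarrow> real).
        c \<longlonglongrightarrow> 0 \<and> \<omega> \<longlonglongrightarrow> 0 \<and>
        (\<forall>m. \<forall>n\<ge>n\<^sub>0 m. \<exists>R N.
           R \<in> carrier_mat n n \<and> N \<in> carrier_mat n n \<and>
           A n = B n m + R + N \<and>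
           real (vec_space.rank n R) \<le> c m * real n \<and>
           spectral_norm N \<le> \<omega> m))"

(* Matrices are indexed from 0, hence the shift by one in the sampling points. *)
definition diag_sampling :: "nat \<Rightarrow> (real \<Rightarrow> complex) \<Rightarrow> complex mat" where
  "diag_sampling n a = mat_diag n (\<lambda>i. a (real (Suc i) / real n))"

definition fourier_coeff :: "(real \<Rightarrow> complex) \<Rightarrow> int \<Rightarrow> complex" where
  "fourier_coeff f k =
     (1 / (2 * of_real pi)) *
     (LINT \<theta>:{-pi..pi}|lebesgue. f \<theta> * exp (- \<i> * of_int k * of_real \<theta>))"

definition toeplitz :: "nat \<Rightarrow> (real \<Rightarrow> complex) \<Rightarrow> complex mat" where
  "toeplitz n f = mat n n (\<lambda>(i, j). fourier_coeff f (int i - int j))"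

(* The type of matrices is not a monoid (dimensions vary), so a finite sum of
   n x n matrices is formed entrywise. *)
definition mat_sum :: "nat \<Rightarrow> ('i \<Rightarrow> complex mat) \<Rightarrow> 'i set \<Rightarrow> complex mat" where
  "mat_sum n M I = mat n n (\<lambda>ij. \<Sum>k\<in>I. M k $$ ij)"

(* Measurability is part of the notion: emeasure is 0 on non-measurable sets. *)
definition tendsto_in_measure ::
  "'a measure \<Rightarrow> (nat \<Rightarrow> 'a \<Rightarrow> complex) \<Rightarrow> ('a \<Rightarrow> complex) \<Rightarrow> bool" where
  "tendsto_in_measure M g h \<longleftrightarrow>
     (\<forall>m. g m \<in> borel_measurable M) \<and> h \<in> borel_measurable M \<and>
     (\<forall>\<epsilon>>0. (\<lambda>m. emeasure M {x \<in> space M. dist (g m x) (h x) > \<epsilon>}) \<longlonglongrightarrow> 0)"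

abbreviation glt_domain :: "(real \<times> real) set" where
  "glt_domain \<equiv> {0..1} \<times> {-pi..pi}"

definition glt :: "(nat \<Rightarrow> complex mat) \<Rightarrow> (real \<times> real \<Rightarrow> complex) \<Rightarrow> bool" where
  "glt A \<kappa> \<longleftrightarrow>
     matrix_sequence A \<and> \<kappa> \<in> borel_measurable (lebesgue_on glt_domain) \<and>
     (\<exists>(N :: nat \<Rightarrow> nat) (a :: nat \<Rightarrow> nat \<Rightarrow> real \<Rightarrow> complex) (f :: nat \<Rightarrow> nat \<Rightarrow> real \<Rightarrow> complex).
        (\<forall>m. \<forall>i\<in>{1..N m}.
           (AE x in lebesgue_on {0..1}. continuous (at x within {0..1}) (a i m)) \<and>
           set_integrable lebesgue {-pi..pi} (f i m)) \<and>
        tendsto_in_measure (lebesgue_on glt_domain)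
          (\<lambda>m (x, \<theta>). \<Sum>i = 1..N m. a i m x * f i m \<theta>) \<kappa> \<and>
        acs (\<lambda>n m. mat_sum n (\<lambda>i. diag_sampling n (a i m) * toeplitz n (f i m)) {1..N m}) A)"

end

theory Submission
  imports Defs
begin

text \<open>
  Within blocks, a sum of products \<open>D\<^sub>n(a) T\<^sub>n(f)\<close> nearly acts on Fourier vectors as multiplication
  by \<open>a f\<close>: with \<open>a\<close> blockwise constant and \<open>f\<close> a trigonometric polynomial this is exact, up to few
  rows near block boundaries. So there are an explicit unitary \<open>V\<close> and explicit numbers \<open>\<mu>\<^sub>j\<close> with
  \<open>A V - V diag(\<mu>) = R + T\<close>, where \<open>R\<close> has small rank and \<open>T\<close> small trace norm; the \<open>\<mu>\<^sub>j\<close> are samples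
  of a function close to \<open>\<kappa>\<close> in measure. The trace norm of \<open>T\<^sub>n(g)\<close> is at most \<open>n \<parallel>g\<parallel>\<^sub>1 / 2\<pi>\<close>
  directly from its integral representation.

  Write the normal matrix \<open>A\<close> as \<open>U diag(\<xi>) U\<^sup>*\<close> and put \<open>W = U\<^sup>* V\<close>. The matrix with entries
  \<open>w\<^sub>i\<^sub>j (\<xi>\<^sub>i - \<mu>\<^sub>j) / sqrt((1 + |\<xi>\<^sub>i|\<^sup>2)(1 + |\<mu>\<^sub>j|\<^sup>2))\<close> has norm at most \<open>2\<close> and inherits the splitting
  into small rank plus small trace norm, so its Frobenius norm is \<open>o(sqrt n)\<close>. As \<open>|w\<^sub>i\<^sub>j|\<^sup>2\<close> is doubly
  stochastic, this couples the \<open>\<xi>\<^sub>i\<close> to the \<open>\<mu>\<^sub>j\<close> at small mean square chordal distance, and a continuous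
  \<open>F\<close> with bounded support is uniformly continuous for the chordal distance. The boundedness of the
  weighted matrix is what makes perturbations of small rank but large norm harmless.
\<close>

section \<open>Bounded, small-rank and small-trace matrices\<close>

text \<open>The sampled functions are only continuous a.e. and may be unbounded, and the Toeplitz
  symbols are merely integrable, so no factor need be bounded in norm uniformly in n. The errors are
  sorted accordingly. Rows where a sampled function oscillates go into the rank part, whatever their
  size. On the other rows an oscillation of at most \<epsilon> multiplies T_n(f), and a bounded
  block value multiplies T_n(f - p) for a trigonometric polynomial p; both are small in trace norm.
  This forces the order of choices: m; then \<epsilon> from the L1 norms of the f; then the number s
  of blocks from \<epsilon>; then the bound M on the block values; then the polynomials p, close to
  f on the scale 1 / M; then their bandwidth d; and n last. Normality of A enters once, to provide
  the unitary U.\<close>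

definition vnorm :: "nat \<Rightarrow> (nat \<Rightarrow> complex) \<Rightarrow> real" where
  "vnorm n v = L2_set (\<lambda>i. cmod (v i)) {..<n}"

text \<open>Matrices are functions of which only the entries with indices below \<open>n\<close> matter, so that the
  product is associative without side conditions. Small trace norm and small rank are expressed by
  duality: through the pairing with matrices of bounded norm, and through the row vectors \<open>z\<close> that
  annihilate the matrix.\<close>

definition op_bound :: "nat \<Rightarrow> real \<Rightarrow> (nat \<Rightarrow> nat \<Rightarrow> complex) \<Rightarrow> bool" where
  "op_bound n c X \<longleftrightarrow> 0 \<le> c \<and>
     (\<forall>u v. cmod (\<Sum>i<n. \<Sum>j<n. u i * X i j * v j) \<le> c * vnorm n u * vnorm n v)"

definition mprod :: "nat \<Rightarrow> (nat \<Rightarrow> nat \<Rightarrow> complex) \<Rightarrow> (nat \<Rightarrow> nat \<Rightarrow> complex) \<Rightarrow> nat \<Rightarrow> nat \<Rightarrow> complex" where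
  "mprod n X Y = (\<lambda>i k. \<Sum>j<n. X i j * Y j k)"

definition adjm :: "(nat \<Rightarrow> nat \<Rightarrow> complex) \<Rightarrow> nat \<Rightarrow> nat \<Rightarrow> complex" where
  "adjm X = (\<lambda>i j. cnj (X j i))"

definition trace_le :: "nat \<Rightarrow> real \<Rightarrow> (nat \<Rightarrow> nat \<Rightarrow> complex) \<Rightarrow> bool" where
  "trace_le n \<delta> T \<longleftrightarrow> (\<forall>X c. op_bound n c X \<longrightarrow> cmod (\<Sum>i<n. \<Sum>j<n. X i j * T j i) \<le> c * \<delta>)"

definition rank_le :: "nat \<Rightarrow> nat \<Rightarrow> (nat \<Rightarrow> nat \<Rightarrow> complex) \<Rightarrow> bool" where
  "rank_le n r R \<longleftrightarrow> (\<exists>ys. length ys \<le> r \<and>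
     (\<forall>z. (\<forall>y\<in>set ys. (\<Sum>i<n. z i * y i) = 0) \<longrightarrow> (\<forall>j<n. (\<Sum>i<n. z i * R i j) = 0)))"

definition unitary_fun :: "nat \<Rightarrow> (nat \<Rightarrow> nat \<Rightarrow> complex) \<Rightarrow> bool" where
  "unitary_fun n u \<longleftrightarrow>
     (\<forall>i<n. \<forall>j<n. (\<Sum>k<n. cnj (u k i) * u k j) = (if i = j then 1 else 0)) \<and>
     (\<forall>i<n. \<forall>j<n. (\<Sum>k<n. u i k * cnj (u j k)) = (if i = j then 1 else 0))"

lemma vnorm_nonneg [simp]: "0 \<le> vnorm n v"
  by (simp add: vnorm_def)

lemma vnorm_power2: "(vnorm n v)\<^sup>2 = (\<Sum>i<n. (cmod (v i))\<^sup>2)"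
  by (simp add: vnorm_def L2_set_def sum_nonneg)

lemma vnorm_power2_complex: "complex_of_real ((vnorm n v)\<^sup>2) = (\<Sum>i<n. cnj (v i) * v i)"
  unfolding vnorm_power2
  by (simp add: complex_norm_square mult.commute del: of_real_power)

lemma vnorm_cnj [simp]: "vnorm n (\<lambda>i. cnj (v i)) = vnorm n v"
  by (simp add: vnorm_def)

lemma vnorm_mono: "(\<And>i. i < n \<Longrightarrow> cmod (u i) \<le> cmod (v i)) \<Longrightarrow> vnorm n u \<le> vnorm n v"
  unfolding vnorm_def by (rule L2_set_mono) auto

lemma vnorm_cong: "(\<And>i. i < n \<Longrightarrow> u i = v i) \<Longrightarrow> vnorm n u = vnorm n v"
  unfolding vnorm_def by (rule L2_set_cong) auto

lemma vnorm_scale: "vnorm n (\<lambda>i. c * v i) = cmod c * vnorm n v"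
  unfolding vnorm_def by (simp add: norm_mult L2_set_right_distrib)

lemma vnorm_triangle: "vnorm n (\<lambda>i. u i + v i) \<le> vnorm n u + vnorm n v"
proof -
  have "vnorm n (\<lambda>i. u i + v i) \<le> L2_set (\<lambda>i. cmod (u i) + cmod (v i)) {..<n}"
    unfolding vnorm_def by (rule L2_set_mono) (auto intro: norm_triangle_ineq)
  also have "\<dots> \<le> vnorm n u + vnorm n v"
    unfolding vnorm_def by (rule L2_set_triangle_ineq)
  finally show ?thesis .
qed

lemma cauchy_schwarz: "cmod (\<Sum>i<n. u i * v i) \<le> vnorm n u * vnorm n v"
proof -
  have "cmod (\<Sum>i<n. u i * v i) \<le> (\<Sum>i<n. \<bar>cmod (u i)\<bar> * \<bar>cmod (v i)\<bar>)"
    by (rule order_trans[OF norm_sum]) (simp add: norm_mult)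
  also have "\<dots> \<le> vnorm n u * vnorm n v"
    unfolding vnorm_def by (rule L2_set_mult_ineq)
  finally show ?thesis .
qed

text \<open>The form is bilinear, without conjugation; testing it with the conjugate of Xv in place
  of u produces the squared norm of Xv. The converse is Cauchy-Schwarz.\<close>

lemma op_bound_iff:
  "op_bound n c X \<longleftrightarrow> 0 \<le> c \<and> (\<forall>v. vnorm n (\<lambda>i. \<Sum>j<n. X i j * v j) \<le> c * vnorm n v)"
proof safe
  assume X: "op_bound n c X"
  then show "0 \<le> c" by (simp add: op_bound_def)
  fix v
  let ?w = "\<lambda>i. \<Sum>j<n. X i j * v j"
  have "(vnorm n ?w)\<^sup>2 = cmod (\<Sum>i<n. cnj (?w i) * ?w i)"
    by (subst vnorm_power2_complex[symmetric]) (simp del: of_real_power)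
  also have "(\<Sum>i<n. cnj (?w i) * ?w i) = (\<Sum>i<n. \<Sum>j<n. cnj (?w i) * X i j * v j)"
    by (simp add: sum_distrib_left mult.assoc del: cnj_sum)
  also have "cmod \<dots> \<le> c * vnorm n ?w * vnorm n v"
    using X[unfolded op_bound_def, THEN conjunct2, rule_format, of "\<lambda>i. cnj (?w i)" v]
    by (simp only: vnorm_cnj)
  finally have "vnorm n ?w * vnorm n ?w \<le> vnorm n ?w * (c * vnorm n v)"
    by (simp add: power2_eq_square mult_ac)
  then show "vnorm n ?w \<le> c * vnorm n v"
    using \<open>0 \<le> c\<close> by (cases "vnorm n ?w = 0")
     (auto simp: mult_le_cancel_left less_le)
next
  assume c: "0 \<le> c" and X: "\<forall>v. vnorm n (\<lambda>i. \<Sum>j<n. X i j * v j) \<le> c * vnorm n v"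
  show "op_bound n c X"
    unfolding op_bound_def
  proof (intro conjI allI c)
    fix u v
    have "(\<Sum>i<n. \<Sum>j<n. u i * X i j * v j) = (\<Sum>i<n. u i * (\<Sum>j<n. X i j * v j))"
      by (simp add: sum_distrib_left mult.assoc)
    also have "cmod \<dots> \<le> vnorm n u * vnorm n (\<lambda>i. \<Sum>j<n. X i j * v j)"
      by (rule cauchy_schwarz)
    also have "\<dots> \<le> vnorm n u * (c * vnorm n v)"
      using X by (intro mult_left_mono) auto
    finally show "cmod (\<Sum>i<n. \<Sum>j<n. u i * X i j * v j) \<le> c * vnorm n u * vnorm n v"
      by (simp add: mult_ac)
  qed
qed

lemma op_bound_nonneg: "op_bound n c X \<Longrightarrow> 0 \<le> c"
  by (simp add: op_bound_def)

lemma op_boundD: "op_bound n c X \<Longrightarrow> vnorm n (\<lambda>i. \<Sum>j<n. X i j * v j) \<le> c * vnorm n v"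
  by (simp add: op_bound_iff)

lemma op_bound_adjm: "op_bound n c X \<Longrightarrow> op_bound n c (adjm X)"
  unfolding op_bound_def
proof safe
  fix u v
  assume "\<forall>u v. cmod (\<Sum>i<n. \<Sum>j<n. u i * X i j * v j) \<le> c * vnorm n u * vnorm n v"
  from this[rule_format, of "\<lambda>i. cnj (v i)" "\<lambda>i. cnj (u i)"]
  have "cmod (\<Sum>i<n. \<Sum>j<n. cnj (v i) * X i j * cnj (u j)) \<le> c * vnorm n v * vnorm n u"
    by (simp only: vnorm_cnj)
  also have "(\<Sum>i<n. \<Sum>j<n. cnj (v i) * X i j * cnj (u j))
      = cnj (\<Sum>i<n. \<Sum>j<n. u i * adjm X i j * v j)"
    by (subst sum.swap) (simp add: adjm_def mult_ac)
  finally show "cmod (\<Sum>i<n. \<Sum>j<n. u i * adjm X i j * v j) \<le> c * vnorm n u * vnorm n v"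
    by (simp add: mult_ac del: cnj_sum)
qed

lemma op_bound_mprod:
  assumes "op_bound n c X" "op_bound n d Y"
  shows "op_bound n (c * d) (mprod n X Y)"
  unfolding op_bound_iff
proof (intro conjI allI)
  show "0 \<le> c * d" using assms by (auto simp: op_bound_nonneg)
  fix v
  have "(\<lambda>i. \<Sum>j<n. mprod n X Y i j * v j) = (\<lambda>i. \<Sum>k<n. X i k * (\<Sum>j<n. Y k j * v j))"
    unfolding mprod_def sum_distrib_right sum_distrib_left
    by (rule ext, subst sum.swap) (simp add: mult.assoc)
  then have "vnorm n (\<lambda>i. \<Sum>j<n. mprod n X Y i j * v j)
      \<le> c * vnorm n (\<lambda>k. \<Sum>j<n. Y k j * v j)"
    using op_boundD[OF assms(1)] by simp
  also have "\<dots> \<le> c * (d * vnorm n v)"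
    by (intro mult_left_mono op_boundD assms op_bound_nonneg[OF assms(1)])
  finally show "vnorm n (\<lambda>i. \<Sum>j<n. mprod n X Y i j * v j) \<le> c * d * vnorm n v"
    by (simp add: mult_ac)
qed

lemma op_bound_add:
  assumes "op_bound n c X" "op_bound n d Y"
  shows "op_bound n (c + d) (\<lambda>i j. X i j + Y i j)"
  unfolding op_bound_iff
proof (intro conjI allI)
  show "0 \<le> c + d" using assms by (auto simp: op_bound_nonneg)
  fix v
  have "vnorm n (\<lambda>i. \<Sum>j<n. (X i j + Y i j) * v j)
     = vnorm n (\<lambda>i. (\<Sum>j<n. X i j * v j) + (\<Sum>j<n. Y i j * v j))"
    by (simp add: algebra_simps sum.distrib)
  also have "\<dots> \<le> vnorm n (\<lambda>i. \<Sum>j<n. X i j * v j) + vnorm n (\<lambda>i. \<Sum>j<n. Y i j * v j)"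
    by (rule vnorm_triangle)
  also have "\<dots> \<le> c * vnorm n v + d * vnorm n v"
    by (intro add_mono op_boundD assms)
  finally show "vnorm n (\<lambda>i. \<Sum>j<n. (X i j + Y i j) * v j) \<le> (c + d) * vnorm n v"
    by (simp add: algebra_simps)
qed

lemma op_bound_minus: "op_bound n c X \<Longrightarrow> op_bound n c (\<lambda>i j. - X i j)"
  unfolding op_bound_def by (simp add: sum_negf)

lemma op_bound_diag_left:
  assumes "op_bound n c X" "\<And>i. i < n \<Longrightarrow> cmod (d i) \<le> b" "0 \<le> b"
  shows "op_bound n (b * c) (\<lambda>i j. d i * X i j)"
  unfolding op_bound_iff
proof (intro conjI allI)
  show "0 \<le> b * c" using assms by (auto simp: op_bound_nonneg)
  fix v
  have "vnorm n (\<lambda>i. \<Sum>j<n. d i * X i j * v j) = vnorm n (\<lambda>i. d i * (\<Sum>j<n. X i j * v j))"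
    by (simp add: sum_distrib_left mult.assoc)
  also have "\<dots> \<le> vnorm n (\<lambda>i. of_real b * (\<Sum>j<n. X i j * v j))"
    using assms by (intro vnorm_mono) (auto simp: norm_mult intro!: mult_right_mono)
  also have "\<dots> = b * vnorm n (\<lambda>i. \<Sum>j<n. X i j * v j)"
    using assms by (simp add: vnorm_scale)
  also have "\<dots> \<le> b * (c * vnorm n v)"
    by (intro mult_left_mono op_boundD assms)
  finally show "vnorm n (\<lambda>i. \<Sum>j<n. d i * X i j * v j) \<le> b * c * vnorm n v"
    by (simp add: mult_ac)
qed

lemma op_bound_diag_right:
  assumes "op_bound n c X" "\<And>i. i < n \<Longrightarrow> cmod (d i) \<le> b" "0 \<le> b"
  shows "op_bound n (b * c) (\<lambda>i j. X i j * d j)"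
proof -
  have "op_bound n (b * c) (adjm (\<lambda>i j. cnj (d i) * adjm X i j))"
    using assms by (intro op_bound_adjm op_bound_diag_left) auto
  then show ?thesis by (simp add: adjm_def mult.commute)
qed

lemma unitary_fun_adjm: "unitary_fun n u \<Longrightarrow> unitary_fun n (adjm u)"
  by (auto simp: unitary_fun_def adjm_def mult.commute)

lemma op_bound_unitary:
  assumes "unitary_fun n u"
  shows "op_bound n 1 u"
  unfolding op_bound_iff
proof (intro conjI allI)
  fix v
  have "complex_of_real ((vnorm n (\<lambda>i. \<Sum>j<n. u i j * v j))\<^sup>2)
      = (\<Sum>i<n. \<Sum>j<n. \<Sum>k<n. cnj (u i j) * cnj (v j) * (u i k * v k))"
    unfolding vnorm_power2_complex by (simp add: sum_product)
  also have "\<dots> = (\<Sum>j<n. \<Sum>k<n. \<Sum>i<n. cnj (u i j) * cnj (v j) * (u i k * v k))"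
    by (subst sum.swap, rule sum.cong[OF refl], subst sum.swap, rule refl)
  also have "\<dots> = (\<Sum>j<n. \<Sum>k<n. cnj (v j) * v k * (\<Sum>i<n. cnj (u i j) * u i k))"
    by (simp add: sum_distrib_left mult_ac)
  also have "\<dots> = (\<Sum>j<n. \<Sum>k<n. if j = k then cnj (v j) * v k else 0)"
    using assms unfolding unitary_fun_def by (intro sum.cong refl) auto
  also have "\<dots> = complex_of_real ((vnorm n v)\<^sup>2)"
    unfolding vnorm_power2_complex by simp
  finally have "(vnorm n (\<lambda>i. \<Sum>j<n. u i j * v j))\<^sup>2 = (vnorm n v)\<^sup>2"
    by (simp only: of_real_eq_iff)
  then show "vnorm n (\<lambda>i. \<Sum>j<n. u i j * v j) \<le> 1 * vnorm n v"
    by simp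
qed simp

text \<open>An orthogonal projection contracts: |Qv|^2 = <v, Qv> is at most |v| |Qv| by
  Cauchy-Schwarz.\<close>

lemma op_bound_idempotent:
  assumes herm: "\<And>i j. i < n \<Longrightarrow> j < n \<Longrightarrow> Q j i = cnj (Q i j)"
    and idem: "\<And>i j. i < n \<Longrightarrow> j < n \<Longrightarrow> (\<Sum>k<n. Q i k * Q k j) = Q i j"
  shows "op_bound n 1 Q"
  unfolding op_bound_iff
proof (intro conjI allI)
  fix v
  let ?w = "\<lambda>i. \<Sum>j<n. Q i j * v j"
  have "complex_of_real ((vnorm n ?w)\<^sup>2)
      = (\<Sum>i<n. \<Sum>j<n. \<Sum>k<n. cnj (Q i j) * cnj (v j) * (Q i k * v k))"
    unfolding vnorm_power2_complex by (simp add: sum_product)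
  also have "\<dots> = (\<Sum>j<n. \<Sum>k<n. \<Sum>i<n. cnj (Q i j) * cnj (v j) * (Q i k * v k))"
    by (subst sum.swap, rule sum.cong[OF refl], subst sum.swap, rule refl)
  also have "\<dots> = (\<Sum>j<n. \<Sum>k<n. cnj (v j) * v k * (\<Sum>i<n. Q j i * Q i k))"
    unfolding sum_distrib_left by (intro sum.cong refl) (simp add: herm[symmetric] mult_ac)
  also have "\<dots> = (\<Sum>j<n. \<Sum>k<n. cnj (v j) * v k * Q j k)"
    by (intro sum.cong refl) (simp add: idem)
  also have "\<dots> = (\<Sum>j<n. cnj (v j) * ?w j)"
    unfolding sum_distrib_left by (simp add: mult_ac)
  finally have eq: "complex_of_real ((vnorm n ?w)\<^sup>2) = (\<Sum>j<n. cnj (v j) * ?w j)" .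
  have "(vnorm n ?w)\<^sup>2 = cmod (complex_of_real ((vnorm n ?w)\<^sup>2))"
    by (simp del: of_real_power)
  also have "\<dots> = cmod (\<Sum>j<n. cnj (v j) * ?w j)"
    by (simp only: eq)
  also have "\<dots> \<le> vnorm n v * vnorm n ?w"
    using cauchy_schwarz[where u="\<lambda>i. cnj (v i)" and v="?w" and n=n] by (simp only: vnorm_cnj)
  finally show "vnorm n ?w \<le> 1 * vnorm n v"
    by (cases "vnorm n ?w = 0") (simp_all add: power2_eq_square mult_le_cancel_right less_le)
qed simp

section \<open>Sums and products of matrices of small trace norm or small rank\<close>

lemma trace_le_add: "trace_le n a S \<Longrightarrow> trace_le n b T \<Longrightarrow> trace_le n (a + b) (\<lambda>i j. S i j + T i j)"
  unfolding trace_le_def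
  by (simp add: distrib_left sum.distrib) (meson add_mono norm_triangle_le)

lemma trace_le_zero [simp]: "trace_le n 0 (\<lambda>i j. 0)"
  by (simp add: trace_le_def)

lemma trace_le_sum:
  "(\<And>k. k \<in> K \<Longrightarrow> trace_le n (a k) (T k)) \<Longrightarrow> trace_le n (\<Sum>k\<in>K. a k) (\<lambda>i j. \<Sum>k\<in>K. T k i j)"
  by (induction K rule: infinite_finite_induct) (auto intro: trace_le_add)

lemma trace_le_mono: "trace_le n a T \<Longrightarrow> a \<le> b \<Longrightarrow> trace_le n b T"
  unfolding trace_le_def by (meson mult_left_mono op_bound_nonneg order_trans)

lemma trace_le_diag_left:
  assumes "trace_le n a T" "\<And>i. i < n \<Longrightarrow> cmod (d i) \<le> b" "0 \<le> b"
  shows "trace_le n (b * a) (\<lambda>i j. d i * T i j)"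
  unfolding trace_le_def
proof safe
  fix X c assume "op_bound n c X"
  then have "op_bound n (b * c) (\<lambda>i j. X i j * d j)"
    by (rule op_bound_diag_right) (use assms in auto)
  with assms(1) show "cmod (\<Sum>i<n. \<Sum>j<n. X i j * (d j * T j i)) \<le> c * (b * a)"
    unfolding trace_le_def by (force simp: mult_ac)
qed

text \<open>Cyclicity of the trace moves V from T onto the test matrix, whose norm bound does not
  grow since V is a contraction. In the duality form of \<open>trace_le\<close> no singular values
  are needed for this.\<close>

lemma trace_le_mprod_right:
  assumes T: "trace_le n a T" and V: "op_bound n 1 V"
  shows "trace_le n a (mprod n T V)"
  unfolding trace_le_def
proof safe
  fix X c assume "op_bound n c X"
  with V have "op_bound n (1 * c) (mprod n V X)" by (rule op_bound_mprod)
  with T have "cmod (\<Sum>i<n. \<Sum>j<n. mprod n V X i j * T j i) \<le> c * a"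
    unfolding trace_le_def by auto
  also have "(\<Sum>i<n. \<Sum>j<n. mprod n V X i j * T j i) = (\<Sum>i<n. \<Sum>j<n. \<Sum>k<n. V i k * X k j * T j i)"
    by (simp add: mprod_def sum_distrib_right)
  also have "\<dots> = (\<Sum>i<n. \<Sum>k<n. \<Sum>j<n. V i k * X k j * T j i)"
    by (intro sum.cong refl sum.swap)
  also have "\<dots> = (\<Sum>k<n. \<Sum>j<n. \<Sum>i<n. V i k * X k j * T j i)"
    by (subst sum.swap, rule sum.cong[OF refl], subst sum.swap, rule refl)
  also have "\<dots> = (\<Sum>k<n. \<Sum>j<n. X k j * mprod n T V j k)"
    by (simp add: mprod_def sum_distrib_left mult_ac)
  finally show "cmod (\<Sum>k<n. \<Sum>j<n. X k j * mprod n T V j k) \<le> c * a" .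
qed

lemma rank_le_add: "rank_le n r R \<Longrightarrow> rank_le n s S \<Longrightarrow> rank_le n (r + s) (\<lambda>i j. R i j + S i j)"
  unfolding rank_le_def
proof (elim exE conjE)
  fix ys zs
  assume "length ys \<le> r" "length zs \<le> s"
    and *: "\<forall>z. (\<forall>y\<in>set ys. (\<Sum>i<n. z i * y i) = 0) \<longrightarrow> (\<forall>j<n. (\<Sum>i<n. z i * R i j) = 0)"
       "\<forall>z. (\<forall>y\<in>set zs. (\<Sum>i<n. z i * y i) = 0) \<longrightarrow> (\<forall>j<n. (\<Sum>i<n. z i * S i j) = 0)"
  then show "\<exists>ys. length ys \<le> r + s \<and>
     (\<forall>z. (\<forall>y\<in>set ys. (\<Sum>i<n. z i * y i) = 0) \<longrightarrow> (\<forall>j<n. (\<Sum>i<n. z i * (R i j + S i j)) = 0))"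
    by (intro exI[of _ "ys @ zs"]) (auto simp: distrib_left sum.distrib)
qed

text \<open>A factor on the right acts after \<open>z\<close> has already annihilated R, so the same
  list of vectors works.\<close>

lemma rank_le_mprod_right:
  assumes "rank_le n r R"
  shows "rank_le n r (mprod n R V)"
proof -
  have "(\<Sum>i<n. z i * mprod n R V i j) = (\<Sum>k<n. (\<Sum>i<n. z i * R i k) * V k j)" for z j
    unfolding mprod_def sum_distrib_left sum_distrib_right by (subst sum.swap) (simp add: mult.assoc)
  then show ?thesis
    using assms unfolding rank_le_def by auto
qed

text \<open>The unit vectors at the positions in I are the witnesses: a \<open>z\<close> orthogonal
  to them vanishes on I, and outside I the rows of R are zero.\<close>

lemma rank_le_rows:
  assumes "\<And>i j. i < n \<Longrightarrow> j < n \<Longrightarrow> i \<notin> I \<Longrightarrow> R i j = 0"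
  shows "rank_le n (card (I \<inter> {..<n})) R"
proof -
  define ys where "ys = map (\<lambda>i k. if k = i then 1 else (0::complex)) (sorted_list_of_set (I \<inter> {..<n}))"
  have "length ys = card (I \<inter> {..<n})"
    by (simp add: ys_def)
  moreover have "(\<Sum>i<n. z i * R i j) = 0"
    if z: "\<forall>y\<in>set ys. (\<Sum>i<n. z i * y i) = 0" and "j < n" for z j
  proof (rule sum.neutral, safe)
    fix i assume "i < n"
    have "z i = 0" if "i \<in> I"
    proof -
      have "(\<lambda>k. if k = i then 1 else (0::complex)) \<in> set ys"
        using that \<open>i < n\<close> by (auto simp: ys_def)
      with z have "(\<Sum>k<n. z k * (if k = i then 1 else 0)) = 0" by fast
      then show ?thesis using \<open>i < n\<close> by (simp add: if_distrib[of "(*) _"] cong: if_cong)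
    qed
    then show "z i * R i j = 0"
      using assms[of i j] \<open>i < n\<close> \<open>j < n\<close> by (cases "i \<in> I") auto
  qed
  ultimately show ?thesis
    unfolding rank_le_def by (intro exI[of _ ys]) auto
qed

text \<open>Gram-Schmidt, carried out on the projection instead of on the vectors: Q is an
  orthogonal projection that kills all \<open>ys\<close>. Its explicit form, identity minus rank-one
  terms, is part of the conclusion because \<open>frobenius_bound\<close> estimates the complement
  of Q one unit vector at a time.\<close>

lemma projection_exists:
  "\<exists>qs Q. length qs \<le> length ys \<and> (\<forall>q\<in>set qs. vnorm n q = 1) \<and>
     (\<forall>i k. Q i k = (if i = k then 1 else 0) - (\<Sum>q\<leftarrow>qs. q i * cnj (q k))) \<and>
     (\<forall>i<n. \<forall>j<n. (\<Sum>k<n. Q i k * Q k j) = Q i j) \<and>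
     (\<forall>y\<in>set ys. \<forall>i<n. (\<Sum>k<n. Q i k * y k) = 0)"
proof (induction ys)
  case Nil
  have "(\<Sum>k<n. (if i = k then 1 else 0) * (if k = j then 1 else 0)) = (if i = j then 1 else (0::complex))"
    if "i < n" for i j
  proof -
    have "(\<Sum>k<n. (if i = k then 1 else 0) * (if k = j then 1 else 0))
        = (\<Sum>k<n. if k = i then (if i = j then 1 else 0) else (0::complex))"
      by (rule sum.cong) auto
    then show ?thesis using that by simp
  qed
  then show ?case by (intro exI[of _ "[]"] exI[of _ "\<lambda>i k. if i = k then 1 else 0"]) auto
next
  case (Cons y ys)
  then obtain qs Q where len: "length qs \<le> length ys" and qs: "\<forall>q\<in>set qs. vnorm n q = 1"
    and Q: "\<And>i k. Q i k = (if i = k then 1 else 0) - (\<Sum>q\<leftarrow>qs. q i * cnj (q k))"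
    and idem: "\<And>i j. i < n \<Longrightarrow> j < n \<Longrightarrow> (\<Sum>k<n. Q i k * Q k j) = Q i j"
    and Qy: "\<And>y i. y \<in> set ys \<Longrightarrow> i < n \<Longrightarrow> (\<Sum>k<n. Q i k * y k) = 0"
    by blast
  have cnj_list: "cnj (\<Sum>q\<leftarrow>qs. f q) = (\<Sum>q\<leftarrow>qs. cnj (f q))" for f :: "_ \<Rightarrow> complex"
    by (induction qs) auto
  have herm: "Q k i = cnj (Q i k)" for i k
    unfolding Q by (simp add: cnj_list mult.commute)
  \<comment> \<open>The component of y that the current projection still sees; if it vanishes,
    nothing has to be added.\<close>
  define z where "z = (\<lambda>i. \<Sum>k<n. Q i k * y k)"
  show ?case
  proof (cases "vnorm n z = 0")
    case True
    then have "(\<Sum>i<n. (cmod (z i))\<^sup>2) = 0" by (simp flip: vnorm_power2)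
    then have "\<forall>i<n. z i = 0" by (subst (asm) sum_nonneg_eq_0_iff) auto
    then show ?thesis
      using len qs Q idem Qy
      by (intro exI[of _ qs] exI[of _ Q]) (auto simp: z_def le_SucI)
  next
    case False
    define q where "q = (\<lambda>i. z i / vnorm n z)"
    have q1: "vnorm n q = 1"
      using vnorm_scale[of n "1 / vnorm n z" z] False by (simp add: q_def norm_divide)
    then have qq: "(\<Sum>k<n. cnj (q k) * q k) = 1"
      by (simp flip: vnorm_power2_complex)
    have Qz: "(\<Sum>k<n. Q i k * z k) = z i" if "i < n" for i
    proof -
      have "(\<Sum>k<n. Q i k * z k) = (\<Sum>j<n. (\<Sum>k<n. Q i k * Q k j) * y j)"
        unfolding z_def sum_distrib_left sum_distrib_right by (subst sum.swap) (simp add: mult.assoc)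
      also have "\<dots> = z i"
        unfolding z_def using that by (intro sum.cong refl) (simp add: idem)
      finally show ?thesis .
    qed
    have Qq: "(\<Sum>k<n. Q i k * q k) = q i" if "i < n" for i
      using Qz[OF that] by (simp add: q_def flip: sum_divide_distrib)
    have qQ: "(\<Sum>k<n. cnj (q k) * Q k i) = cnj (q i)" if "i < n" for i
      using arg_cong[OF Qq[OF that], of cnj] by (simp add: herm[of _ i] mult.commute)
    define Q' where "Q' = (\<lambda>i k. Q i k - q i * cnj (q k))"
    have Q'v: "(\<Sum>k<n. Q' i k * v k) = (\<Sum>k<n. Q i k * v k) - q i * (\<Sum>k<n. cnj (q k) * v k)" for i v
      by (simp add: Q'_def algebra_simps sum_subtractf sum_distrib_left)
    \<comment> \<open>The new q lies in the range of Q, so pairing with q factors through Q. Hence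
      vectors killed by Q are also killed by \<open>Q'\<close>.\<close>
    have qv: "(\<Sum>k<n. cnj (q k) * v k) = (\<Sum>i<n. cnj (q i) * (\<Sum>k<n. Q i k * v k))" for v
    proof -
      have "(\<Sum>i<n. cnj (q i) * (\<Sum>k<n. Q i k * v k)) = (\<Sum>k<n. (\<Sum>i<n. cnj (q i) * Q i k) * v k)"
        unfolding sum_distrib_left sum_distrib_right by (subst sum.swap) (simp add: mult.assoc)
      also have "\<dots> = (\<Sum>k<n. cnj (q k) * v k)"
        by (intro sum.cong refl) (simp add: qQ)
      finally show ?thesis by simp
    qed
    have old: "(\<Sum>k<n. Q' i k * v k) = 0" if "v \<in> set ys" "i < n" for i v
      unfolding Q'v qv[of v] using Qy that by simp
    have new: "(\<Sum>k<n. Q' i k * y k) = 0" if "i < n" for i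
    proof -
      have "(\<Sum>i<n. cnj (q i) * z i) = vnorm n z"
        using qq False by (simp add: q_def divide_simps power2_eq_square
            flip: sum_divide_distrib vnorm_power2_complex)
      moreover have "(\<Sum>k<n. Q' i k * y k) = z i - q i * (\<Sum>i<n. cnj (q i) * z i)"
        unfolding Q'v qv[of y] by (simp only: z_def)
      ultimately show ?thesis
        using False by (simp add: q_def)
    qed
    have idem': "(\<Sum>k<n. Q' i k * Q' k j) = Q' i j" if "i < n" "j < n" for i j
    proof -
      have "(\<Sum>k<n. Q i k * Q' k j) = (\<Sum>k<n. Q i k * Q k j) - (\<Sum>k<n. Q i k * q k) * cnj (q j)"
        by (simp add: Q'_def algebra_simps sum_subtractf sum_distrib_left)
      also have "\<dots> = Q' i j" using that by (simp add: idem Qq Q'_def)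
      moreover have "(\<Sum>k<n. cnj (q k) * Q' k j)
          = (\<Sum>k<n. cnj (q k) * Q k j) - (\<Sum>k<n. cnj (q k) * q k) * cnj (q j)"
        by (simp add: Q'_def algebra_simps sum_subtractf sum_distrib_left)
      ultimately show ?thesis unfolding Q'v using that by (simp add: qQ qq)
    qed
    show ?thesis
      using len qs q1 old new idem'
      by (intro exI[of _ "q # qs"] exI[of _ Q']) (auto simp: Q'_def Q)
  qed
qed

text \<open>Let the projection Q satisfy QYR = 0. The squared Frobenius norm of E splits into tr(E^*
  Q E), where only T survives and the trace bound gives c \<delta>, and the sum of |E^* q|^2 over at
  most r unit vectors q, each term being at most c^2. The size of R never enters.\<close>

lemma frobenius_bound:
  assumes E: "op_bound n c E" and ET: "\<And>i j. i < n \<Longrightarrow> j < n \<Longrightarrow> E i j = mprod n Y D i j * t j"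
    and D: "\<And>i j. i < n \<Longrightarrow> j < n \<Longrightarrow> D i j = R i j + T i j"
    and R: "rank_le n r R" and T: "trace_le n \<delta> T"
    and Y: "op_bound n 1 Y" and t: "\<And>j. j < n \<Longrightarrow> cmod (t j) \<le> 1"
  shows "(\<Sum>i<n. \<Sum>j<n. (cmod (E i j))\<^sup>2) \<le> c\<^sup>2 * r + c * \<delta>"
proof -
  obtain ys where ys: "length ys \<le> r"
    and Rys: "\<And>z j. (\<forall>y\<in>set ys. (\<Sum>i<n. z i * y i) = 0) \<Longrightarrow> j < n \<Longrightarrow> (\<Sum>i<n. z i * R i j) = 0"
    using R unfolding rank_le_def by blast
  \<comment> \<open>For a row vector \<open>z\<close>, the product zY annihilates R as soon as
    \<open>z\<close> annihilates the images Yy of the vectors y that control R.\<close>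
  define ys' where "ys' = map (\<lambda>y i. \<Sum>k<n. Y i k * y k) ys"
  obtain qs Q where len: "length qs \<le> length ys'" and qs: "\<And>q. q \<in> set qs \<Longrightarrow> vnorm n q = 1"
    and Q: "\<And>i k. Q i k = (if i = k then 1 else 0) - (\<Sum>q\<leftarrow>qs. q i * cnj (q k))"
    and idem: "\<And>i j. i < n \<Longrightarrow> j < n \<Longrightarrow> (\<Sum>k<n. Q i k * Q k j) = Q i j"
    and Qy: "\<And>y i. y \<in> set ys' \<Longrightarrow> i < n \<Longrightarrow> (\<Sum>k<n. Q i k * y k) = 0"
    using projection_exists[of ys' n] by blast
  have cnj_list: "cnj (\<Sum>q\<leftarrow>qs. f q) = (\<Sum>q\<leftarrow>qs. cnj (f q))" for f :: "_ \<Rightarrow> complex"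
    by (induction qs) auto
  have opQ: "op_bound n 1 Q"
    by (rule op_bound_idempotent) (auto simp: idem, auto simp: Q cnj_list mult.commute)
  have QR: "(\<Sum>k<n. \<Sum>l<n. Q i k * Y k l * R l j) = 0" if "i < n" "j < n" for i j
  proof -
    have "(\<Sum>l<n. (\<Sum>k<n. Q i k * Y k l) * R l j) = 0"
    proof (rule Rys[OF _ \<open>j < n\<close>], safe)
      fix y assume "y \<in> set ys"
      then have "(\<Sum>k<n. Q i k * (\<Sum>l<n. Y k l * y l)) = 0"
        using Qy[of "\<lambda>i. \<Sum>k<n. Y i k * y k" i] \<open>i < n\<close> by (auto simp: ys'_def)
      also have "(\<Sum>k<n. Q i k * (\<Sum>l<n. Y k l * y l)) = (\<Sum>l<n. (\<Sum>k<n. Q i k * Y k l) * y l)"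
        unfolding sum_distrib_left sum_distrib_right by (subst sum.swap) (simp add: mult.assoc)
      finally show "(\<Sum>l<n. (\<Sum>k<n. Q i k * Y k l) * y l) = 0" .
    qed
    then show ?thesis unfolding sum_distrib_right by (subst sum.swap)
  qed
  have QE: "(\<Sum>k<n. Q i k * E k j) = (\<Sum>l<n. mprod n Q Y i l * T l j) * t j" if "i < n" "j < n" for i j
  proof -
    have "(\<Sum>k<n. Q i k * E k j) = (\<Sum>k<n. Q i k * (\<Sum>l<n. Y k l * (R l j + T l j)) * t j)"
      using that by (intro sum.cong refl) (simp add: ET D mprod_def)
    also have "\<dots> = (\<Sum>k<n. \<Sum>l<n. Q i k * Y k l * R l j) * t j
        + (\<Sum>k<n. \<Sum>l<n. Q i k * Y k l * T l j) * t j"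
      by (simp add: sum_distrib_left sum_distrib_right algebra_simps sum.distrib)
    also have "(\<Sum>k<n. \<Sum>l<n. Q i k * Y k l * T l j) = (\<Sum>l<n. mprod n Q Y i l * T l j)"
      unfolding mprod_def sum_distrib_right by (rule sum.swap)
    finally show ?thesis using QR that by simp
  qed
  \<comment> \<open>The matrix against which T is paired once the trace has been rotated: diag(t)
    E^* Q Y. Its norm bound is that of E, all other factors being contractions.\<close>
  define X where "X = mprod n (\<lambda>j i. t j * adjm E j i) (mprod n Q Y)"
  have X: "op_bound n c X"
  proof -
    have "op_bound n ((1 * c) * (1 * 1)) X"
      unfolding X_def using t
      by (intro op_bound_mprod op_bound_diag_left op_bound_adjm E opQ Y) auto
    then show ?thesis by simp
  qed
  have tr1: "cmod (\<Sum>i<n. \<Sum>j<n. cnj (E i j) * (\<Sum>k<n. Q i k * E k j)) \<le> c * \<delta>"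
  proof -
    have "(\<Sum>i<n. \<Sum>j<n. cnj (E i j) * (\<Sum>k<n. Q i k * E k j))
       = (\<Sum>i<n. \<Sum>j<n. cnj (E i j) * ((\<Sum>l<n. mprod n Q Y i l * T l j) * t j))"
      by (intro sum.cong refl) (simp add: QE)
    also have "\<dots> = (\<Sum>j<n. \<Sum>i<n. \<Sum>l<n. t j * cnj (E i j) * mprod n Q Y i l * T l j)"
      by (subst sum.swap, intro sum.cong refl) (simp add: sum_distrib_left sum_distrib_right mult_ac)
    also have "\<dots> = (\<Sum>j<n. \<Sum>l<n. X j l * T l j)"
    proof (rule sum.cong[OF refl])
      fix j
      have X: "X j l = (\<Sum>i<n. t j * cnj (E i j) * mprod n Q Y i l)" for l
        unfolding X_def by (subst mprod_def) (simp add: adjm_def)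
      show "(\<Sum>i<n. \<Sum>l<n. t j * cnj (E i j) * mprod n Q Y i l * T l j) = (\<Sum>l<n. X j l * T l j)"
        unfolding X sum_distrib_right by (rule sum.swap)
    qed
    finally show ?thesis using T X unfolding trace_le_def by auto
  qed
  have op': "(vnorm n (\<lambda>j. \<Sum>k<n. cnj (q k) * E k j))\<^sup>2 \<le> c\<^sup>2" if "q \<in> set qs" for q
  proof -
    have "vnorm n (\<lambda>j. cnj (\<Sum>k<n. adjm E j k * q k)) \<le> c * vnorm n q"
      unfolding vnorm_cnj by (rule op_boundD[OF op_bound_adjm[OF E]])
    then have "vnorm n (\<lambda>j. \<Sum>k<n. cnj (q k) * E k j) \<le> c"
      using qs[OF that] by (simp add: adjm_def mult.commute)
    then show ?thesis by (intro power_mono) auto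
  qed
  have list_swap: "(\<Sum>i<n. \<Sum>q\<leftarrow>qs. f q i) = (\<Sum>q\<leftarrow>qs. \<Sum>i<n. f q i)" for f :: "_ \<Rightarrow> nat \<Rightarrow> complex"
    by (induction qs) (auto simp: sum.distrib)
  have tr2: "(\<Sum>i<n. \<Sum>j<n. \<Sum>k<n. (\<Sum>q\<leftarrow>qs. cnj (E i j) * q i * cnj (q k) * E k j))
      = of_real (\<Sum>q\<leftarrow>qs. (vnorm n (\<lambda>j. \<Sum>k<n. cnj (q k) * E k j))\<^sup>2)"
  proof -
    have "complex_of_real ((vnorm n (\<lambda>j. \<Sum>k<n. cnj (q k) * E k j))\<^sup>2)
       = (\<Sum>i<n. \<Sum>j<n. \<Sum>k<n. cnj (E i j) * q i * cnj (q k) * E k j)" for q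
      unfolding vnorm_power2_complex cnj_sum sum_product
      by (subst sum.swap) (simp add: mult_ac)
    then have "(\<Sum>q\<leftarrow>qs. complex_of_real ((vnorm n (\<lambda>j. \<Sum>k<n. cnj (q k) * E k j))\<^sup>2))
       = (\<Sum>q\<leftarrow>qs. (\<Sum>i<n. \<Sum>j<n. \<Sum>k<n. cnj (E i j) * q i * cnj (q k) * E k j))"
      by presburger
    moreover have "of_real (\<Sum>q\<leftarrow>qs. g q) = (\<Sum>q\<leftarrow>qs. complex_of_real (g q))" for g
      by (induction qs) auto
    ultimately show ?thesis by (simp only: list_swap)
  qed
  have pull: "(\<Sum>q\<leftarrow>qs. a * q i * cnj (q k) * b) = a * (\<Sum>q\<leftarrow>qs. q i * cnj (q k)) * b"
    for a b :: complex and i k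
    by (induction qs) (auto simp: algebra_simps)
  have "complex_of_real (\<Sum>i<n. \<Sum>j<n. (cmod (E i j))\<^sup>2) = (\<Sum>i<n. \<Sum>j<n. cnj (E i j) * E i j)"
    by (simp add: complex_norm_square mult.commute del: of_real_power)
  \<comment> \<open>E = QE + (1 - Q)E, with 1 - Q expanded into the rank-one terms of
    \<open>qs\<close>.\<close>
  also have "\<dots> = (\<Sum>i<n. \<Sum>j<n. cnj (E i j) * (\<Sum>k<n. Q i k * E k j)
      + (\<Sum>k<n. (\<Sum>q\<leftarrow>qs. cnj (E i j) * q i * cnj (q k) * E k j)))"
  proof (intro sum.cong refl)
    fix i j assume "i \<in> {..<n}"
    have "(\<Sum>k<n. (\<Sum>q\<leftarrow>qs. cnj (E i j) * q i * cnj (q k) * E k j))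
        = cnj (E i j) * (\<Sum>k<n. ((if k = i then 1 else 0) - Q i k) * E k j)"
      unfolding sum_distrib_left Q pull by (intro sum.cong refl) (auto simp: mult.assoc)
    also have "(\<Sum>k<n. ((if k = i then 1 else 0) - Q i k) * E k j) = E i j - (\<Sum>k<n. Q i k * E k j)"
    proof -
      have "(\<Sum>k<n. (if k = i then 1 else 0) * E k j) = (\<Sum>k<n. if k = i then E i j else 0)"
        by (intro sum.cong) auto
      then show ?thesis using \<open>i \<in> {..<n}\<close> by (simp add: left_diff_distrib sum_subtractf)
    qed
    finally show "cnj (E i j) * E i j = cnj (E i j) * (\<Sum>k<n. Q i k * E k j)
      + (\<Sum>k<n. (\<Sum>q\<leftarrow>qs. cnj (E i j) * q i * cnj (q k) * E k j))"
      by (simp add: algebra_simps)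
  qed
  also have "\<dots> = (\<Sum>i<n. \<Sum>j<n. cnj (E i j) * (\<Sum>k<n. Q i k * E k j))
      + of_real (\<Sum>q\<leftarrow>qs. (vnorm n (\<lambda>j. \<Sum>k<n. cnj (q k) * E k j))\<^sup>2)"
    by (simp only: sum.distrib tr2)
  finally have eq: "complex_of_real (\<Sum>i<n. \<Sum>j<n. (cmod (E i j))\<^sup>2) = \<dots>" .
  have "(\<Sum>i<n. \<Sum>j<n. (cmod (E i j))\<^sup>2) = cmod (complex_of_real (\<Sum>i<n. \<Sum>j<n. (cmod (E i j))\<^sup>2))"
    by (simp only: norm_of_real) (simp add: sum_nonneg)
  also have "\<dots> \<le> c * \<delta> + \<bar>\<Sum>q\<leftarrow>qs. (vnorm n (\<lambda>j. \<Sum>k<n. cnj (q k) * E k j))\<^sup>2\<bar>"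
    unfolding eq using tr1 by (intro norm_triangle_le add_mono) (simp_all only: norm_of_real order_refl)
  also have "\<bar>\<Sum>q\<leftarrow>qs. (vnorm n (\<lambda>j. \<Sum>k<n. cnj (q k) * E k j))\<^sup>2\<bar> \<le> c\<^sup>2 * r"
  proof -
    have "(\<Sum>q\<leftarrow>qs. (vnorm n (\<lambda>j. \<Sum>k<n. cnj (q k) * E k j))\<^sup>2) \<le> (\<Sum>q\<leftarrow>qs. c\<^sup>2)"
      by (intro sum_list_mono op')
    also have "\<dots> = c\<^sup>2 * length qs" by (simp add: sum_list_triv)
    also have "\<dots> \<le> c\<^sup>2 * r"
      using len ys by (intro mult_left_mono) (auto simp: ys'_def)
    finally show ?thesis
      using sum_list_nonneg[of "map (\<lambda>q. (vnorm n (\<lambda>j. \<Sum>k<n. cnj (q k) * E k j))\<^sup>2) qs"] by fastforce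
  qed
  finally show ?thesis by simp
qed

text \<open>The weights \<open>s\<^sub>i\<close>, \<open>t\<^sub>j\<close> turn the difference of the eigenvalues into their chordal
  distance on the Riemann sphere. They make the matrix \<open>E\<close> bounded, so a perturbation of small
  rank contributes little even if its norm is large.\<close>

lemma chordal_distance_sum:
  fixes \<xi> \<mu> :: "nat \<Rightarrow> complex"
  assumes U: "unitary_fun n u" and V: "unitary_fun n v"
    and A: "\<And>i j. i < n \<Longrightarrow> j < n \<Longrightarrow> (\<Sum>k<n. cnj (u k i) * A k j) = \<xi> i * cnj (u j i)"
    and AV: "\<And>i j. i < n \<Longrightarrow> j < n \<Longrightarrow> mprod n A v i j - v i j * \<mu> j = R i j + T i j"
    and R: "rank_le n r R" and T: "trace_le n \<delta> T"
  defines "w \<equiv> (\<lambda>i j. \<Sum>k<n. cnj (u k i) * v k j)"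
  shows "(\<Sum>i<n. \<Sum>j<n. (cmod (w i j))\<^sup>2 *
      ((cmod (\<xi> i - \<mu> j))\<^sup>2 / ((1 + (cmod (\<xi> i))\<^sup>2) * (1 + (cmod (\<mu> j))\<^sup>2)))) \<le> 4 * r + 2 * \<delta>"
proof -
  define s where "s = (\<lambda>i. complex_of_real (1 / sqrt (1 + (cmod (\<xi> i))\<^sup>2)))"
  define t where "t = (\<lambda>j. complex_of_real (1 / sqrt (1 + (cmod (\<mu> j))\<^sup>2)))"
  \<comment> \<open>The product of diag(s), diag(\<xi>) W - W diag(\<mu>) and diag(t), written as a
    difference of two contractions: s, t, s \<xi> and t \<mu> all have modulus at most 1. The
    resulting norm bound 2 is the origin of the constants 4 = 2^2 and 2 in the conclusion.\<close>
  define E where "E = (\<lambda>i j. s i * \<xi> i * w i j * t j + - (s i * w i j * (t j * \<mu> j)))"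
  have le1: "cmod (complex_of_real (1 / sqrt (1 + (cmod z)\<^sup>2))) \<le> 1" for z
    unfolding norm_of_real by (simp add: divide_le_eq_1 add_pos_nonneg)
  have le2: "cmod (complex_of_real (1 / sqrt (1 + (cmod z)\<^sup>2)) * z) \<le> 1" for z
  proof -
    have "cmod z \<le> sqrt (1 + (cmod z)\<^sup>2)" by (rule real_le_rsqrt) simp
    moreover have "0 < sqrt (1 + (cmod z)\<^sup>2)" by (simp add: add_pos_nonneg)
    ultimately show ?thesis unfolding norm_mult norm_of_real by (simp add: divide_simps)
  qed
  have w: "op_bound n 1 w"
  proof -
    have "op_bound n (1 * 1) (mprod n (adjm u) v)"
      by (intro op_bound_mprod op_bound_adjm op_bound_unitary U V)
    then show ?thesis by (simp add: mprod_def adjm_def w_def)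
  qed
  have E: "op_bound n 2 E"
  proof -
    have "op_bound n (1 * (1 * 1) + 1 * (1 * 1)) E"
      unfolding E_def
      by (intro op_bound_add op_bound_minus op_bound_diag_right op_bound_diag_left w)
         (simp_all only: s_def t_def le1 le2 zero_le_one)
    then show ?thesis by simp
  qed
  define Y where "Y = (\<lambda>i k. s i * adjm u i k)"
  have Y: "op_bound n 1 Y"
  proof -
    have "op_bound n (1 * 1) Y"
      unfolding Y_def by (intro op_bound_diag_left op_bound_adjm op_bound_unitary U) (simp_all only: s_def le1 zero_le_one)
    then show ?thesis by simp
  qed
  define D where "D = (\<lambda>i j. mprod n A v i j - v i j * \<mu> j)"
  have ET: "E i j = mprod n Y D i j * t j" if "i < n" "j < n" for i j
  proof -
    \<comment> \<open>U^* A = diag(\<xi>) U^* turns U^* A V into diag(\<xi>) W, so that E is a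
      two-sided product with the difference \<open>D\<close>.\<close>
    have "(\<Sum>k<n. cnj (u k i) * mprod n A v k j) = (\<Sum>l<n. (\<Sum>k<n. cnj (u k i) * A k l) * v l j)"
      unfolding mprod_def sum_distrib_left sum_distrib_right by (subst sum.swap) (simp add: mult.assoc)
    also have "\<dots> = \<xi> i * w i j"
      unfolding w_def sum_distrib_left using that by (intro sum.cong refl) (simp add: A)
    finally have 1: "(\<Sum>k<n. cnj (u k i) * mprod n A v k j) = \<xi> i * w i j" .
    have "mprod n Y D i j = (\<Sum>k<n. s i * cnj (u k i) * (mprod n A v k j - v k j * \<mu> j))"
      by (subst mprod_def) (simp add: Y_def D_def adjm_def)
    also have "\<dots> = s i * ((\<Sum>k<n. cnj (u k i) * mprod n A v k j) - w i j * \<mu> j)"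
      unfolding w_def
      by (simp add: sum_distrib_left sum_distrib_right right_diff_distrib sum_subtractf mult_ac)
    finally have 2: "mprod n Y D i j = s i * ((\<Sum>k<n. cnj (u k i) * mprod n A v k j) - w i j * \<mu> j)" .
    show ?thesis
      unfolding 2 1 by (simp add: E_def algebra_simps)
  qed
  have "(\<Sum>i<n. \<Sum>j<n. (cmod (E i j))\<^sup>2) \<le> 2\<^sup>2 * real r + 2 * \<delta>"
    by (rule frobenius_bound[OF E ET _ R T Y]) (simp_all only: D_def AV t_def le1)
  moreover have "(cmod (E i j))\<^sup>2 = (cmod (w i j))\<^sup>2 *
      ((cmod (\<xi> i - \<mu> j))\<^sup>2 / ((1 + (cmod (\<xi> i))\<^sup>2) * (1 + (cmod (\<mu> j))\<^sup>2)))" for i j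
  proof -
    have "E i j = s i * t j * w i j * (\<xi> i - \<mu> j)" by (simp add: E_def algebra_simps)
    moreover have "(cmod (complex_of_real (1 / sqrt (1 + (cmod z)\<^sup>2))))\<^sup>2 = 1 / (1 + (cmod z)\<^sup>2)" for z
      unfolding norm_of_real by (simp add: power_divide)
    ultimately show ?thesis
      by (simp only: norm_mult power_mult_distrib s_def t_def) (simp add: field_simps)
  qed
  ultimately show ?thesis by simp
qed

section \<open>The spectral theorem for normal matrices\<close>

lemma mprod_assoc: "mprod n (mprod n X Y) Z = mprod n X (mprod n Y Z)"
  unfolding mprod_def sum_distrib_left sum_distrib_right
  by (intro ext, subst sum.swap) (simp add: mult.assoc)

lemma adjm_mprod: "adjm (mprod n X Y) = mprod n (adjm Y) (adjm X)"
  by (simp add: adjm_def mprod_def mult.commute)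

lemma adjm_adjm [simp]: "adjm (adjm X) = X"
  by (simp add: adjm_def)

lemma mprod_cong_right: "(\<And>k. k < n \<Longrightarrow> Y k j = Z k j) \<Longrightarrow> mprod n X Y i j = mprod n X Z i j"
  by (simp add: mprod_def)

lemma mprod_cong_left: "(\<And>k. k < n \<Longrightarrow> Y i k = Z i k) \<Longrightarrow> mprod n Y X i j = mprod n Z X i j"
  by (simp add: mprod_def)

lemma mprod_delta_left: "i < n \<Longrightarrow> mprod n (\<lambda>i j. if i = j then 1 else 0) X i j = X i j"
  by (simp add: mprod_def if_distrib[of "\<lambda>x. x * _"] cong: if_cong)

lemma unitary_fun_iff:
  "unitary_fun n u \<longleftrightarrow>
     (\<forall>i<n. \<forall>j<n. mprod n (adjm u) u i j = (if i = j then 1 else 0)) \<and>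
     (\<forall>i<n. \<forall>j<n. mprod n u (adjm u) i j = (if i = j then 1 else 0))"
  by (simp add: unitary_fun_def mprod_def adjm_def)

lemma index_mult_mat_sum:
  fixes A B :: "complex mat"
  assumes "A \<in> carrier_mat n n" "B \<in> carrier_mat n n" "i < n" "j < n"
  shows "(A * B) $$ (i, j) = (\<Sum>k<n. A $$ (i, k) * B $$ (k, j))"
  using assms by (simp add: scalar_prod_def atLeast0LessThan)

text \<open>A one-sided inverse of a square matrix is two-sided; the detour through genuine matrices
  serves to quote that fact.\<close>

lemma unitary_funI:
  assumes "\<And>i j. i < n \<Longrightarrow> j < n \<Longrightarrow> (\<Sum>k<n. cnj (u k i) * u k j) = (if i = j then 1 else 0)"
  shows "unitary_fun n u"
proof -
  define P where "P = mat n n (\<lambda>(i, j). u i j)"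
  define Q where "Q = mat n n (\<lambda>(i, j). cnj (u j i))"
  have PQ: "P \<in> carrier_mat n n" "Q \<in> carrier_mat n n" by (auto simp: P_def Q_def)
  have "(Q * P) $$ (i, j) = (if i = j then 1 else 0)" if "i < n" "j < n" for i j
    unfolding index_mult_mat_sum[OF PQ(2,1) that] using that assms by (simp add: P_def Q_def)
  then have "Q * P = 1\<^sub>m n"
    using PQ by (auto intro!: eq_matI simp del: index_mult_mat(1))
  then have inv: "P * Q = 1\<^sub>m n" by (rule mat_mult_left_right_inverse[OF PQ(2,1)])
  have "(\<Sum>k<n. u i k * cnj (u j k)) = (if i = j then 1 else 0)" if "i < n" "j < n" for i j
    using index_mult_mat_sum[OF PQ that] that unfolding inv by (simp add: P_def Q_def)
  with assms show ?thesis unfolding unitary_fun_def by blast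
qed

lemma unitary_cancel:
  assumes "unitary_fun n u" "i < n"
  shows "mprod n u (mprod n (adjm u) X) i j = X i j" "mprod n (adjm u) (mprod n u X) i j = X i j"
proof -
  have "mprod n u (adjm u) i k = (if i = k then 1 else 0)" "mprod n (adjm u) u i k = (if i = k then 1 else 0)"
    if "k < n" for k
    using assms that by (auto simp: unitary_fun_def mprod_def adjm_def)
  then have "mprod n (mprod n u (adjm u)) X i j = mprod n (\<lambda>i j. if i = j then 1 else 0) X i j"
    "mprod n (mprod n (adjm u) u) X i j = mprod n (\<lambda>i j. if i = j then 1 else 0) X i j"
    by (auto intro: mprod_cong_left)
  then show "mprod n u (mprod n (adjm u) X) i j = X i j" "mprod n (adjm u) (mprod n u X) i j = X i j"
    using \<open>i < n\<close> by (simp_all add: mprod_assoc mprod_delta_left)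
qed

lemma unitary_fun_mprod:
  assumes u: "unitary_fun n u" and v: "unitary_fun n v"
  shows "unitary_fun n (mprod n u v)"
proof -
  have "mprod n (adjm (mprod n u v)) (mprod n u v) i j = (if i = j then 1 else 0)" if "i < n" "j < n" for i j
  proof -
    have "mprod n (adjm (mprod n u v)) (mprod n u v) i j = mprod n (adjm v) (mprod n (adjm u) (mprod n u v)) i j"
      by (simp add: adjm_mprod mprod_assoc)
    also have "\<dots> = mprod n (adjm v) v i j"
      by (intro mprod_cong_right unitary_cancel u)
    finally show ?thesis using v that by (simp add: unitary_fun_iff)
  qed
  moreover have "(\<Sum>k<n. cnj (x k i) * x k j) = mprod n (adjm x) x i j" for x i j
    by (simp add: mprod_def adjm_def)
  ultimately show ?thesis
    by (intro unitary_funI) (simp only:)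
qed

section \<open>Unitary diagonalization of a normal matrix\<close>

text \<open>A Householder reflection: for x = cv - e_0 one has |x|^2 = 2d, so the identity minus x
  x^* / d is unitary, and it sends e_0 to cv.\<close>

lemma unitary_with_first_column:
  assumes "vnorm n v = 1" "0 < n"
  shows "\<exists>u c. unitary_fun n u \<and> cmod c = 1 \<and> (\<forall>i<n. u i 0 = c * v i)"
proof -
  \<comment> \<open>This phase makes \<open>c * v 0\<close> real and nonpositive, so
    \<open>x 0\<close> is -(1 + |v 0|) and the divisor d is at least 1.\<close>
  define c where "c = (if v 0 = 0 then 1 else - cnj (v 0) / cmod (v 0))"
  have c: "cmod c = 1" by (simp add: c_def norm_divide)
  have cv0: "c * v 0 = - of_real (cmod (v 0))"
    by (simp add: c_def complex_norm_square[symmetric] power2_eq_square mult.commute[of "cnj _"])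
  define x where "x = (\<lambda>i. c * v i - (if i = 0 then 1 else 0))"
  define d where "d = 1 + cmod (v 0)"
  have "0 < d" by (simp add: d_def add_pos_nonneg)
  have x0: "x 0 = - of_real d" by (simp add: x_def cv0 d_def)
  have xx: "(\<Sum>i<n. cnj (x i) * x i) = of_real (2 * d)"
  proof -
    obtain m where m: "n = Suc m" using \<open>0 < n\<close> by (cases n) auto
    have "(\<Sum>i<n. cnj (c * v i) * (c * v i)) = of_real ((vnorm n (\<lambda>i. c * v i))\<^sup>2)"
      by (rule vnorm_power2_complex[symmetric])
    also have "\<dots> = 1" using assms c by (simp add: vnorm_scale)
    finally have "(\<Sum>i<n. cnj (c * v i) * (c * v i)) = 1" .
    then have "(\<Sum>i<m. cnj (x (Suc i)) * x (Suc i)) = 1 - cnj (c * v 0) * (c * v 0)"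
      unfolding m sum.lessThan_Suc_shift by (simp add: x_def algebra_simps)
    then have "(\<Sum>i<n. cnj (x i) * x i) = of_real (d * d) + (1 - of_real (cmod (v 0)) * of_real (cmod (v 0)))"
      unfolding m sum.lessThan_Suc_shift cv0 by (simp add: x0)
    then show ?thesis by (simp add: d_def algebra_simps)
  qed
  define u where "u = (\<lambda>i j. (if i = j then 1 else 0) - x i * cnj (x j) / of_real d)"
  have herm: "cnj (u j i) = u i j" for i j
    by (simp add: u_def mult.commute)
  have "(\<Sum>k<n. u i k * u k j) = (if i = j then 1 else 0)" if "i < n" "j < n" for i j
  proof -
    have "(\<Sum>k<n. u i k * u k j) = (\<Sum>k<n. (if i = k then (if i = j then 1 else 0) else 0))
       - (\<Sum>k<n. if i = k then x i * cnj (x j) / d else 0)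
       - (\<Sum>k<n. if k = j then x i * cnj (x j) / d else 0)
       + (\<Sum>k<n. x i * cnj (x j) / (of_real d * of_real d) * (cnj (x k) * x k))"
      unfolding sum.distrib[symmetric] sum_subtractf[symmetric]
      by (intro sum.cong refl) (auto simp: u_def algebra_simps)
    also have "\<dots> = (if i = j then 1 else 0)"
      using that \<open>0 < d\<close> unfolding sum_distrib_left[symmetric] xx by (simp add: field_simps)
    finally show ?thesis .
  qed
  then have "unitary_fun n u"
    unfolding unitary_fun_def herm by simp
  moreover have "u i 0 = c * v i" if "i < n" for i
    using \<open>0 < d\<close> by (auto simp: u_def x0) (auto simp: x_def cv0 d_def)
  ultimately show ?thesis using c by blast
qed

lemma eigenvector_exists:
  fixes a :: "nat \<Rightarrow> nat \<Rightarrow> complex"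
  assumes "0 < n"
  shows "\<exists>e v. vnorm n v = 1 \<and> (\<forall>i<n. (\<Sum>j<n. a i j * v j) = e * v i)"
proof -
  define A where "A = mat n n (\<lambda>(i, j). a i j)"
  have A: "A \<in> carrier_mat n n" by (simp add: A_def)
  obtain es where es: "char_poly A = (\<Prod>e\<leftarrow>es. [:- e, 1:])" "length es = n"
    using char_poly_factorized[OF A] by blast
  with \<open>0 < n\<close> obtain e es' where "es = e # es'" by (cases es) auto
  then have "poly (char_poly A) e = 0" by (simp add: es)
  then have "eigenvalue A e" by (simp add: eigenvalue_root_char_poly[OF A])
  then obtain w where w: "w \<in> carrier_vec n" "w \<noteq> 0\<^sub>v n" "A *\<^sub>v w = e \<cdot>\<^sub>v w"
    using A by (auto simp: eigenvalue_def eigenvector_def)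
  define v where "v = vec_index w"
  have av: "(\<Sum>j<n. a i j * v j) = e * v i" if "i < n" for i
    using arg_cong[OF w(3), of "\<lambda>x. vec_index x i"] w(1) that
    by (simp add: A_def v_def scalar_prod_def atLeast0LessThan)
  have "vnorm n v \<noteq> 0"
  proof
    assume "vnorm n v = 0"
    then have "(\<Sum>i<n. (cmod (v i))\<^sup>2) = 0" by (simp flip: vnorm_power2)
    then have "\<forall>i<n. v i = 0" by (subst (asm) sum_nonneg_eq_0_iff) auto
    then have "w = 0\<^sub>v n" using w(1) by (intro eq_vecI) (auto simp: v_def)
    with w(2) show False by simp
  qed
  then have "vnorm n (\<lambda>i. of_real (1 / vnorm n v) * v i) = 1"
    unfolding vnorm_scale norm_of_real by simp
  moreover have "(\<Sum>j<n. a i j * (of_real (1 / vnorm n v) * v j)) = e * (of_real (1 / vnorm n v) * v i)"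
    if "i < n" for i
    using arg_cong[OF av[OF that], of "(*) (of_real (1 / vnorm n v))"]
    by (simp add: sum_distrib_left mult_ac)
  ultimately show ?thesis by (intro exI conjI allI impI) assumption+
qed

text \<open>Deflation: conjugation by a unitary whose first column is an eigenvector clears the
  first column below the diagonal, and normality then clears the first row as well. So the remaining
  block is normal and the induction applies to it.\<close>

lemma normal_diagonalization:
  assumes "\<And>i j. i < n \<Longrightarrow> j < n \<Longrightarrow> mprod n a (adjm a) i j = mprod n (adjm a) a i j"
  shows "\<exists>u \<xi>. unitary_fun n u \<and> (\<forall>i<n. \<forall>j<n. mprod n (adjm u) a i j = \<xi> i * adjm u i j)"
  using assms
proof (induction n arbitrary: a)
  case 0
  show ?case by (auto simp: unitary_fun_def)
next
  case (Suc m)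
  let ?n = "Suc m"
  obtain e v where "vnorm ?n v = 1" and ev: "\<And>i. i < ?n \<Longrightarrow> (\<Sum>j<?n. a i j * v j) = e * v i"
    using eigenvector_exists[of ?n a] by auto
  then obtain w c where w: "unitary_fun ?n w" and wv: "\<And>i. i < ?n \<Longrightarrow> w i 0 = c * v i"
    using unitary_with_first_column[of ?n v] by auto
  define b where "b = mprod ?n (adjm w) (mprod ?n a w)"
  have adjb: "adjm b = mprod ?n (adjm w) (mprod ?n (adjm a) w)"
    by (simp add: b_def adjm_mprod mprod_assoc)
  have norm_b: "mprod ?n b (adjm b) i j = mprod ?n (adjm b) b i j" if "i < ?n" "j < ?n" for i j
  proof -
    have 1: "mprod ?n w (mprod ?n (adjm w) X) k l = X k l" if "k < ?n" for k l X
      using unitary_cancel(1)[OF w that] .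
    have "mprod ?n b (adjm b) i j = mprod ?n (adjm w) (mprod ?n a (mprod ?n w (adjm b))) i j"
      by (simp add: b_def mprod_assoc)
    also have "\<dots> = mprod ?n (adjm w) (mprod ?n a (mprod ?n (adjm a) w)) i j"
      unfolding adjb by (intro mprod_cong_right 1)
    also have "\<dots> = mprod ?n (adjm w) (mprod ?n (mprod ?n a (adjm a)) w) i j"
      by (simp only: mprod_assoc)
    also have "\<dots> = mprod ?n (adjm w) (mprod ?n (mprod ?n (adjm a) a) w) i j"
      by (intro mprod_cong_right mprod_cong_left Suc.prems)
    also have "\<dots> = mprod ?n (adjm w) (mprod ?n (adjm a) (mprod ?n a w)) i j"
      by (simp only: mprod_assoc)
    also have "\<dots> = mprod ?n (adjm w) (mprod ?n (adjm a) (mprod ?n w b)) i j"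
      unfolding b_def by (intro mprod_cong_right 1[symmetric])
    also have "\<dots> = mprod ?n (adjm b) b i j"
      by (simp add: adjb mprod_assoc)
    finally show ?thesis .
  qed
  have col0: "b i 0 = (if i = 0 then e else 0)" if "i < ?n" for i
  proof -
    have "mprod ?n a w k 0 = w k 0 * e" if "k < ?n" for k
      unfolding mprod_def using ev[OF that] wv
      by (simp add: that mult.left_commute[of _ c] sum_distrib_left[symmetric] del: sum.lessThan_Suc)
    moreover have "b i 0 = (\<Sum>k<?n. cnj (w k i) * mprod ?n a w k 0)"
      unfolding b_def by (subst mprod_def) (simp add: adjm_def del: sum.lessThan_Suc)
    ultimately have "b i 0 = (\<Sum>k<?n. cnj (w k i) * w k 0) * e"
      by (simp add: sum_distrib_right mult.assoc del: sum.lessThan_Suc)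
    then show ?thesis using w that by (auto simp: unitary_fun_def simp del: sum.lessThan_Suc)
  qed
  \<comment> \<open>Entry (0,0) of b b^* = b^* b: on the left the squared norm of row 0, on the
    right that of column 0, which is |e|^2.\<close>
  have row0: "b 0 (Suc j) = 0" if "j < m" for j
  proof -
    have "(\<Sum>j<m. b 0 (Suc j) * cnj (b 0 (Suc j))) = 0"
      using norm_b[of 0 0] col0
      by (simp add: mprod_def adjm_def sum.lessThan_Suc_shift mult.commute del: sum.lessThan_Suc)
    then have "complex_of_real (\<Sum>j<m. (cmod (b 0 (Suc j)))\<^sup>2) = 0"
      by (simp add: complex_norm_square del: of_real_power)
    then have "(\<Sum>j<m. (cmod (b 0 (Suc j)))\<^sup>2) = 0"
      by (simp only: of_real_eq_0_iff)
    then show ?thesis using that by (subst (asm) sum_nonneg_eq_0_iff) auto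
  qed
  define b' where "b' = (\<lambda>i j. b (Suc i) (Suc j))"
  have "mprod m b' (adjm b') i j = mprod m (adjm b') b' i j" if "i < m" "j < m" for i j
    using norm_b[of "Suc i" "Suc j"] that col0 row0
    by (simp add: mprod_def adjm_def sum.lessThan_Suc_shift b'_def del: sum.lessThan_Suc)
  from Suc.IH[OF this] obtain u' \<xi>' where u': "unitary_fun m u'"
    and eig': "\<And>i j. i < m \<Longrightarrow> j < m \<Longrightarrow> mprod m (adjm u') b' i j = \<xi>' i * adjm u' i j"
    by blast
  \<comment> \<open>The unitary of the smaller block, bordered by 1.\<close>
  define y where "y = (\<lambda>i j. case i of 0 \<Rightarrow> (case j of 0 \<Rightarrow> 1 | Suc j \<Rightarrow> 0)
      | Suc i \<Rightarrow> (case j of 0 \<Rightarrow> 0 | Suc j \<Rightarrow> u' i j))"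
  have y: "unitary_fun ?n y"
  proof -
    have 1: "(\<Sum>k<m. cnj (u' k i) * u' k j) = (if i = j then 1 else 0)"
        "(\<Sum>k<m. u' i k * cnj (u' j k)) = (if i = j then 1 else 0)" if "i < m" "j < m" for i j
      using u' that unfolding unitary_fun_def by auto
    show ?thesis
      unfolding unitary_fun_def
      by (auto simp: sum.lessThan_Suc_shift y_def less_Suc_eq_0_disj 1 simp del: sum.lessThan_Suc split: if_splits)
  qed
  define \<xi> where "\<xi> = (\<lambda>i. case i of 0 \<Rightarrow> e | Suc i \<Rightarrow> \<xi>' i)"
  have eig: "mprod ?n (adjm y) b i j = \<xi> i * adjm y i j" if "i < ?n" "j < ?n" for i j
  proof (cases i)
    case 0
    then show ?thesis using that col0 row0
      by (cases j) (auto simp: mprod_def adjm_def \<xi>_def sum.lessThan_Suc_shift y_def simp del: sum.lessThan_Suc)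
  next
    case (Suc i')
    then show ?thesis using that col0 eig'[of i' "j - 1"]
      by (cases j) (auto simp: mprod_def adjm_def \<xi>_def sum.lessThan_Suc_shift y_def b'_def simp del: sum.lessThan_Suc)
  qed
  define u where "u = mprod ?n w y"
  have "mprod ?n (adjm u) a i j = \<xi> i * adjm u i j" if "i < ?n" "j < ?n" for i j
  proof -
    have "mprod ?n (adjm u) a i j = mprod ?n (adjm y) (mprod ?n (adjm w) a) i j"
      by (simp add: u_def adjm_mprod mprod_assoc)
    also have "\<dots> = mprod ?n (adjm y) (mprod ?n b (adjm w)) i j"
    proof (rule mprod_cong_right)
      fix k assume "k < ?n"
      have "mprod ?n a (mprod ?n w (adjm w)) l j = a l j" for l
      proof -
        have "mprod ?n a (mprod ?n w (adjm w)) l j = (\<Sum>k<?n. if k = j then a l k else 0)"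
          unfolding mprod_def[of _ a] using w \<open>j < ?n\<close>
          by (intro sum.cong refl) (auto simp: unitary_fun_def mprod_def adjm_def simp del: sum.lessThan_Suc)
        then show ?thesis using \<open>j < ?n\<close> by (simp del: sum.lessThan_Suc)
      qed
      then show "mprod ?n (adjm w) a k j = mprod ?n b (adjm w) k j"
        unfolding b_def mprod_assoc by (intro mprod_cong_right) simp
    qed
    also have "\<dots> = mprod ?n (mprod ?n (adjm y) b) (adjm w) i j"
      by (simp only: mprod_assoc)
    also have "\<dots> = mprod ?n (\<lambda>i j. \<xi> i * adjm y i j) (adjm w) i j"
      using that by (intro mprod_cong_left eig)
    also have "\<dots> = \<xi> i * adjm u i j"
      unfolding u_def adjm_mprod by (simp add: mprod_def sum_distrib_left mult.assoc del: sum.lessThan_Suc)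
    finally show ?thesis .
  qed
  moreover have "unitary_fun ?n u"
    unfolding u_def by (rule unitary_fun_mprod[OF w y])
  ultimately show ?case by blast
qed

text \<open>The similarity to diag(\<xi>) is established on genuine matrices because the \<xi> have
  to be matched with the roots of the characteristic polynomial, including multiplicities.\<close>

lemma normal_mat_spectral:
  assumes A: "A \<in> carrier_mat n n" and N: "normal_mat A"
  shows "\<exists>u \<xi>. unitary_fun n u \<and>
     (\<forall>i<n. \<forall>j<n. (\<Sum>k<n. cnj (u k i) * A $$ (k, j)) = \<xi> i * cnj (u j i)) \<and>
     proots (char_poly A) = mset (map \<xi> [0..<n])"
proof -
  define a where "a = (\<lambda>i j. A $$ (i, j))"
  have adj: "mat_adjoint A \<in> carrier_mat n n" "i < n \<Longrightarrow> j < n \<Longrightarrow> mat_adjoint A $$ (i, j) = cnj (A $$ (j, i))" for i j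
    using A by (auto simp: mat_adjoint_def mat_of_rows_def)
  have "mprod n a (adjm a) i j = mprod n (adjm a) a i j" if "i < n" "j < n" for i j
    using arg_cong[OF N[unfolded normal_mat_def], of "\<lambda>X. X $$ (i, j)"] that
    by (simp add: index_mult_mat_sum[OF A adj(1)] index_mult_mat_sum[OF adj(1) A] adj a_def mprod_def adjm_def)
  from normal_diagonalization[OF this] obtain u \<xi> where u: "unitary_fun n u"
    and eig: "\<And>i j. i < n \<Longrightarrow> j < n \<Longrightarrow> mprod n (adjm u) a i j = \<xi> i * adjm u i j"
    by blast
  define P where "P = mat n n (\<lambda>(i, j). u i j)"
  define Q where "Q = mat n n (\<lambda>(i, j). adjm u i j)"
  have PQ: "P \<in> carrier_mat n n" "Q \<in> carrier_mat n n" by (auto simp: P_def Q_def)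
  have D: "mat_diag n \<xi> \<in> carrier_mat n n" by simp
  have A_eq: "A = P * mat_diag n \<xi> * Q"
  proof (rule eq_matI)
    fix i j assume "i < dim_row (P * mat_diag n \<xi> * Q)" "j < dim_col (P * mat_diag n \<xi> * Q)"
    then have ij: "i < n" "j < n" using PQ by auto
    have "(P * mat_diag n \<xi>) $$ (i, k) = u i k * \<xi> k" if "k < n" for k
      using ij that by (subst mat_diag_mult_right[OF PQ(1)]) (simp add: P_def)
    then have "(P * mat_diag n \<xi> * Q) $$ (i, j) = (\<Sum>k<n. u i k * (\<xi> k * adjm u k j))"
      using ij by (subst index_mult_mat_sum[OF mult_carrier_mat[OF PQ(1) D] PQ(2)])
        (auto simp: Q_def mult.assoc)
    also have "\<dots> = mprod n u (mprod n (adjm u) a) i j"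
      using ij by (subst mprod_def) (simp add: eig)
    also have "\<dots> = A $$ (i, j)" using unitary_cancel(1)[OF u ij(1)] by (simp add: a_def)
    finally show "A $$ (i, j) = (P * mat_diag n \<xi> * Q) $$ (i, j)" by simp
  qed (use A PQ in auto)
  have "(P * Q) $$ (i, j) = (if i = j then 1 else 0)" "(Q * P) $$ (i, j) = (if i = j then 1 else 0)"
    if "i < n" "j < n" for i j
    using that u unfolding index_mult_mat_sum[OF PQ that] index_mult_mat_sum[OF PQ(2) PQ(1) that]
    by (simp_all add: P_def Q_def adjm_def unitary_fun_def)
  then have "P * Q = 1\<^sub>m n" "Q * P = 1\<^sub>m n"
    using PQ by (auto intro!: eq_matI simp del: index_mult_mat(1))
  then have "similar_mat A (mat_diag n \<xi>)"
    unfolding similar_mat_def using similar_mat_witI[OF _ _ A_eq A D PQ] by blast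
  then have "char_poly A = char_poly (mat_diag n \<xi>)" by (rule char_poly_similar)
  also have "\<dots> = (\<Prod>e\<leftarrow>map \<xi> [0..<n]. [:- e, 1:])"
  proof -
    have "upper_triangular (mat_diag n \<xi>)" by (auto simp: mat_diag_def)
    moreover have "diag_mat (mat_diag n \<xi>) = map \<xi> [0..<n]" by (auto simp: diag_mat_def mat_diag_def)
    ultimately show ?thesis using char_poly_upper_triangular[OF D] by simp
  qed
  finally have cp: "char_poly A = (\<Prod>e\<leftarrow>map \<xi> [0..<n]. [:- e, 1:])" .
  have "proots (\<Prod>e\<leftarrow>es. [:- e, 1:]) = mset es" for es :: "complex list"
  proof (induction es)
    case (Cons e es)
    have "(\<Prod>e\<leftarrow>es. [:- e, 1:]) \<noteq> (0 :: complex poly)" by (auto simp: prod_list_zero_iff)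
    then have "proots ([:- e, 1:] * (\<Prod>e\<leftarrow>es. [:- e, 1:])) = {#e#} + mset es"
      using Cons by (subst proots_mult) auto
    then show ?case by simp
  qed simp
  then have "proots (char_poly A) = mset (map \<xi> [0..<n])" by (simp only: cp)
  then show ?thesis
    using u eig by (intro exI[of _ u] exI[of _ \<xi>]) (auto simp: mprod_def adjm_def a_def)
qed

section \<open>Rank and spectral norm of genuine matrices\<close>

text \<open>A maximal independent set of columns has as many elements as the rank and spans every
  column, so a row vector that annihilates it annihilates the whole matrix.\<close>

lemma rank_le_vec_space_rank:
  assumes R: "R \<in> carrier_mat n n"
  shows "rank_le n (vec_space.rank n R) (\<lambda>i j. R $$ (i, j))"
proof -
  interpret vec_space "TYPE(complex)" n .
  have cols: "set (cols R) \<subseteq> carrier_vec n" using R cols_dim by blast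
  have "lin_indpt {}" by (simp add: lin_dep_def)
  then obtain S where S: "maximal S (\<lambda>T. T \<subseteq> set (cols R) \<and> lin_indpt T)" "finite S"
    using maximal_exists_superset[of "set (cols R)" "\<lambda>T. T \<subseteq> set (cols R) \<and> lin_indpt T" "{}"] by auto
  then have Sc: "S \<subseteq> set (cols R)" "lin_indpt S" by (auto simp: maximal_def)
  then have SC: "S \<subseteq> carrier_vec n" using cols by blast
  have rank: "rank R = card S" by (rule rank_card_indpt[OF R S(1)])
  obtain xs where xs: "set xs = S" "length xs = card S"
    using finite_distinct_list[OF S(2)] distinct_card by metis
  show ?thesis
    unfolding rank_le_def
  proof (intro exI[of _ "map vec_index xs"] conjI allI impI)
    show "length (map vec_index xs) \<le> rank R" by (simp add: xs rank)
    fix z j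
    assume z: "\<forall>y\<in>set (map vec_index xs). (\<Sum>i<n. z i * y i) = 0" and "j < n"
    let ?c = "col R j"
    have c: "?c \<in> set (cols R)" using R \<open>j < n\<close> by (auto simp: cols_def)
    have "?c \<in> span S"
    proof (cases "?c \<in> S")
      case True then show ?thesis using span_mem[OF SC] by auto
    next
      case False
      have "lin_dep (S \<union> {?c})"
      proof (rule ccontr)
        assume "\<not> lin_dep (S \<union> {?c})"
        then have "S \<union> {?c} = S"
          using S(1) Sc c unfolding maximal_def by auto
        with False show False by auto
      qed
      then show ?thesis using lin_dep_iff_in_span[OF SC Sc(2) _ False] c cols by auto
    qed
    then obtain f B where B: "finite B" "B \<subseteq> S" "?c = lincomb f B"
      by (auto simp: span_def)
    have "(\<Sum>i<n. z i * R $$ (i, j)) = (\<Sum>i<n. z i * (\<Sum>x\<in>B. f x * vec_index x i))"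
    proof (intro sum.cong refl)
      fix i assume "i \<in> {..<n}"
      then have "R $$ (i, j) = vec_index ?c i" using R \<open>j < n\<close> by auto
      then show "z i * R $$ (i, j) = z i * (\<Sum>x\<in>B. f x * vec_index x i)"
        using B SC \<open>i \<in> {..<n}\<close> by (simp add: lincomb_index)
    qed
    also have "\<dots> = (\<Sum>x\<in>B. f x * (\<Sum>i<n. z i * vec_index x i))"
      unfolding sum_distrib_left by (subst sum.swap) (simp add: mult_ac)
    also have "\<dots> = 0"
      using z B(2) by (intro sum.neutral) (auto simp: xs)
    finally show "(\<Sum>i<n. z i * R $$ (i, j)) = 0" .
  qed
qed

lemma op_bound_spectral_norm:
  assumes N: "N \<in> carrier_mat n n" and "spectral_norm N \<le> c"
  shows "op_bound n c (\<lambda>i j. N $$ (i, j))"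
proof -
  have en: "euclid_norm v = vnorm n (vec_index v)" if "v \<in> carrier_vec n" for v
    using that by (simp add: euclid_norm_def vnorm_def)
  have Nv: "euclid_norm (N *\<^sub>v v) = vnorm n (\<lambda>i. \<Sum>j<n. N $$ (i, j) * vec_index v j)" if "v \<in> carrier_vec n" for v
  proof -
    have "N *\<^sub>v v \<in> carrier_vec n" by (rule mult_mat_vec_carrier[OF N that])
    then show ?thesis unfolding en[OF \<open>N *\<^sub>v v \<in> carrier_vec n\<close>]
      using N that by (intro vnorm_cong) (simp add: scalar_prod_def atLeast0LessThan)
  qed
  let ?B = "{v \<in> carrier_vec (dim_col N). euclid_norm v \<le> 1}"
  \<comment> \<open>The supremum dominates its members only if the set is bounded; the sum of the
    row norms is crude but enough.\<close>
  have bdd: "bdd_above ((\<lambda>v. euclid_norm (N *\<^sub>v v)) ` ?B)"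
  proof (rule bdd_aboveI2)
    fix v assume "v \<in> ?B"
    then have v: "v \<in> carrier_vec n" "vnorm n (vec_index v) \<le> 1" using N en by auto
    have "euclid_norm (N *\<^sub>v v) \<le> (\<Sum>i<n. cmod (\<Sum>j<n. N $$ (i, j) * vec_index v j))"
      unfolding Nv[OF v(1)] vnorm_def by (rule L2_set_le_sum) simp
    also have "\<dots> \<le> (\<Sum>i<n. vnorm n (\<lambda>j. N $$ (i, j)) * 1)"
      using v(2) by (intro sum_mono order_trans[OF cauchy_schwarz] mult_left_mono) auto
    finally show "euclid_norm (N *\<^sub>v v) \<le> (\<Sum>i<n. vnorm n (\<lambda>j. N $$ (i, j)) * 1)" .
  qed
  have le: "euclid_norm (N *\<^sub>v v) \<le> c" if "v \<in> carrier_vec n" "euclid_norm v \<le> 1" for v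
  proof -
    have "euclid_norm (N *\<^sub>v v) \<le> spectral_norm N"
      unfolding spectral_norm_def using that N by (intro cSUP_upper bdd) auto
    then show ?thesis using assms(2) by simp
  qed
  \<comment> \<open>Evaluation at the zero vector gives the sign of c even when n = 0.\<close>
  have "0 \<le> c"
    by (rule order_trans[OF _ le[of "0\<^sub>v n"]]) (simp_all add: euclid_norm_def L2_set_def sum_nonneg)
  show ?thesis
    unfolding op_bound_iff
  proof (intro conjI allI \<open>0 \<le> c\<close>)
    fix f
    show "vnorm n (\<lambda>i. \<Sum>j<n. N $$ (i, j) * f j) \<le> c * vnorm n f"
    proof (cases "vnorm n f = 0")
      case True
      then have "(\<Sum>i<n. (cmod (f i))\<^sup>2) = 0" by (simp flip: vnorm_power2)
      then have "\<forall>i<n. f i = 0" by (subst (asm) sum_nonneg_eq_0_iff) auto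
      then show ?thesis using True by (simp add: vnorm_def L2_set_def)
    next
      case False
      define v where "v = vec n (\<lambda>i. of_real (1 / vnorm n f) * f i)"
      have v: "v \<in> carrier_vec n" by (simp add: v_def)
      have "vnorm n (vec_index v) = vnorm n (\<lambda>i. of_real (1 / vnorm n f) * f i)"
        by (intro vnorm_cong) (simp add: v_def)
      also have "\<dots> = 1" unfolding vnorm_scale norm_of_real using False by simp
      finally have "euclid_norm (N *\<^sub>v v) \<le> c" using le[OF v] en[OF v] by simp
      also have "euclid_norm (N *\<^sub>v v) = vnorm n (\<lambda>i. of_real (1 / vnorm n f) * (\<Sum>j<n. N $$ (i, j) * f j))"
        unfolding Nv[OF v] by (intro vnorm_cong) (simp add: v_def sum_distrib_left mult_ac)
      also have "\<dots> = 1 / vnorm n f * vnorm n (\<lambda>i. \<Sum>j<n. N $$ (i, j) * f j)"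
        unfolding vnorm_scale norm_of_real by simp
      finally show ?thesis
        using False vnorm_nonneg[of n f] by (simp add: divide_le_eq less_le)
    qed
  qed
qed

text \<open>Each of the n diagonal entries of XT is the value of its form at a unit vector, hence at
  most c d in modulus.\<close>

lemma trace_le_op_bound:
  assumes "op_bound n d T"
  shows "trace_le n (d * n) T"
  unfolding trace_le_def
proof safe
  fix X c assume "op_bound n c X"
  then have XT: "op_bound n (c * d) (mprod n X T)" using assms by (rule op_bound_mprod)
  have "cmod (mprod n X T i i) \<le> c * d" if "i < n" for i
  proof -
    let ?e = "\<lambda>k. if k = i then 1 else (0::complex)"
    have e: "vnorm n ?e = 1"
      using that by (simp add: vnorm_def L2_set_def if_distrib[of "\<lambda>x. x\<^sup>2"] if_distrib[of cmod] cong: if_cong)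
    then have "cmod (\<Sum>k<n. \<Sum>j<n. ?e k * mprod n X T k j * ?e j) \<le> c * d"
      using XT[unfolded op_bound_def, THEN conjunct2, rule_format, of ?e ?e] by (simp only: e mult_1_right)
    also have "(\<Sum>k<n. \<Sum>j<n. ?e k * mprod n X T k j * ?e j) = (\<Sum>k<n. if k = i then mprod n X T i i else 0)"
      using that by (intro sum.cong refl) (simp add: if_distrib[of "\<lambda>x. _ * x"] cong: if_cong)
    also have "\<dots> = mprod n X T i i" using that by simp
    finally show ?thesis .
  qed
  then have "cmod (\<Sum>i<n. mprod n X T i i) \<le> (\<Sum>i<n. c * d)"
    by (intro order_trans[OF norm_sum] sum_mono) simp
  then show "cmod (\<Sum>i<n. \<Sum>j<n. X i j * T j i) \<le> c * (d * n)"
    by (simp add: mprod_def mult_ac)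
qed

section \<open>Toeplitz matrices and trigonometric polynomials\<close>

abbreviation circle_measure :: "real measure" where
  "circle_measure \<equiv> lebesgue_on {-pi..pi}"

lemma circle_integrable_iff: "set_integrable lebesgue {-pi..pi} f \<longleftrightarrow> integrable circle_measure f"
  for f :: "real \<Rightarrow> complex"
  unfolding set_integrable_def by (rule integrable_restrict_space[symmetric]) auto

lemma circle_integral_eq: "(LINT \<theta>:{-pi..pi}|lebesgue. f \<theta>) = integral\<^sup>L circle_measure f"
  for f :: "real \<Rightarrow> complex"
  unfolding set_lebesgue_integral_def by (rule integral_restrict_space[symmetric]) auto

lemma finite_circle_measure: "finite_measure circle_measure"
  by (rule finite_measure_lebesgue_on) auto

lemma measure_circle: "measure circle_measure (space circle_measure) = 2 * pi"
  by (simp add: measure_restrict_space)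

lemma fourier_coeff_eq:
  "fourier_coeff f k = (1 / (2 * of_real pi)) * (LINT \<theta>|circle_measure. f \<theta> * exp (- \<i> * of_int k * of_real \<theta>))"
  by (simp add: fourier_coeff_def circle_integral_eq)

lemma integrable_mult_cis:
  fixes f :: "real \<Rightarrow> complex"
  assumes "integrable circle_measure f"
  shows "integrable circle_measure (\<lambda>\<theta>. f \<theta> * exp (- \<i> * of_int k * of_real \<theta>))"
proof (rule Bochner_Integration.integrable_bound[OF assms])
  have "(\<lambda>\<theta>::real. exp (- \<i> * of_int k * of_real \<theta>)) \<in> borel_measurable circle_measure"
    by (intro continuous_imp_measurable_on_sets_lebesgue continuous_intros) auto
  then show "(\<lambda>\<theta>. f \<theta> * exp (- \<i> * of_int k * of_real \<theta>)) \<in> borel_measurable circle_measure"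
    using assms by (intro borel_measurable_times) auto
  have "cmod (exp (- \<i> * of_int k * of_real \<theta>)) = 1" for \<theta>
    by simp
  then show "AE \<theta> in circle_measure. norm (f \<theta> * exp (- \<i> * of_int k * of_real \<theta>)) \<le> norm (f \<theta>)"
    by (simp add: norm_mult)
qed

lemma fourier_coeff_add:
  assumes "integrable circle_measure f" "integrable circle_measure g"
  shows "fourier_coeff (\<lambda>\<theta>. f \<theta> + g \<theta>) k = fourier_coeff f k + fourier_coeff g k"
  unfolding fourier_coeff_eq distrib_right
    Bochner_Integration.integral_add[OF integrable_mult_cis[OF assms(1)] integrable_mult_cis[OF assms(2)]]
  by (rule distrib_left)

lemma fourier_coeff_diff:
  assumes "integrable circle_measure f" "integrable circle_measure g"
  shows "fourier_coeff (\<lambda>\<theta>. f \<theta> - g \<theta>) k = fourier_coeff f k - fourier_coeff g k"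
  unfolding fourier_coeff_eq left_diff_distrib
    Bochner_Integration.integral_diff[OF integrable_mult_cis[OF assms(1)] integrable_mult_cis[OF assms(2)]]
  by (rule right_diff_distrib)

lemma integral_exp_int:
  "(LINT \<theta>|circle_measure. exp (\<i> * of_int m * of_real \<theta>)) = (if m = 0 then 2 * of_real pi else 0)"
proof -
  have int: "integrable circle_measure (\<lambda>\<theta>. exp (\<i> * of_int m * complex_of_real \<theta>))"
    by (intro continuous_imp_integrable_real continuous_intros)
  have "((\<lambda>\<theta>. exp (\<i> * of_int m * complex_of_real \<theta>)) has_integral (if m = 0 then 2 * of_real pi else 0)) {-pi..pi}"
  proof (cases "m = 0")
    case True
    then show ?thesis
      using has_integral_const_real[of "1::complex" "-pi" pi] by (simp add: scaleR_conv_of_real)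
  next
    case False
    define G where "G = (\<lambda>\<theta>. exp (\<i> * of_int m * complex_of_real \<theta>) / (\<i> * of_int m))"
    have "((\<lambda>\<theta>. exp (\<i> * of_int m * complex_of_real \<theta>)) has_integral (G pi - G (-pi))) {-pi..pi}"
    proof (rule fundamental_theorem_of_calculus)
      fix x
      have "((\<lambda>z. exp (\<i> * of_int m * z) / (\<i> * of_int m)) has_field_derivative exp (\<i> * of_int m * of_real x)) (at (of_real x))"
        using False by (auto intro!: derivative_eq_intros)
      then show "(G has_vector_derivative exp (\<i> * of_int m * complex_of_real x)) (at x within {-pi..pi})"
        unfolding G_def by (rule has_vector_derivative_real_field)
    qed simp
    moreover have "exp (\<i> * of_int m * of_real pi) = exp (\<i> * of_int m * of_real (-pi))"
    proof -
      have "\<i> * of_int m * of_real pi = \<i> * of_int m * of_real (-pi) + (of_int (2 * m) * of_real pi) * \<i>"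
        by (simp add: algebra_simps)
      then show ?thesis unfolding exp_eq by (intro exI[of _ m]) simp
    qed
    ultimately show ?thesis using False by (simp add: G_def)
  qed
  then show ?thesis
    using lebesgue_integral_eq_integral[OF int] by (auto dest: integral_unique)
qed

lemma fourier_coeff_exp:
  "fourier_coeff (\<lambda>\<theta>. c * exp (\<i> * of_int m * of_real \<theta>)) k = (if k = m then c else 0)"
proof -
  have "c * exp (\<i> * of_int m * of_real \<theta>) * exp (- \<i> * of_int k * of_real \<theta>)
      = c * exp (\<i> * of_int (m - k) * of_real \<theta>)" for \<theta>
    by (simp add: mult.assoc algebra_simps flip: exp_add)
  then have "fourier_coeff (\<lambda>\<theta>. c * exp (\<i> * of_int m * of_real \<theta>)) k
      = (1 / (2 * of_real pi)) * (c * (LINT \<theta>|circle_measure. exp (\<i> * of_int (m - k) * of_real \<theta>)))"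
    unfolding fourier_coeff_eq by (simp only: integral_mult_right_zero)
  then show ?thesis by (simp add: integral_exp_int del: of_int_diff)
qed

text \<open>Pairing X with the Toeplitz matrix gives 1 / (2 pi) times the integral of g(\<theta>)
  against the form of X at two vectors of unimodular exponentials. Both have norm sqrt n, whence the
  factor c n.\<close>

lemma trace_le_toeplitz:
  assumes g: "integrable circle_measure g"
  shows "trace_le n (n * ((LINT \<theta>|circle_measure. cmod (g \<theta>)) / (2 * pi))) (\<lambda>i j. fourier_coeff g (int i - int j))"
  unfolding trace_le_def
proof safe
  fix X c assume X: "op_bound n c X"
  let ?e = "\<lambda>k \<theta>. exp (- \<i> * of_int k * of_real \<theta>)"
  define h where "h = (\<lambda>\<theta>. \<Sum>i<n. \<Sum>j<n. X i j * (g \<theta> * ?e (int j - int i) \<theta>))"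
  have h: "integrable circle_measure h"
    unfolding h_def by (intro Bochner_Integration.integrable_sum integrable_mult_right integrable_mult_cis g)
  have bound: "cmod (h \<theta>) \<le> c * n * cmod (g \<theta>)" for \<theta>
  proof -
    have "?e (int j - int i) \<theta> = ?e (- int i) \<theta> * ?e (int j) \<theta>" for i j
      by (simp add: algebra_simps flip: exp_add)
    then have "h \<theta> = g \<theta> * (\<Sum>i<n. \<Sum>j<n. ?e (- int i) \<theta> * X i j * ?e (int j) \<theta>)"
      unfolding h_def sum_distrib_left by (simp add: mult_ac)
    also have "cmod \<dots> \<le> cmod (g \<theta>) * (c * vnorm n (\<lambda>i. ?e (- int i) \<theta>) * vnorm n (\<lambda>j. ?e (int j) \<theta>))"
      unfolding norm_mult
      by (intro mult_left_mono norm_ge_zero X[unfolded op_bound_def, THEN conjunct2, rule_format])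
    also have "vnorm n (\<lambda>i. ?e (- int i) \<theta>) = sqrt n"
      by (simp add: vnorm_def L2_set_def)
    also have "vnorm n (\<lambda>j. ?e (int j) \<theta>) = sqrt n"
      by (simp add: vnorm_def L2_set_def)
    finally show ?thesis by (simp add: mult_ac)
  qed
  have "(\<Sum>i<n. \<Sum>j<n. X i j * fourier_coeff g (int j - int i)) = (1 / (2 * of_real pi)) * integral\<^sup>L circle_measure h"
  proof -
    have "integral\<^sup>L circle_measure h
        = (\<Sum>i<n. \<Sum>j<n. X i j * (LINT \<theta>|circle_measure. g \<theta> * ?e (int j - int i) \<theta>))"
      unfolding h_def using g
      by (subst Bochner_Integration.integral_sum, intro Bochner_Integration.integrable_sum integrable_mult_right integrable_mult_cis g)
         (subst Bochner_Integration.integral_sum, intro integrable_mult_right integrable_mult_cis g, simp only: integral_mult_right_zero)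
    then show ?thesis
      unfolding fourier_coeff_eq by (simp only: sum_distrib_left) (intro sum.cong refl mult.left_commute)
  qed
  also have "cmod \<dots> \<le> 1 / (2 * pi) * (LINT \<theta>|circle_measure. c * n * cmod (g \<theta>))"
  proof -
    have "cmod (integral\<^sup>L circle_measure h) \<le> (LINT \<theta>|circle_measure. cmod (h \<theta>))"
      by (rule integral_norm_bound)
    also have "\<dots> \<le> (LINT \<theta>|circle_measure. c * n * cmod (g \<theta>))"
      using h g by (intro integral_mono integrable_mult_right integrable_norm bound)
    finally show ?thesis by (simp add: norm_mult norm_divide divide_right_mono)
  qed
  finally show "cmod (\<Sum>i<n. \<Sum>j<n. X i j * fourier_coeff g (int j - int i))
      \<le> c * (n * ((LINT \<theta>|circle_measure. cmod (g \<theta>)) / (2 * pi)))"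
    by (simp add: mult_ac)
qed

section \<open>Trigonometric polynomials and their density in L1\<close>

inductive trig_poly :: "(real \<Rightarrow> complex) \<Rightarrow> bool" where
  monomial: "trig_poly (\<lambda>\<theta>. c * exp (\<i> * of_int k * of_real \<theta>))"
| add: "trig_poly p \<Longrightarrow> trig_poly q \<Longrightarrow> trig_poly (\<lambda>\<theta>. p \<theta> + q \<theta>)"

lemma trig_poly_const: "trig_poly (\<lambda>\<theta>. c)"
  using trig_poly.monomial[of c 0] by simp

lemma trig_poly_mult:
  assumes "trig_poly p" "trig_poly q"
  shows "trig_poly (\<lambda>\<theta>. p \<theta> * q \<theta>)"
  using assms(1)
proof (induction rule: trig_poly.induct)
  case (monomial c k)
  show ?case
    using assms(2)
  proof (induction rule: trig_poly.induct)
    case (monomial d l)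
    have "c * exp (\<i> * of_int k * of_real \<theta>) * (d * exp (\<i> * of_int l * of_real \<theta>))
        = (c * d) * exp (\<i> * of_int (k + l) * of_real \<theta>)" for \<theta>
      by (simp add: algebra_simps exp_add)
    then show ?case using trig_poly.monomial[of "c * d" "k + l"] by (simp only:)
  next
    case (add p q)
    then show ?case using trig_poly.add by (simp add: distrib_left)
  qed
next
  case (add p q)
  then show ?case using trig_poly.add by (simp add: distrib_right)
qed

lemma trig_poly_cos: "trig_poly (\<lambda>\<theta>. of_real (cos \<theta>))" and trig_poly_sin: "trig_poly (\<lambda>\<theta>. of_real (sin \<theta>))"
proof -
  have "trig_poly (\<lambda>\<theta>. 1 / 2 * exp (\<i> * of_int 1 * of_real \<theta>) + 1 / 2 * exp (\<i> * of_int (-1) * of_real \<theta>))"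
    by (intro trig_poly.intros)
  then show "trig_poly (\<lambda>\<theta>. of_real (cos \<theta>))"
    by (simp add: cos_of_real[symmetric] cos_exp_eq add_divide_distrib)
  have "trig_poly (\<lambda>\<theta>. - \<i> / 2 * exp (\<i> * of_int 1 * of_real \<theta>) + \<i> / 2 * exp (\<i> * of_int (-1) * of_real \<theta>))"
    by (intro trig_poly.intros)
  moreover have "(a - b) / (2 * \<i>) = - \<i> / 2 * a + \<i> / 2 * b" for a b :: complex
    by (subst divide_eq_eq) (auto simp: algebra_simps)
  ultimately show "trig_poly (\<lambda>\<theta>. of_real (sin \<theta>))"
    by (simp add: sin_of_real[symmetric] sin_exp_eq mult.commute)
qed

lemma continuous_on_trig_poly: "trig_poly p \<Longrightarrow> continuous_on S p"
  by (induction rule: trig_poly.induct) (auto intro!: continuous_intros)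

lemma integrable_trig_poly: "trig_poly p \<Longrightarrow> integrable circle_measure p"
  by (intro continuous_imp_integrable_real continuous_on_trig_poly)

text \<open>Along the unit circle a real-linear form is a combination of cos and sin. This turns
  polynomial approximants in the plane into trigonometric polynomials.\<close>

lemma trig_poly_polynomial_cis:
  assumes "real_polynomial_function r"
  shows "trig_poly (\<lambda>\<theta>. of_real (r (cis \<theta>)))"
  using assms
proof (induction rule: real_polynomial_function.induct)
  case (linear f)
  interpret bounded_linear f by fact
  have "f (cis \<theta>) = cos \<theta> * f 1 + sin \<theta> * f \<i>" for \<theta>
  proof -
    have "cis \<theta> = cos \<theta> *\<^sub>R 1 + sin \<theta> *\<^sub>R \<i>" by (simp add: complex_eq_iff)
    then show ?thesis by (simp only: add scale) simp
  qed
  moreover have "trig_poly (\<lambda>\<theta>. of_real (cos \<theta>) * of_real (f 1) + of_real (sin \<theta>) * of_real (f \<i>))"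
    by (intro trig_poly.add trig_poly_mult trig_poly_cos trig_poly_sin trig_poly_const)
  ultimately show ?case by simp
qed (auto intro: trig_poly_const trig_poly.add trig_poly_mult)

text \<open>Since q takes the same value at both end points, it descends to a continuous function on
  the unit circle, where Stone-Weierstrass supplies a polynomial.\<close>

lemma trig_poly_uniform_dense:
  fixes q :: "real \<Rightarrow> complex"
  assumes q: "continuous_on UNIV q" and "q (-pi) = 0" "q pi = 0" and "0 < \<epsilon>"
  shows "\<exists>p. trig_poly p \<and> (\<forall>\<theta>\<in>{-pi..pi}. cmod (q \<theta> - p \<theta>) < \<epsilon>)"
proof -
  \<comment> \<open>The angle is arccos(Re z) on the upper half circle and its negative on the lower
    one. The formulas agree at z = 1, where both angles are 0, and at z = -1, where q vanishes at
    both angles.\<close>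
  define h where "h = (\<lambda>z. if - Im z \<le> 0 then q (arccos (Re z)) else q (- arccos (Re z)))"
  have Re: "-1 \<le> Re z \<and> Re z \<le> 1" if "cmod z = 1" for z
    using abs_Re_le_cmod[of z] that by linarith
  have "continuous_on (sphere 0 1) h"
    unfolding h_def
  proof (rule continuous_on_cases_le)
    have ac: "continuous_on (sphere 0 1) (\<lambda>z. arccos (Re z))"
      by (intro continuous_intros) (use Re in auto)
    show "continuous_on {z \<in> sphere 0 1. - Im z \<le> 0} (\<lambda>z. q (arccos (Re z)))"
      by (rule continuous_on_subset[OF continuous_on_compose2[OF q ac]]) auto
    show "continuous_on {z \<in> sphere 0 1. 0 \<le> - Im z} (\<lambda>z. q (- arccos (Re z)))"
      by (rule continuous_on_subset[OF continuous_on_compose2[OF q continuous_on_minus[OF ac]]]) auto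
    show "continuous_on (sphere 0 1) (\<lambda>z. - Im z)" by (intro continuous_intros)
    fix z assume "z \<in> sphere 0 1" "- Im z = 0"
    then have "(Re z)\<^sup>2 = 1" using cmod_power2[of z] by simp
    then have "Re z = 1 \<or> Re z = -1" by (simp add: power2_eq_1_iff)
    then show "q (arccos (Re z)) = q (- arccos (Re z))" using assms by auto
  qed
  from Stone_Weierstrass_polynomial_function[OF compact_sphere this \<open>0 < \<epsilon>\<close>]
  obtain g where g: "polynomial_function g" "\<And>z. z \<in> sphere 0 1 \<Longrightarrow> cmod (h z - g z) < \<epsilon>"
    by auto
  have hq: "h (cis \<theta>) = q \<theta>" if "\<theta> \<in> {-pi..pi}" for \<theta>
  proof (cases "0 \<le> \<theta>")
    case True
    then show ?thesis using that sin_ge_zero[of \<theta>] by (simp add: h_def arccos_cos)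
  next
    case False
    show ?thesis
    \<comment> \<open>The angle -pi gives the point -1, which h reads as the angle pi; the boundary
      values of q make this harmless.\<close>
    proof (cases "\<theta> = -pi")
      case True
      then show ?thesis using assms by (simp add: h_def)
    next
      case False
      then have "0 < sin (- \<theta>)" using \<open>\<not> 0 \<le> \<theta>\<close> that by (intro sin_gt_zero) auto
      moreover have "arccos (cos \<theta>) = - \<theta>"
        using arccos_cos[of "-\<theta>"] \<open>\<not> 0 \<le> \<theta>\<close> that by simp
      ultimately show ?thesis by (simp add: h_def)
    qed
  qed
  have "real_polynomial_function (Re \<circ> g)" "real_polynomial_function (Im \<circ> g)"
    using g(1) bounded_linear_Re bounded_linear_Im unfolding polynomial_function_def by blast+
  then have "trig_poly (\<lambda>\<theta>. of_real ((Re \<circ> g) (cis \<theta>)) + of_real ((Im \<circ> g) (cis \<theta>)) * \<i>)"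
    by (intro trig_poly.add trig_poly_mult trig_poly_polynomial_cis trig_poly_const)
  moreover have "of_real ((Re \<circ> g) (cis \<theta>)) + of_real ((Im \<circ> g) (cis \<theta>)) * \<i> = g (cis \<theta>)" for \<theta>
    by (simp add: complex_eq_iff)
  ultimately have "trig_poly (\<lambda>\<theta>. g (cis \<theta>))" by simp
  moreover have "cmod (q \<theta> - g (cis \<theta>)) < \<epsilon>" if "\<theta> \<in> {-pi..pi}" for \<theta>
    using g(2)[of "cis \<theta>"] hq[OF that] by simp
  ultimately show ?thesis by blast
qed

text \<open>For K > 0 this is the radial retraction onto the disc of radius K. The maximum with 1
  keeps the denominator away from 0, so a single formula is continuous everywhere.\<close>

definition clip :: "real \<Rightarrow> complex \<Rightarrow> complex" where
  "clip K z = z / of_real (max 1 (cmod z / K))"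

lemma cmod_clip_le: "0 < K \<Longrightarrow> cmod (clip K z) \<le> K"
  by (simp add: clip_def norm_divide divide_le_eq max_def)

lemma clip_eq: "0 < K \<Longrightarrow> cmod z \<le> K \<Longrightarrow> clip K z = z"
  by (simp add: clip_def max_def divide_le_eq)

lemma cmod_clip_diff_le: "0 < K \<Longrightarrow> cmod (z - clip K z) \<le> cmod z"
proof -
  assume "0 < K"
  define m where "m = max 1 (cmod z / K)"
  have "1 \<le> m" by (simp add: m_def)
  have "z - clip K z = of_real (1 - 1 / m) * z"
    by (simp add: clip_def m_def[symmetric] algebra_simps)
  also have "cmod \<dots> \<le> 1 * cmod z"
    unfolding norm_mult norm_of_real using \<open>1 \<le> m\<close> by (intro mult_right_mono) (auto simp: abs_le_iff divide_le_eq)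
  finally show ?thesis by simp
qed

lemma continuous_on_clip: "0 < K \<Longrightarrow> continuous_on S (clip K)"
  unfolding clip_def by (intro continuous_intros) (auto simp: max_def)

text \<open>Three errors of \<epsilon> / 3 each: truncating the values of f, approximating the
  bounded function by continuous ones that vanish at both end points, and approximating one of those
  uniformly by a trigonometric polynomial.\<close>

lemma trig_poly_L1_dense:
  assumes f: "integrable circle_measure f" and "0 < \<epsilon>"
  shows "\<exists>p. trig_poly p \<and> (LINT \<theta>|circle_measure. cmod (f \<theta> - p \<theta>)) < \<epsilon>"
proof -
  interpret finite_measure circle_measure by (rule finite_circle_measure)
  have fm: "f \<in> borel_measurable circle_measure" using f by auto
  have clipm: "clip K \<in> borel_measurable borel" if "0 < K" for K
    by (intro borel_measurable_continuous_onI continuous_on_clip that)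
  have "(\<lambda>k. LINT \<theta>|circle_measure. cmod (f \<theta> - clip (Suc k) (f \<theta>))) \<longlonglongrightarrow> (LINT \<theta>|circle_measure. 0)"
  proof (rule integral_dominated_convergence[where w="\<lambda>\<theta>. cmod (f \<theta>)"])
    show "AE \<theta> in circle_measure. (\<lambda>k. cmod (f \<theta> - clip (Suc k) (f \<theta>))) \<longlonglongrightarrow> 0"
    proof (intro AE_I2 tendsto_eventually)
      fix \<theta>
      show "\<forall>\<^sub>F k in sequentially. cmod (f \<theta> - clip (Suc k) (f \<theta>)) = 0"
        using eventually_ge_at_top[of "nat \<lceil>cmod (f \<theta>)\<rceil>"]
      proof eventually_elim
        case (elim k)
        then have "cmod (f \<theta>) \<le> Suc k" by linarith
        then show ?case by (simp add: clip_eq)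
      qed
    qed
    show "(\<lambda>\<theta>. cmod (f \<theta> - clip (Suc k) (f \<theta>))) \<in> borel_measurable circle_measure" for k
      using fm measurable_compose[OF fm clipm[of "Suc k"]] by measurable
  qed (use f in \<open>auto simp: cmod_clip_diff_le\<close>)
  then have "\<forall>\<^sub>F k in sequentially. (LINT \<theta>|circle_measure. cmod (f \<theta> - clip (Suc k) (f \<theta>))) < \<epsilon> / 3"
    using \<open>0 < \<epsilon>\<close> by (intro order_tendstoD(2)) auto
  then obtain k where k: "(LINT \<theta>|circle_measure. cmod (f \<theta> - clip (Suc k) (f \<theta>))) < \<epsilon> / 3"
    using eventually_happens'[OF sequentially_bot] by blast
  define K where "K = real (Suc k)"
  have "0 < K" by (simp add: K_def)
  \<comment> \<open>Extended by 0, f is an a.e. limit of continuous functions; clipping these at K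
    provides the dominating constant.\<close>
  have "(\<lambda>\<theta>. if \<theta> \<in> {-pi..pi} then f \<theta> else 0) \<in> borel_measurable lebesgue"
    using fm by (intro borel_measurable_if_I) auto
  then have "(\<lambda>\<theta>. if \<theta> \<in> {-pi..pi} then f \<theta> else 0) measurable_on UNIV"
    by (rule lebesgue_measurable_imp_measurable_on) simp
  then have "f measurable_on {-pi..pi}"
    by (simp only: measurable_on_UNIV)
  then obtain N g where N: "negligible N" and g: "\<And>n. continuous_on UNIV (g n)"
    and gf: "\<And>x. x \<notin> N \<Longrightarrow> (\<lambda>n::nat. g n x) \<longlonglongrightarrow> (if x \<in> {-pi..pi} then f x else 0)"
    unfolding measurable_on_def by blast
  \<comment> \<open>A cutoff that vanishes at -pi and pi, as \<open>trig_poly_uniform_dense\<close>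
    demands, and tends to 1 at every interior point.\<close>
  define \<psi> where "\<psi> = (\<lambda>n \<theta>. max 0 (min 1 (real n * (pi - \<bar>\<theta>\<bar>))))"
  define q where "q = (\<lambda>n \<theta>. of_real (\<psi> n \<theta>) * clip K (g n \<theta>))"
  have \<psi>: "0 \<le> \<psi> n \<theta>" "\<psi> n \<theta> \<le> 1" for n \<theta> by (auto simp: \<psi>_def)
  have q_cont: "continuous_on UNIV (q n)" for n
    unfolding q_def \<psi>_def
    by (intro continuous_intros continuous_on_compose2[OF continuous_on_clip[OF \<open>0 < K\<close>] g]) auto
  have q_bound: "cmod (q n \<theta>) \<le> K" for n \<theta>
  proof -
    have "cmod (q n \<theta>) \<le> 1 * K"
      unfolding q_def norm_mult using \<psi> cmod_clip_le[OF \<open>0 < K\<close>] by (intro mult_mono) auto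
    then show ?thesis by simp
  qed
  have lim: "(\<lambda>n. cmod (clip K (f \<theta>) - q n \<theta>)) \<longlonglongrightarrow> 0" if "\<theta> \<notin> N" "-pi < \<theta>" "\<theta> < pi" for \<theta>
  proof -
    have "(\<lambda>n. \<psi> n \<theta>) \<longlonglongrightarrow> 1"
    proof (rule tendsto_eventually)
      show "\<forall>\<^sub>F n in sequentially. \<psi> n \<theta> = 1"
        using eventually_ge_at_top[of "nat \<lceil>1 / (pi - \<bar>\<theta>\<bar>)\<rceil>"]
      proof eventually_elim
        case (elim n)
        have "0 < pi - \<bar>\<theta>\<bar>" using that by auto
        moreover have "1 / (pi - \<bar>\<theta>\<bar>) \<le> real n" using elim by linarith
        ultimately have "1 \<le> real n * (pi - \<bar>\<theta>\<bar>)" by (simp add: divide_le_eq)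
        then show ?case by (simp add: \<psi>_def)
      qed
    qed
    moreover have "(\<lambda>n. clip K (g n \<theta>)) \<longlonglongrightarrow> clip K (f \<theta>)"
    proof -
      have "isCont (clip K) (f \<theta>)"
        using continuous_on_clip[OF \<open>0 < K\<close>, of UNIV] by (simp add: continuous_on_eq_continuous_at)
      then show ?thesis
        using gf[OF \<open>\<theta> \<notin> N\<close>] that by (intro isCont_tendsto_compose[of _ "clip K"]) auto
    qed
    ultimately have "(\<lambda>n. q n \<theta>) \<longlonglongrightarrow> of_real 1 * clip K (f \<theta>)"
      unfolding q_def by (intro tendsto_intros)
    then have "(\<lambda>n. cmod (clip K (f \<theta>) - q n \<theta>)) \<longlonglongrightarrow> cmod (clip K (f \<theta>) - of_real 1 * clip K (f \<theta>))"
      by (intro tendsto_intros)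
    then show ?thesis by simp
  qed
  have qm: "q n \<in> borel_measurable circle_measure" for n
    by (rule continuous_imp_measurable_on_sets_lebesgue) (auto intro: continuous_on_subset[OF q_cont])
  have "(\<lambda>n. LINT \<theta>|circle_measure. cmod (clip K (f \<theta>) - q n \<theta>)) \<longlonglongrightarrow> (LINT \<theta>|circle_measure. 0)"
  proof (rule integral_dominated_convergence[where w="\<lambda>\<theta>. 2 * K"])
    have "negligible (N \<union> {-pi, pi})" using N by (intro negligible_Un) auto
    then have "N \<union> {-pi, pi} \<in> null_sets lebesgue" by (simp add: negligible_iff_null_sets)
    then have "AE \<theta> in lebesgue. \<theta> \<notin> N \<union> {-pi, pi}" by (rule AE_not_in)
    then have "AE \<theta> in lebesgue. \<theta> \<in> {-pi..pi} \<longrightarrow> (\<lambda>n. cmod (clip K (f \<theta>) - q n \<theta>)) \<longlonglongrightarrow> 0"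
    proof (rule AE_mp, intro AE_I2 impI)
      fix \<theta> assume "\<theta> \<notin> N \<union> {-pi, pi}" "\<theta> \<in> {-pi..pi}"
      then show "(\<lambda>n. cmod (clip K (f \<theta>) - q n \<theta>)) \<longlonglongrightarrow> 0" by (intro lim) auto
    qed
    then show "AE \<theta> in circle_measure. (\<lambda>n. cmod (clip K (f \<theta>) - q n \<theta>)) \<longlonglongrightarrow> 0"
      by (subst AE_restrict_space_iff) auto
    show "AE \<theta> in circle_measure. norm (cmod (clip K (f \<theta>) - q n \<theta>)) \<le> 2 * K" for n
    proof (rule AE_I2)
      fix \<theta>
      have "cmod (clip K (f \<theta>) - q n \<theta>) \<le> cmod (clip K (f \<theta>)) + cmod (q n \<theta>)" by (rule norm_triangle_ineq4)
      then show "norm (cmod (clip K (f \<theta>) - q n \<theta>)) \<le> 2 * K"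
        using q_bound[of n \<theta>] cmod_clip_le[OF \<open>0 < K\<close>, of "f \<theta>"] by simp
    qed
    show "(\<lambda>\<theta>. cmod (clip K (f \<theta>) - q n \<theta>)) \<in> borel_measurable circle_measure" for n
      using qm[of n] measurable_compose[OF fm clipm[OF \<open>0 < K\<close>]] by measurable
  qed auto
  then have "\<forall>\<^sub>F n in sequentially. (LINT \<theta>|circle_measure. cmod (clip K (f \<theta>) - q n \<theta>)) < \<epsilon> / 3"
    using \<open>0 < \<epsilon>\<close> by (intro order_tendstoD(2)) auto
  then obtain n where n: "(LINT \<theta>|circle_measure. cmod (clip K (f \<theta>) - q n \<theta>)) < \<epsilon> / 3"
    using eventually_happens'[OF sequentially_bot] by blast
  \<comment> \<open>The interval has length 2 pi, so this uniform error integrates to \<epsilon> /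
    3.\<close>
  have "0 < \<epsilon> / (6 * pi)" using \<open>0 < \<epsilon>\<close> by simp
  then obtain p where p: "trig_poly p" and pq: "\<And>\<theta>. \<theta> \<in> {-pi..pi} \<Longrightarrow> cmod (q n \<theta> - p \<theta>) < \<epsilon> / (6 * pi)"
    using trig_poly_uniform_dense[OF q_cont, of n "\<epsilon> / (6 * pi)"] by (auto simp: q_def \<psi>_def)
  have int1: "integrable circle_measure (\<lambda>\<theta>. cmod (f \<theta> - clip K (f \<theta>)))"
    by (rule Bochner_Integration.integrable_bound[OF integrable_norm[OF f]])
       (use fm measurable_compose[OF fm clipm[OF \<open>0 < K\<close>]] in \<open>auto simp: cmod_clip_diff_le \<open>0 < K\<close>\<close>)
  have "integrable circle_measure (\<lambda>\<theta>. clip K (f \<theta>))"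
    by (rule integrable_const_bound[of _ K])
       (use measurable_compose[OF fm clipm[OF \<open>0 < K\<close>]] in \<open>auto simp: cmod_clip_le \<open>0 < K\<close>\<close>)
  moreover have "integrable circle_measure (q n)"
    by (rule integrable_const_bound[of _ K]) (use qm q_bound in auto)
  ultimately have int2: "integrable circle_measure (\<lambda>\<theta>. cmod (clip K (f \<theta>) - q n \<theta>))"
    by (intro integrable_norm Bochner_Integration.integrable_diff)
  have int3: "integrable circle_measure (\<lambda>\<theta>. cmod (f \<theta> - p \<theta>))"
    by (intro integrable_norm Bochner_Integration.integrable_diff f integrable_trig_poly p)
  have "(LINT \<theta>|circle_measure. cmod (f \<theta> - p \<theta>))
      \<le> (LINT \<theta>|circle_measure. cmod (f \<theta> - clip K (f \<theta>)) + cmod (clip K (f \<theta>) - q n \<theta>) + \<epsilon> / (6 * pi))"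
  proof (rule integral_mono)
    fix \<theta> assume "\<theta> \<in> space circle_measure"
    then have "cmod (q n \<theta> - p \<theta>) \<le> \<epsilon> / (6 * pi)" using pq[of \<theta>] by simp
    moreover have "cmod (f \<theta> - p \<theta>) \<le> cmod (f \<theta> - clip K (f \<theta>)) + cmod (clip K (f \<theta>) - q n \<theta>) + cmod (q n \<theta> - p \<theta>)"
      using norm_triangle_ineq[of "f \<theta> - clip K (f \<theta>)" "clip K (f \<theta>) - q n \<theta>"]
        norm_triangle_ineq[of "f \<theta> - q n \<theta>" "q n \<theta> - p \<theta>"] by simp
    ultimately show "cmod (f \<theta> - p \<theta>) \<le> cmod (f \<theta> - clip K (f \<theta>)) + cmod (clip K (f \<theta>) - q n \<theta>) + \<epsilon> / (6 * pi)"
      by linarith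
  qed (use int1 int2 int3 in auto)
  also have "\<dots> = (LINT \<theta>|circle_measure. cmod (f \<theta> - clip K (f \<theta>)))
      + (LINT \<theta>|circle_measure. cmod (clip K (f \<theta>) - q n \<theta>)) + (LINT \<theta>|circle_measure. \<epsilon> / (6 * pi))"
    using int1 int2 by simp
  also have "(LINT \<theta>|circle_measure. \<epsilon> / (6 * pi)) = \<epsilon> / 3"
    using measure_circle by simp
  finally show ?thesis using p n k by (intro exI[of _ p]) (simp add: K_def)
qed

section \<open>Banded Toeplitz matrices acting on exponentials\<close>

text \<open>A row of a Toeplitz matrix of bandwidth d sees \<open>w\<close> only within distance d
  of its index; if \<open>w\<close> is a pure exponential there, the row multiplies it by the
  symbol. The window consists of integers so that it can be required not to reach below 0. The minus
  sign in the exponent matches the Fourier convention and yields p(\<theta>) instead of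
  p(-\<theta>).\<close>

definition local_symbol :: "nat \<Rightarrow> (real \<Rightarrow> complex) \<Rightarrow> bool" where
  "local_symbol d p \<longleftrightarrow> (\<forall>n i \<theta> w c. i < n \<longrightarrow>
     (\<forall>m. \<bar>m - int i\<bar> \<le> int d \<longrightarrow> 0 \<le> m \<and> m < int n \<and> w (nat m) = c * exp (- \<i> * of_int m * of_real \<theta>)) \<longrightarrow>
     (\<Sum>j<n. fourier_coeff p (int i - int j) * w j) = p \<theta> * w i)"

lemma local_symbol_mono:
  assumes "local_symbol d p" "d \<le> e"
  shows "local_symbol e p"
  unfolding local_symbol_def
proof (intro allI impI)
  fix n i :: nat and \<theta> :: real and w and c :: complex
  assume "i < n" and w: "\<forall>m. \<bar>m - int i\<bar> \<le> int e \<longrightarrow> 0 \<le> m \<and> m < int n \<and> w (nat m) = c * exp (- \<i> * of_int m * of_real \<theta>)"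
  show "(\<Sum>j<n. fourier_coeff p (int i - int j) * w j) = p \<theta> * w i"
    by (rule assms(1)[unfolded local_symbol_def, rule_format, OF \<open>i < n\<close>, of w c \<theta>],
        rule w[rule_format]) (use \<open>d \<le> e\<close> in simp)
qed

text \<open>A monomial of degree k is a shift by k places and needs a window of width |k|; for a sum
  the larger of the two windows serves both terms.\<close>

lemma trig_poly_local_symbol:
  assumes "trig_poly p"
  shows "\<exists>d. local_symbol d p"
  using assms
proof (induction rule: trig_poly.induct)
  case (monomial b k)
  have "local_symbol (nat \<bar>k\<bar>) (\<lambda>\<theta>. b * exp (\<i> * of_int k * of_real \<theta>))"
    unfolding local_symbol_def
  proof (intro allI impI)
    fix n i :: nat and \<theta> :: real and w and c :: complex
    assume "i < n" and
      w: "\<forall>m. \<bar>m - int i\<bar> \<le> int (nat \<bar>k\<bar>) \<longrightarrow> 0 \<le> m \<and> m < int n \<and> w (nat m) = c * exp (- \<i> * of_int m * of_real \<theta>)"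
    define l where "l = nat (int i - k)"
    have l: "int l = int i - k" "l < n" "w l = c * exp (- \<i> * of_int (int i - k) * of_real \<theta>)"
      using w[rule_format, of "int i - k"] by (auto simp: l_def)
    have wi: "w i = c * exp (- \<i> * of_int (int i) * of_real \<theta>)"
      using w[rule_format, of "int i"] by simp
    have "(\<Sum>j<n. fourier_coeff (\<lambda>\<theta>. b * exp (\<i> * of_int k * of_real \<theta>)) (int i - int j) * w j)
        = (\<Sum>j<n. if j = l then b * w l else 0)"
      using l(1) by (intro sum.cong refl) (auto simp: fourier_coeff_exp)
    also have "\<dots> = b * w l" using \<open>l < n\<close> by simp
    also have "\<dots> = b * exp (\<i> * of_int k * of_real \<theta>) * w i"
      unfolding l(3) wi by (simp add: algebra_simps flip: exp_add)
    finally show "(\<Sum>j<n. fourier_coeff (\<lambda>\<theta>. b * exp (\<i> * of_int k * of_real \<theta>)) (int i - int j) * w j)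
        = b * exp (\<i> * of_int k * of_real \<theta>) * w i" .
  qed
  then show ?case by blast
next
  case (add p q)
  then obtain d e where "local_symbol d p" "local_symbol e q" by blast
  then have d: "local_symbol (max d e) p" and e: "local_symbol (max d e) q"
    by (auto intro: local_symbol_mono[OF _ max.cobounded1] local_symbol_mono[OF _ max.cobounded2])
  have "local_symbol (max d e) (\<lambda>\<theta>. p \<theta> + q \<theta>)"
    unfolding local_symbol_def
  proof (intro allI impI)
    fix n i :: nat and \<theta> :: real and w and c :: complex
    assume "i < n" and
      w: "\<forall>m. \<bar>m - int i\<bar> \<le> int (max d e) \<longrightarrow> 0 \<le> m \<and> m < int n \<and> w (nat m) = c * exp (- \<i> * of_int m * of_real \<theta>)"
    show "(\<Sum>j<n. fourier_coeff (\<lambda>\<theta>. p \<theta> + q \<theta>) (int i - int j) * w j) = (p \<theta> + q \<theta>) * w i"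
      unfolding fourier_coeff_add[OF add(1,2)[THEN integrable_trig_poly]] distrib_right sum.distrib
      by (simp only: d[unfolded local_symbol_def, rule_format, OF \<open>i < n\<close> w[rule_format]]
          e[unfolded local_symbol_def, rule_format, OF \<open>i < n\<close> w[rule_format]])
  qed
  then show ?case by blast
qed

section \<open>Sampling, Riemann sums and the chordal distance\<close>

text \<open>The interval attached to block b reaches one block length further left than the block,
  because the sample points of its rows may lie to the left of b / s; see
  \<open>sample_point_in_block\<close>.\<close>

definition bad_blocks :: "(real \<Rightarrow> complex) \<Rightarrow> real \<Rightarrow> nat \<Rightarrow> nat set" where
  "bad_blocks a \<epsilon> s = {b. b < s \<and> \<not> (\<forall>x\<in>{0..1}. \<forall>y\<in>{0..1}.
     (real b - 1) / s \<le> x \<and> x \<le> (real b + 1) / s \<and> (real b - 1) / s \<le> y \<and> y \<le> (real b + 1) / s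
       \<longrightarrow> cmod (a x - a y) \<le> \<epsilon>)}"

lemma finite_bad_blocks [simp]: "finite (bad_blocks a \<epsilon> s)"
  by (simp add: bad_blocks_def)

text \<open>The interior of every bad block lies in an open set of points close to two points at
  which a differs by more than \<epsilon>. As s grows, these sets shrink to a set of
  discontinuities, hence to measure 0; being open, they are measurable without any argument about
  a.\<close>

lemma bad_blocks_density:
  assumes a: "AE x in lebesgue_on {0..1}. continuous (at x within {0..1}) a" and "0 < \<epsilon>"
  shows "(\<lambda>s. card (bad_blocks a \<epsilon> s) / real s) \<longlonglongrightarrow> 0"
proof -
  define M :: "real measure" where "M = lebesgue_on {0..1}"
  interpret finite_measure M
    unfolding M_def by (rule finite_measure_lebesgue_on) auto
  have spM: "space M = {0..1}" by (simp add: M_def)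
  have setsM: "S \<inter> {0..1} \<in> sets M" if "S \<in> sets borel" for S
  proof -
    have "S \<inter> {0..1} \<in> sets lborel" using that by simp
    then have "S \<inter> {0..1} \<in> sets lebesgue" by (rule sets_completionI_sets)
    then show ?thesis unfolding M_def by (simp add: sets_restrict_space_iff)
  qed
  \<comment> \<open>A point of block b is within 2 / s of every point of the interval from (b - 1) /
    s to (b + 1) / s, so 3 leaves room. The index is shifted by one to avoid division by 0.\<close>
  define H where "H = (\<lambda>s::nat. \<Union>y\<in>{0..1}. \<Union>z\<in>{z\<in>{0..1}. \<epsilon> < cmod (a y - a z)}.
     ball y (3 / Suc s) \<inter> ball z (3 / Suc s))"
  have H_open: "open (H s)" for s
    unfolding H_def by (intro open_UN ballI open_Int open_ball)
  then have H_meas: "H s \<inter> {0..1} \<in> sets M" for s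
    by (intro setsM) auto
  have dec: "decseq (\<lambda>s. H s \<inter> {0..1})"
  proof (rule decseq_SucI)
    fix s
    have "3 / real (Suc (Suc s)) \<le> 3 / real (Suc s)" by (intro divide_left_mono) auto
    then have "ball y (3 / Suc (Suc s)) \<subseteq> ball y (3 / Suc s)" for y :: real by (intro subset_ball)
    then show "H (Suc s) \<inter> {0..1} \<subseteq> H s \<inter> {0..1}" unfolding H_def by blast
  qed
  have Hnull: "(\<Inter>s. H s \<inter> {0..1}) \<in> null_sets M"
  proof -
    have "AE x in M. x \<notin> (\<Inter>s. H s \<inter> {0..1})"
      using a[folded M_def]
    proof (rule AE_mp, intro AE_I2 impI notI)
      fix x assume "continuous (at x within {0..1}) a" and x: "x \<in> (\<Inter>s. H s \<inter> {0..1})"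
      then obtain d where "0 < d" and d: "\<And>y. y \<in> {0..1} \<Longrightarrow> dist y x < d \<Longrightarrow> dist (a y) (a x) < \<epsilon> / 2"
        using \<open>0 < \<epsilon>\<close> unfolding continuous_within_eps_delta by (metis half_gt_zero)
      obtain s :: nat where "3 / d < real s" using reals_Archimedean2 by blast
      then have s: "3 / real (Suc s) < d" using \<open>0 < d\<close> by (simp add: field_simps)
      from x have "x \<in> H s" by auto
      then obtain y z where yz: "y \<in> {0..1}" "z \<in> {0..1}" "\<epsilon> < cmod (a y - a z)"
        "dist y x < 3 / Suc s" "dist z x < 3 / Suc s"
        unfolding H_def by auto
      have "dist (a y) (a z) \<le> dist (a y) (a x) + dist (a z) (a x)" by (rule dist_triangle2)
      also have "\<dots> < \<epsilon> / 2 + \<epsilon> / 2"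
        using yz s by (intro add_strict_mono d) auto
      finally show False using yz by (simp add: dist_norm)
    qed
    moreover have "(\<Inter>s. H s \<inter> {0..1}) \<in> sets M" using H_meas by (intro sets.countable_INT) auto
    ultimately show ?thesis
      using AE_iff_null_sets by blast
  qed
  have "(\<lambda>s. measure M (H s \<inter> {0..1})) \<longlonglongrightarrow> measure M (\<Inter>s. H s \<inter> {0..1})"
    using H_meas by (intro finite_Lim_measure_decseq dec) auto
  moreover have "measure M (\<Inter>s. H s \<inter> {0..1}) = 0"
    using Hnull by (simp add: null_sets_def measure_def)
  ultimately have lim: "(\<lambda>s. measure M (H s \<inter> {0..1})) \<longlonglongrightarrow> 0" by simp
  have le: "card (bad_blocks a \<epsilon> (Suc s)) / real (Suc s) \<le> measure M (H s \<inter> {0..1})" for s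
  proof -
    define I where "I = (\<lambda>b::nat. {real b / Suc s<..<(real b + 1) / Suc s})"
    have I_sub: "I b \<subseteq> {0..1}" if "b \<in> bad_blocks a \<epsilon> (Suc s)" for b
    proof
      fix x assume "x \<in> I b"
      then have "real b / Suc s < x" "x < (real b + 1) / Suc s" by (auto simp: I_def)
      moreover have "0 \<le> real b / Suc s" by simp
      moreover have "(real b + 1) / Suc s \<le> 1"
        using that by (simp add: bad_blocks_def divide_le_eq)
      ultimately have "0 \<le> x" "x \<le> 1" by linarith+
      then show "x \<in> {0..1}" by simp
    qed
    have I_H: "I b \<subseteq> H s" if b: "b \<in> bad_blocks a \<epsilon> (Suc s)" for b
    proof
      fix x assume "x \<in> I b"
      then have x: "real b / Suc s < x" "x < (real b + 1) / Suc s" by (auto simp: I_def)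
      from b obtain y z where yz: "y \<in> {0..1}" "z \<in> {0..1}" "\<epsilon> < cmod (a y - a z)"
        "(real b - 1) / Suc s \<le> y" "y \<le> (real b + 1) / Suc s" "(real b - 1) / Suc s \<le> z" "z \<le> (real b + 1) / Suc s"
        unfolding bad_blocks_def by (auto simp: not_le simp del: of_nat_Suc)
      have *: "dist w x < 3 / Suc s" if "(real b - 1) / Suc s \<le> w" "w \<le> (real b + 1) / Suc s" for w
      proof -
        have "(real b - 1) / Suc s = real b / Suc s - 1 / Suc s" "(real b + 1) / Suc s = real b / Suc s + 1 / Suc s"
          "3 / real (Suc s) = 3 * (1 / Suc s)" "0 < 1 / real (Suc s)"
          by (auto simp: diff_divide_distrib add_divide_distrib)
        then show ?thesis using x that unfolding dist_real_def by linarith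
      qed
      show "x \<in> H s"
        unfolding H_def
      proof (rule UN_I[OF yz(1)], rule UN_I)
        show "z \<in> {z \<in> {0..1}. \<epsilon> < cmod (a y - a z)}" using yz by simp
        show "x \<in> ball y (3 / Suc s) \<inter> ball z (3 / Suc s)"
          using *[of y] *[of z] yz by (simp del: of_nat_Suc)
      qed
    qed
    have "disjoint_family_on I (bad_blocks a \<epsilon> (Suc s))"
      unfolding disjoint_family_on_def
    proof (intro ballI impI)
      fix b c :: nat assume "b \<noteq> c"
      then consider "real b + 1 \<le> real c" | "real c + 1 \<le> real b" by linarith
      then show "I b \<inter> I c = {}"
      proof cases
        case 1
        then have "(real b + 1) / Suc s \<le> real c / Suc s" by (intro divide_right_mono) auto
        then show ?thesis by (auto simp: I_def simp del: of_nat_Suc)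
      next
        case 2
        then have "(real c + 1) / Suc s \<le> real b / Suc s" by (intro divide_right_mono) auto
        then show ?thesis by (auto simp: I_def simp del: of_nat_Suc)
      qed
    qed
    moreover have I_meas: "I b \<in> sets M" if "b \<in> bad_blocks a \<epsilon> (Suc s)" for b
      using setsM[of "I b"] I_sub[OF that] by (simp add: I_def Int_absorb2)
    ultimately have "measure M (\<Union>b\<in>bad_blocks a \<epsilon> (Suc s). I b) = (\<Sum>b\<in>bad_blocks a \<epsilon> (Suc s). measure M (I b))"
      by (intro finite_measure_finite_Union) auto
    also have "\<dots> = (\<Sum>b\<in>bad_blocks a \<epsilon> (Suc s). 1 / Suc s)"
    proof (rule sum.cong[OF refl])
      fix b assume b: "b \<in> bad_blocks a \<epsilon> (Suc s)"
      have "measure M (I b) = measure lebesgue (I b)"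
        unfolding M_def using I_sub[OF b] by (simp add: measure_restrict_space)
      also have "\<dots> = (real b + 1) / Suc s - real b / Suc s"
        unfolding I_def by (simp add: divide_right_mono)
      finally show "measure M (I b) = 1 / Suc s" by (simp add: diff_divide_distrib add_divide_distrib)
    qed
    finally have "card (bad_blocks a \<epsilon> (Suc s)) / real (Suc s) = measure M (\<Union>b\<in>bad_blocks a \<epsilon> (Suc s). I b)"
      by simp
    also have "\<dots> \<le> measure M (H s \<inter> {0..1})"
      using I_sub I_H by (intro finite_measure_mono H_meas) blast
    finally show ?thesis .
  qed
  have "(\<lambda>s. card (bad_blocks a \<epsilon> (Suc s)) / real (Suc s)) \<longlonglongrightarrow> 0"
    by (rule tendsto_sandwich[OF _ _ tendsto_const lim]) (use le in auto)
  then show ?thesis by (subst (asm) filterlim_sequentially_Suc)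
qed

section \<open>Riemann sums on the equidistant grid\<close>

lemma riemann_sum_tendsto:
  fixes h :: "real \<Rightarrow> complex"
  assumes h: "continuous_on {-pi..pi} h"
  shows "(\<lambda>L. (\<Sum>k<L. h (-pi + 2 * pi * real k / real L)) / of_nat L)
     \<longlonglongrightarrow> (LINT \<theta>|circle_measure. h \<theta>) / (2 * of_real pi)"
proof (rule LIMSEQ_I)
  fix r :: real assume "0 < r"
  have "uniformly_continuous_on {-pi..pi} h"
    using h by (intro compact_uniformly_continuous) auto
  then obtain d where "0 < d"
    and d: "\<And>x y. x \<in> {-pi..pi} \<Longrightarrow> y \<in> {-pi..pi} \<Longrightarrow> dist y x < d \<Longrightarrow> dist (h y) (h x) < r / 2"
    using \<open>0 < r\<close> unfolding uniformly_continuous_on_def by (metis half_gt_zero)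
  \<comment> \<open>Beyond \<open>L0\<close> the cells are shorter than d, so h varies by less than
    r / 2 on each; the total error r pi, divided by 2 pi, is r / 2.\<close>
  obtain L0 :: nat where L0: "2 * pi / d < real L0" using reals_Archimedean2 by blast
  have int: "(LINT \<theta>|circle_measure. h \<theta>) = integral {-pi..pi} h"
    by (intro lebesgue_integral_eq_integral continuous_imp_integrable_real h) auto
  show "\<exists>no. \<forall>L\<ge>no. norm ((\<Sum>k<L. h (-pi + 2 * pi * real k / real L)) / of_nat L
      - (LINT \<theta>|circle_measure. h \<theta>) / (2 * of_real pi)) < r"
  proof (intro exI[of _ "Suc L0"] allI impI)
    fix L assume "Suc L0 \<le> L"
    then have L: "0 < real L" "2 * pi / d < real L" using L0 by auto
    define t where "t = (\<lambda>k. -pi + 2 * pi * real k / real L)"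
    have w: "t (Suc k) - t k = 2 * pi / L" for k
      using L by (simp add: t_def field_simps)
    have wd: "2 * pi / L < d" using L \<open>0 < d\<close> by (simp add: field_simps)
    have t0: "t 0 = -pi" and tL: "t L = pi" using L by (auto simp: t_def)
    have t_in: "-pi \<le> t k" "k \<le> L \<Longrightarrow> t k \<le> pi" for k
    proof -
      show "-pi \<le> t k" by (simp add: t_def)
      assume "k \<le> L"
      then have "real k / real L \<le> 1" using L by simp
      then have "2 * pi * (real k / real L) \<le> 2 * pi * 1" by (intro mult_left_mono) auto
      then show "t k \<le> pi" by (simp add: t_def)
    qed
    have mono: "t k \<le> t (Suc k)" for k using w[of k] L by (smt (verit) divide_nonneg_nonneg pi_ge_zero)
    have int_on: "h integrable_on {x..y}" if "-pi \<le> x" "y \<le> pi" for x y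
      using that by (intro integrable_continuous_real continuous_on_subset[OF h]) auto
    have sum_int: "integral {-pi..t k} h = (\<Sum>j<k. integral {t j..t (Suc j)} h)" if "k \<le> L" for k
      using that
    proof (induction k)
      case 0
      then show ?case by (simp add: t0)
    next
      case (Suc k)
      have "integral {-pi..t (Suc k)} h = integral {-pi..t k} h + integral {t k..t (Suc k)} h"
        using t_in[of k] t_in[of "Suc k"] mono Suc.prems
        by (intro Henstock_Kurzweil_Integration.integral_combine[symmetric] int_on) auto
      then show ?case using Suc by simp
    qed
    have step: "cmod (of_real (2 * pi / L) * h (t k) - integral {t k..t (Suc k)} h) \<le> r / 2 * (2 * pi / L)"
      if "k < L" for k
    proof -
      have tk: "-pi \<le> t k" "t (Suc k) \<le> pi" "t k \<le> t (Suc k)" using t_in mono that by auto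
      have "((\<lambda>x. h (t k)) has_integral (t (Suc k) - t k) *\<^sub>R h (t k)) {t k..t (Suc k)}"
        using has_integral_const_real[of "h (t k)" "t k" "t (Suc k)"] tk by simp
      moreover have "(h has_integral integral {t k..t (Suc k)} h) {t k..t (Suc k)}"
        using tk by (intro integrable_integral int_on) auto
      ultimately have "((\<lambda>x. h (t k) - h x) has_integral
          (t (Suc k) - t k) *\<^sub>R h (t k) - integral {t k..t (Suc k)} h) {t k..t (Suc k)}"
        by (rule has_integral_diff)
      note bound = has_integral_bound_real[OF _ finite.emptyI this, of "r / 2"]
      have "cmod (h (t k) - h x) \<le> r / 2" if x: "x \<in> {t k..t (Suc k)}" for x
      proof -
        have "dist x (t k) < d" using x w[of k] wd by (auto simp: dist_real_def)
        then have "dist (h x) (h (t k)) < r / 2" using x tk by (intro d) auto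
        then show ?thesis by (simp add: dist_norm norm_minus_commute)
      qed
      with bound have "cmod ((t (Suc k) - t k) *\<^sub>R h (t k) - integral {t k..t (Suc k)} h)
          \<le> r / 2 * Henstock_Kurzweil_Integration.content {t k..t (Suc k)}"
        using \<open>0 < r\<close> by simp
      then show ?thesis using tk by (simp add: w scaleR_conv_of_real)
    qed
    have "cmod ((\<Sum>k<L. of_real (2 * pi / L) * h (t k)) - integral {-pi..pi} h)
        = cmod (\<Sum>k<L. of_real (2 * pi / L) * h (t k) - integral {t k..t (Suc k)} h)"
      using sum_int[of L] by (simp add: tL sum_subtractf)
    also have "\<dots> \<le> (\<Sum>k<L. r / 2 * (2 * pi / L))"
      by (intro order_trans[OF norm_sum] sum_mono step) auto
    also have "\<dots> = r * pi" using L by simp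
    finally have bound: "cmod ((\<Sum>k<L. of_real (2 * pi / L) * h (t k)) - integral {-pi..pi} h) \<le> r * pi" .
    have "(\<Sum>k<L. h (t k)) / of_nat L - (LINT \<theta>|circle_measure. h \<theta>) / (2 * of_real pi)
       = ((\<Sum>k<L. of_real (2 * pi / L) * h (t k)) - integral {-pi..pi} h) / of_real (2 * pi)"
      unfolding int sum_distrib_left[symmetric] using L by (simp add: field_simps)
    also have "cmod \<dots> \<le> r * pi / (2 * pi)"
      using divide_right_mono[OF bound, of "2 * pi"] unfolding norm_divide norm_of_real by simp
    also have "\<dots> < r" using \<open>0 < r\<close> by simp
    finally show "norm ((\<Sum>k<L. h (-pi + 2 * pi * real k / real L)) / of_nat L
      - (LINT \<theta>|circle_measure. h \<theta>) / (2 * of_real pi)) < r"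
      unfolding t_def .
  qed
qed

section \<open>Chordal distance and moduli of continuity\<close>

text \<open>The squared chordal distance on a Riemann sphere of diameter 1; it stays bounded however
  far apart z and w are.\<close>

definition chordal2 :: "complex \<Rightarrow> complex \<Rightarrow> real" where
  "chordal2 z w = (cmod (z - w))\<^sup>2 / ((1 + (cmod z)\<^sup>2) * (1 + (cmod w)\<^sup>2))"

lemma chordal2_commute: "chordal2 z w = chordal2 w z"
  by (simp add: chordal2_def norm_minus_commute mult.commute)

lemma chordal2_nonneg [simp]: "0 \<le> chordal2 z w"
  by (simp add: chordal2_def)

text \<open>Only z is confined to a disc; w may be arbitrarily far away. With t = |z - w|, |w|^2 is
  at most 2 t^2 + 2 K^2, and t^2 / (1 + 2 t^2 + 2 K^2) increases with t, so t may be replaced by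
  \<delta>.\<close>

lemma chordal2_lower_bound:
  assumes "0 < \<delta>" "\<delta> \<le> cmod (z - w)" "cmod z \<le> K"
  shows "\<delta>\<^sup>2 / ((1 + K\<^sup>2) * (1 + 2 * \<delta>\<^sup>2 + 2 * K\<^sup>2)) \<le> chordal2 z w"
proof -
  define t where "t = cmod (z - w)"
  have "0 \<le> K" using assms(3) norm_ge_zero order_trans by blast
  have "cmod w \<le> t + K" using norm_triangle_ineq2[of w z] assms(3) by (simp add: t_def norm_minus_commute)
  then have "(cmod w)\<^sup>2 \<le> (t + K)\<^sup>2" by (intro power_mono) auto
  also have "\<dots> \<le> 2 * t\<^sup>2 + 2 * K\<^sup>2" 
    using zero_le_power2[of "t - K"] by (simp add: power2_eq_square algebra_simps)
  finally have w: "(cmod w)\<^sup>2 \<le> 2 * t\<^sup>2 + 2 * K\<^sup>2" .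
  have z: "(cmod z)\<^sup>2 \<le> K\<^sup>2" using assms(3) by (intro power_mono) auto
  have dt: "\<delta>\<^sup>2 \<le> t\<^sup>2" using assms by (intro power_mono) (auto simp: t_def)
  have "\<delta>\<^sup>2 / (1 + 2 * \<delta>\<^sup>2 + 2 * K\<^sup>2) \<le> t\<^sup>2 / (1 + 2 * t\<^sup>2 + 2 * K\<^sup>2)"
  proof -
    have "\<delta>\<^sup>2 * (1 + 2 * K\<^sup>2) \<le> t\<^sup>2 * (1 + 2 * K\<^sup>2)" using dt by (intro mult_right_mono) auto
    then have "\<delta>\<^sup>2 * (1 + 2 * t\<^sup>2 + 2 * K\<^sup>2) \<le> t\<^sup>2 * (1 + 2 * \<delta>\<^sup>2 + 2 * K\<^sup>2)"
      by (simp add: algebra_simps)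
    moreover have "0 < 1 + 2 * t\<^sup>2 + 2 * K\<^sup>2" "0 < 1 + 2 * \<delta>\<^sup>2 + 2 * K\<^sup>2"
      by (auto simp: add_pos_nonneg)
    ultimately show ?thesis by (simp add: divide_simps mult.commute)
  qed
  then have "\<delta>\<^sup>2 / (1 + 2 * \<delta>\<^sup>2 + 2 * K\<^sup>2) / (1 + K\<^sup>2) \<le> t\<^sup>2 / (1 + 2 * t\<^sup>2 + 2 * K\<^sup>2) / (1 + K\<^sup>2)"
    by (intro divide_right_mono) auto
  also have "\<dots> = t\<^sup>2 / ((1 + K\<^sup>2) * (1 + 2 * t\<^sup>2 + 2 * K\<^sup>2))" by (simp add: mult.commute)
  also have "\<dots> \<le> t\<^sup>2 / ((1 + (cmod z)\<^sup>2) * (1 + (cmod w)\<^sup>2))"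
    using w z by (intro divide_left_mono mult_mono) (auto simp: add_pos_nonneg intro!: mult_pos_pos)
  finally show ?thesis by (simp add: chordal2_def t_def mult.commute)
qed

lemma compact_support_uniformly_continuous:
  fixes F :: "complex \<Rightarrow> complex"
  assumes F: "continuous_on UNIV F" and supp: "bounded {z. F z \<noteq> 0}" and "0 < \<eta>"
  shows "\<exists>\<delta>>0. \<forall>z w. cmod (z - w) < \<delta> \<longrightarrow> cmod (F z - F w) \<le> \<eta>"
proof -
  obtain K where K: "\<And>z. F z \<noteq> 0 \<Longrightarrow> cmod z \<le> K"
    using supp unfolding bounded_iff by auto
  have "uniformly_continuous_on (cball 0 (K + 1)) F"
    by (intro compact_uniformly_continuous continuous_on_subset[OF F]) auto
  then obtain d where "0 < d"
    and d: "\<And>x y. x \<in> cball 0 (K + 1) \<Longrightarrow> y \<in> cball 0 (K + 1) \<Longrightarrow> dist y x < d \<Longrightarrow> dist (F y) (F x) < \<eta>"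
    using \<open>0 < \<eta>\<close> unfolding uniformly_continuous_on_def by metis
  have "cmod (F z - F w) \<le> \<eta>" if "cmod (z - w) < min d 1" for z w
  proof (cases "F z = 0 \<and> F w = 0")
    case True
    then show ?thesis using \<open>0 < \<eta>\<close> by simp
  next
    case False
    then have "cmod z \<le> K \<or> cmod w \<le> K" using K by auto
    then have "cmod z \<le> K + 1 \<and> cmod w \<le> K + 1"
      using that norm_triangle_ineq2[of z w] norm_triangle_ineq2[of w z] by (auto simp: norm_minus_commute)
    then have "dist (F z) (F w) < \<eta>" using that by (intro d) (auto simp: dist_norm)
    then show ?thesis by (simp add: dist_norm)
  qed
  then show ?thesis using \<open>0 < d\<close> by (intro exI[of _ "min d 1"]) auto
qed

lemma compact_support_bounded:
  fixes F :: "complex \<Rightarrow> complex"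
  assumes F: "continuous_on UNIV F" and supp: "bounded {z. F z \<noteq> 0}"
  shows "\<exists>B>0. \<forall>z. cmod (F z) \<le> B"
proof -
  obtain K where K: "\<And>z. F z \<noteq> 0 \<Longrightarrow> cmod z \<le> K"
    using supp unfolding bounded_iff by auto
  have "compact (F ` cball 0 K)"
    by (intro compact_continuous_image continuous_on_subset[OF F]) auto
  then obtain B where "0 < B" and B: "\<And>z. z \<in> cball 0 K \<Longrightarrow> cmod (F z) \<le> B"
    using compact_imp_bounded[of "F ` cball 0 K"] unfolding bounded_pos by auto
  have "cmod (F z) \<le> B" for z
    using B[of z] K[of z] \<open>0 < B\<close> by (cases "F z = 0") auto
  then show ?thesis using \<open>0 < B\<close> by blast
qed

text \<open>Pairs at least \<delta> apart with one point in the support have squared chordal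
  distance at least m, while the values of F differ by at most 2 B; hence C = 2 B / m. The affine
  form can be summed against weights without splitting the index set.\<close>

lemma compact_support_chordal_modulus:
  fixes F :: "complex \<Rightarrow> complex"
  assumes F: "continuous_on UNIV F" and supp: "bounded {z. F z \<noteq> 0}" and "0 < \<eta>"
  shows "\<exists>C>0. \<forall>z w. cmod (F z - F w) \<le> \<eta> + C * chordal2 z w"
proof -
  obtain \<delta> where "0 < \<delta>" and \<delta>: "\<And>z w. cmod (z - w) < \<delta> \<Longrightarrow> cmod (F z - F w) \<le> \<eta>"
    using compact_support_uniformly_continuous[OF assms] by blast
  obtain B where "0 < B" and B: "\<And>z. cmod (F z) \<le> B"
    using compact_support_bounded[OF F supp] by blast
  obtain K where K: "\<And>z. F z \<noteq> 0 \<Longrightarrow> cmod z \<le> K"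
    using supp unfolding bounded_iff by auto
  define m where "m = \<delta>\<^sup>2 / ((1 + K\<^sup>2) * (1 + 2 * \<delta>\<^sup>2 + 2 * K\<^sup>2))"
  have "0 < m" unfolding m_def using \<open>0 < \<delta>\<close> by (auto intro!: divide_pos_pos mult_pos_pos simp: add_pos_nonneg)
  have "cmod (F z - F w) \<le> \<eta> + 2 * B / m * chordal2 z w" for z w
  proof (cases "cmod (z - w) < \<delta> \<or> F z = 0 \<and> F w = 0")
    case True
    then have "cmod (F z - F w) \<le> \<eta>" using \<delta> \<open>0 < \<eta>\<close> by auto
    moreover have "0 \<le> 2 * B / m * chordal2 z w" using \<open>0 < B\<close> \<open>0 < m\<close> by simp
    ultimately show ?thesis by linarith
  next
    case False
    then have "cmod z \<le> K \<or> cmod w \<le> K" using K by auto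
    then have "m \<le> chordal2 z w"
      using chordal2_lower_bound[of \<delta> z w K] chordal2_lower_bound[of \<delta> w z K] False \<open>0 < \<delta>\<close>
      by (auto simp: m_def chordal2_commute norm_minus_commute)
    then have "2 * B / m * m \<le> 2 * B / m * chordal2 z w"
      using \<open>0 < B\<close> \<open>0 < m\<close> by (intro mult_left_mono) auto
    moreover have "cmod (F z - F w) \<le> B + B"
      by (intro order_trans[OF norm_triangle_ineq4] add_mono B)
    ultimately show ?thesis using \<open>0 < m\<close> \<open>0 < \<eta>\<close> by simp
  qed
  then show ?thesis using \<open>0 < B\<close> \<open>0 < m\<close> by (intro exI[of _ "2 * B / m"]) auto
qed

text \<open>The counterpart for the comparison with the symbol, where errors are controlled in L1
  and not in chordal distance.\<close>

lemma compact_support_linear_modulus: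
  fixes F :: "complex \<Rightarrow> complex"
  assumes F: "continuous_on UNIV F" and supp: "bounded {z. F z \<noteq> 0}" and "0 < \<eta>"
  shows "\<exists>C>0. \<forall>z w. cmod (F z - F w) \<le> \<eta> + C * cmod (z - w)"
proof -
  obtain \<delta> where "0 < \<delta>" and \<delta>: "\<And>z w. cmod (z - w) < \<delta> \<Longrightarrow> cmod (F z - F w) \<le> \<eta>"
    using compact_support_uniformly_continuous[OF assms] by blast
  obtain B where "0 < B" and B: "\<And>z. cmod (F z) \<le> B"
    using compact_support_bounded[OF F supp] by blast
  have "cmod (F z - F w) \<le> \<eta> + 2 * B / \<delta> * cmod (z - w)" for z w
  proof (cases "cmod (z - w) < \<delta>")
    case True
    moreover have "0 \<le> 2 * B / \<delta> * cmod (z - w)" using \<open>0 < B\<close> \<open>0 < \<delta>\<close> by simp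
    ultimately show ?thesis using \<delta>[of z w] by linarith
  next
    case False
    then have "2 * B / \<delta> * \<delta> \<le> 2 * B / \<delta> * cmod (z - w)"
      using \<open>0 < B\<close> \<open>0 < \<delta>\<close> by (intro mult_left_mono) auto
    moreover have "cmod (F z - F w) \<le> B + B"
      by (intro order_trans[OF norm_triangle_ineq4] add_mono B)
    ultimately show ?thesis using \<open>0 < \<delta>\<close> \<open>0 < \<eta>\<close> by simp
  qed
  then show ?thesis using \<open>0 < B\<close> \<open>0 < \<delta>\<close> by (intro exI[of _ "2 * B / \<delta>"]) auto
qed

section \<open>Lebesgue integrals of products in the plane\<close>

text \<open>Lebesgue measure in the plane is the completion of a product of Borel measures, so
  Fubini is applied to a Borel representative of h and the result is carried back along null
  sets.\<close>

lemma lebesgue_product_integral: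
  fixes h :: "real \<Rightarrow> 'b::euclidean_space" and S :: "real set"
  assumes h: "integrable lebesgue h" and S: "S \<in> sets borel" "emeasure lborel S < \<infinity>"
  shows "integrable lebesgue (\<lambda>(x, \<theta>). indicator S x *\<^sub>R h \<theta>)"
    and "(LINT z|lebesgue. (case z of (x, \<theta>) \<Rightarrow> indicator S x *\<^sub>R h \<theta>)) = measure lborel S *\<^sub>R integral\<^sup>L lebesgue h"
proof -
  have "h measurable_on UNIV"
    using h by (intro lebesgue_measurable_imp_measurable_on) auto
  then obtain N u where N: "negligible N" and u: "\<And>n. continuous_on UNIV (u n)"
    and uh: "\<And>x. x \<notin> N \<Longrightarrow> (\<lambda>n::nat. u n x) \<longlonglongrightarrow> h x"
    unfolding measurable_on_def by auto
  \<comment> \<open>A limit of continuous functions is Borel. Where the sequence diverges,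
    \<open>lim\<close> is an unspecified value, which concerns only a null set.\<close>
  define g where "g = (\<lambda>x. lim (\<lambda>n. u n x))"
  have g: "g \<in> borel_measurable lborel"
    unfolding g_def using u by (intro borel_measurable_lim_metric) (auto intro: borel_measurable_continuous_onI)
  obtain N' where N': "N' \<in> null_sets lborel" "N \<subseteq> N'"
    using N unfolding negligible_iff_null_sets null_sets_completion_iff2 by auto
  have "h \<theta> = g \<theta>" if "\<theta> \<notin> N" for \<theta>
    using limI[OF uh[OF that]] by (simp add: g_def)
  then have ae: "AE \<theta> in lborel. h \<theta> = g \<theta>"
    by (intro AE_I'[OF N'(1)]) (use N'(2) in auto)
  have g': "g \<in> borel_measurable lebesgue" using g by (rule measurable_completion)
  have gi: "integrable lborel g"
  proof -
    have "integrable lebesgue g"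
      using h ae g' by (subst integrable_cong_AE[symmetric, of h]) (auto intro: AE_completion)
    then show ?thesis using g by (simp add: integrable_completion)
  qed
  have hg: "integral\<^sup>L lebesgue h = integral\<^sup>L lborel g"
  proof -
    have "integral\<^sup>L lebesgue h = integral\<^sup>L lebesgue g"
      using h ae g' by (intro integral_cong_AE) (auto intro: AE_completion)
    then show ?thesis using g by (simp add: integral_completion)
  qed
  define G where "G = (\<lambda>(x::real, \<theta>). indicator S x *\<^sub>R g \<theta>)"
  have GM: "G \<in> borel_measurable (lborel \<Otimes>\<^sub>M lborel)"
    unfolding G_def using g S by measurable
  have indint: "integrable lborel (\<lambda>x. indicator S x *\<^sub>R c)" for c :: 'b
    using S by (intro integrable_scaleR_left) (auto simp: integrable_indicator_iff)
  have "integrable (lborel \<Otimes>\<^sub>M lborel) G"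
  proof (rule lborel_pair.Fubini_integrable[OF GM])
    have "(LINT \<theta>|lborel. norm (G (x, \<theta>))) = indicator S x *\<^sub>R (LINT \<theta>|lborel. norm (g \<theta>))" for x
      by (simp add: G_def)
    moreover have "integrable lborel (\<lambda>x. indicator S x *\<^sub>R (LINT \<theta>|lborel. norm (g \<theta>)))"
      using S by (intro integrable_scaleR_left) (auto simp: integrable_indicator_iff)
    ultimately show "integrable lborel (\<lambda>x. LINT \<theta>|lborel. norm (G (x, \<theta>)))" by simp
    show "AE x in lborel. integrable lborel (\<lambda>\<theta>. G (x, \<theta>))"
      using gi by (simp add: G_def)
  qed
  then have Gi: "integrable lborel G" unfolding lborel_prod .
  have "integral\<^sup>L lborel G = (LINT x|lborel. LINT \<theta>|lborel. G (x, \<theta>))"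
    using lborel_pair.integral_fst'[of G] \<open>integrable (lborel \<Otimes>\<^sub>M lborel) G\<close> unfolding lborel_prod by simp
  also have "\<dots> = (LINT x|lborel. indicator S x *\<^sub>R integral\<^sup>L lborel g)"
    by (simp add: G_def)
  also have "\<dots> = measure lborel S *\<^sub>R integral\<^sup>L lborel g"
    using S by (subst integral_scaleR_left) (auto simp: integrable_indicator_iff)
  finally have Gint: "integral\<^sup>L lborel G = measure lborel S *\<^sub>R integral\<^sup>L lborel g" .
  have Gae: "AE z in lebesgue. (case z of (x, \<theta>) \<Rightarrow> indicator S x *\<^sub>R h \<theta>) = G z"
  proof (rule AE_completion)
    obtain N where N: "N \<in> null_sets lborel" "{\<theta>. h \<theta> \<noteq> g \<theta>} \<subseteq> N"
      using ae by (auto elim!: AE_E simp: null_sets_def)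
    have "emeasure (lborel \<Otimes>\<^sub>M lborel) (UNIV \<times> N :: (real \<times> real) set) = 0"
      using N(1) by (subst lborel.emeasure_pair_measure_Times) auto
    then have "UNIV \<times> N \<in> null_sets (lborel :: (real \<times> real) measure)"
      using N(1) unfolding lborel_prod[symmetric] by (auto simp: null_sets_def)
    then show "AE z in lborel. (case z of (x, \<theta>) \<Rightarrow> indicator S x *\<^sub>R h \<theta>) = G z"
      by (rule AE_I') (use N(2) in \<open>auto simp: G_def\<close>)
  qed
  have Gm: "G \<in> borel_measurable lborel" using Gi by auto
  have Gm': "G \<in> borel_measurable lebesgue" using Gm by (rule measurable_completion)
  have hm: "(\<lambda>(x, \<theta>). indicator S x *\<^sub>R h \<theta>) \<in> borel_measurable lebesgue"
    by (rule borel_measurable_AE[OF Gm']) (use Gae in \<open>auto elim: eventually_mono\<close>)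
  have "integrable lebesgue G" using Gi Gm by (simp add: integrable_completion)
  then show "integrable lebesgue (\<lambda>(x, \<theta>). indicator S x *\<^sub>R h \<theta>)"
    using Gae Gm' hm by (subst integrable_cong_AE[of _ _ G]) auto
  have "(LINT z|lebesgue. (case z of (x, \<theta>) \<Rightarrow> indicator S x *\<^sub>R h \<theta>)) = integral\<^sup>L lebesgue G"
    using Gae Gm' hm by (intro integral_cong_AE) auto
  also have "\<dots> = integral\<^sup>L lborel G" using Gm by (simp add: integral_completion)
  finally show "(LINT z|lebesgue. (case z of (x, \<theta>) \<Rightarrow> indicator S x *\<^sub>R h \<theta>)) = measure lborel S *\<^sub>R integral\<^sup>L lebesgue h"
    by (simp add: Gint hg)
qed

section \<open>Block Fourier vectors\<close>

definition grid_angle :: "nat \<Rightarrow> nat \<Rightarrow> real" where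
  "grid_angle L k = -pi + 2 * pi * real k / real L"

text \<open>The columns form an orthonormal basis: discrete Fourier vectors supported on \<open>s\<close> consecutive
  blocks of length \<open>L\<close>, and unit vectors for the indices beyond the last block.\<close>

definition block_dft :: "nat \<Rightarrow> nat \<Rightarrow> nat \<Rightarrow> nat \<Rightarrow> complex" where
  "block_dft s L i j =
     (if i < s * L \<and> j < s * L
      then (if i div L = j div L
            then exp (- \<i> * of_nat i * of_real (grid_angle L (j mod L))) / of_real (sqrt (real L)) else 0)
      else if i = j then 1 else 0)"

lemma sum_roots_of_unity:
  assumes "\<bar>m\<bar> < int L"
  shows "(\<Sum>k<L. exp (\<i> * of_int m * of_real (2 * pi * real k / real L))) = (if m = 0 then of_nat L else 0)"
proof (cases "m = 0")
  case False
  have "0 < L" using assms by linarith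
  define w where "w = exp (\<i> * of_int m * of_real (2 * pi / real L))"
  have pw: "exp (\<i> * of_int m * of_real (2 * pi * real k / real L)) = w ^ k" for k
    unfolding w_def exp_of_nat_mult[symmetric] by (simp add: mult_ac)
  have "w \<noteq> 1"
  proof
    assume "w = 1"
    then obtain n :: int where "of_int m * (2 * pi / real L) = of_int (2 * n) * pi"
      unfolding w_def exp_eq_1 by auto
    then have "real_of_int m = of_int n * real L" using \<open>0 < L\<close> by (simp add: field_simps)
    then have m: "m = n * int L" by (metis of_int_eq_iff of_int_mult of_int_of_nat_eq)
    then have "n \<noteq> 0" using False by auto
    then have "1 * int L \<le> \<bar>n\<bar> * int L" by (intro mult_right_mono) auto
    then show False using assms m by (simp add: abs_mult)
  qed
  have "w ^ L = exp (\<i> * of_int m * of_real (2 * pi * real L / real L))" by (rule pw[symmetric])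
  also have "\<dots> = 1" using \<open>0 < L\<close> unfolding exp_eq_1 by (auto intro!: exI[of _ m])
  finally have "w ^ L = 1" .
  then show ?thesis
    using False unfolding pw by (simp add: geometric_sum[OF \<open>w \<noteq> 1\<close>])
qed simp

lemma sum_block:
  fixes f :: "nat \<Rightarrow> complex"
  assumes "\<And>k. k < n \<Longrightarrow> k div L \<noteq> b \<Longrightarrow> f k = 0" and "b * L + L \<le> n" and "0 < L"
  shows "(\<Sum>k<n. f k) = (\<Sum>r<L. f (b * L + r))"
proof -
  have "(\<Sum>k<n. f k) = (\<Sum>k\<in>{b * L..<b * L + L}. f k)"
  proof (rule sum.mono_neutral_right)
    show "\<forall>k\<in>{..<n} - {b * L..<b * L + L}. f k = 0"
    proof
      fix k assume "k \<in> {..<n} - {b * L..<b * L + L}"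
      then have "k div L \<noteq> b"
        using \<open>0 < L\<close> by (auto simp: not_le not_less dest: div_mult_mod_eq[symmetric, THEN subst])
           (metis \<open>0 < L\<close> add_less_cancel_left div_mult_mod_eq le_add1 mod_less_divisor not_le)+
      then show "f k = 0" using assms(1) \<open>k \<in> {..<n} - {b * L..<b * L + L}\<close> by auto
    qed
  qed (use assms(2) in auto)
  also have "\<dots> = (\<Sum>r<L. f (b * L + r))"
    using sum.shift_bounds_nat_ivl[of f 0 "b * L" L] by (simp add: add.commute atLeast0LessThan)
  finally show ?thesis .
qed

lemma unitary_block_dft:
  assumes "0 < L" "s * L \<le> n"
  shows "unitary_fun n (block_dft s L)"
proof -
  let ?v = "block_dft s L"
  have block_end: "b * L + L \<le> n" if "b < s" for b
  proof -
    have "Suc b * L \<le> s * L" using that by (intro mult_right_mono) auto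
    then show ?thesis using assms by simp
  qed
  have div_less: "i div L < s" if "i < s * L" for i
    using that by (simp add: less_mult_imp_div_less)
  have in_range: "b * L + r < s * L" if "b < s" "r < L" for b r
  proof -
    have "Suc b * L \<le> s * L" using that by (intro mult_right_mono) auto
    then show ?thesis using that by simp
  qed
  have LL: "of_real (sqrt (real L)) * of_real (sqrt (real L)) = (of_nat L :: complex)"
    by (simp flip: of_real_mult)
  have "(\<Sum>k<n. cnj (?v k i) * ?v k j) = (if i = j then 1 else 0)" if "i < n" "j < n" for i j
  proof -
    consider "s * L \<le> i" | "s * L \<le> j" | "i < s * L" "j < s * L" "i div L \<noteq> j div L"
      | "i < s * L" "j < s * L" "i div L = j div L" by linarith
    then show ?thesis
    proof cases
      case 1
      then have "(\<Sum>k<n. cnj (?v k i) * ?v k j) = (\<Sum>k<n. if k = i then ?v i j else 0)"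
        by (intro sum.cong refl) (auto simp: block_dft_def)
      then show ?thesis using 1 that by (simp add: block_dft_def)
    next
      case 2
      then have "(\<Sum>k<n. cnj (?v k i) * ?v k j) = (\<Sum>k<n. if k = j then cnj (?v j i) else 0)"
        by (intro sum.cong refl) (auto simp: block_dft_def)
      then show ?thesis using 2 that by (simp add: block_dft_def)
    next
      case 3
      then have "(\<Sum>k<n. cnj (?v k i) * ?v k j) = 0"
        by (intro sum.neutral) (auto simp: block_dft_def)
      then show ?thesis using 3 by auto
    next
      case 4
      define b where "b = i div L"
      have "b < s" using 4 div_less by (simp add: b_def)
      define m where "m = int (i mod L) - int (j mod L)"
      have "(\<Sum>k<n. cnj (?v k i) * ?v k j) = (\<Sum>r<L. cnj (?v (b * L + r) i) * ?v (b * L + r) j)"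
        using 4 block_end[OF \<open>b < s\<close>] assms by (intro sum_block) (auto simp: block_dft_def b_def)
      also have "\<dots> = (\<Sum>r<L. exp (\<i> * of_int m * of_real (2 * pi * real (b * L + r) / real L)) / of_nat L)"
      proof (intro sum.cong refl)
        fix r assume "r \<in> {..<L}"
        then have r: "b * L + r < s * L" "(b * L + r) div L = b"
          using in_range[OF \<open>b < s\<close>] by auto
        have "cnj (?v (b * L + r) i) * ?v (b * L + r) j
           = exp (cnj (- \<i> * of_nat (b * L + r) * of_real (grid_angle L (i mod L)))) *
             exp (- \<i> * of_nat (b * L + r) * of_real (grid_angle L (j mod L))) / of_nat L"
          using r 4 unfolding LL[symmetric] by (simp add: block_dft_def b_def exp_cnj del: of_nat_add of_nat_mult)
        also have "\<dots> = exp (\<i> * of_int m * of_real (2 * pi * real (b * L + r) / real L)) / of_nat L"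
          unfolding exp_add[symmetric]
          by (simp add: grid_angle_def m_def algebra_simps diff_divide_distrib add_divide_distrib)
        finally show "cnj (?v (b * L + r) i) * ?v (b * L + r) j = \<dots>" .
      qed
      \<comment> \<open>The exponentials are numbered by the global row index; the offset b L
        changes the phase by an integral multiple of 2 pi and drops out.\<close>
      also have "\<dots> = (\<Sum>r<L. exp (\<i> * of_int m * of_real (2 * pi * real r / real L))) / of_nat L"
        unfolding sum_divide_distrib
      proof (intro sum.cong refl arg_cong[of _ _ "\<lambda>x. x / of_nat L"])
        fix r assume "r \<in> {..<L}"
        have "\<i> * of_int m * of_real (2 * pi * real (b * L + r) / real L)
            = \<i> * of_int m * of_real (2 * pi * real r / real L) + (of_int (2 * (m * int b)) * of_real pi) * \<i>"
          using \<open>0 < L\<close> by (simp add: field_simps)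
        then show "exp (\<i> * of_int m * of_real (2 * pi * real (b * L + r) / real L))
            = exp (\<i> * of_int m * of_real (2 * pi * real r / real L))"
          unfolding exp_eq by (intro exI[of _ "m * int b"]) simp
      qed
      also have "\<dots> = (if m = 0 then 1 else 0)"
      proof -
        have "i mod L < L" "j mod L < L" using \<open>0 < L\<close> by auto
        then have "\<bar>m\<bar> < int L" unfolding m_def by linarith
        then show ?thesis using \<open>0 < L\<close> by (subst sum_roots_of_unity) auto
      qed
      also have "m = 0 \<longleftrightarrow> i = j"
        using 4 div_mult_mod_eq[of i L] div_mult_mod_eq[of j L] by (auto simp: m_def)
      finally show ?thesis .
    qed
  qed
  then show ?thesis by (rule unitary_funI)
qed

lemma local_symbol_family:
  assumes "finite I" "\<And>l. l \<in> I \<Longrightarrow> trig_poly (p l)"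
  shows "\<exists>d. \<forall>l\<in>I. local_symbol d (p l)"
  using assms
proof (induction I)
  case (insert x I)
  then obtain d where d: "\<And>l. l \<in> I \<Longrightarrow> local_symbol d (p l)" by auto
  obtain e where "local_symbol e (p x)"
    using trig_poly_local_symbol[of "p x"] insert.prems by auto
  then show ?case
    using d by (intro exI[of _ "max d e"]) (auto intro: local_symbol_mono[OF _ max.cobounded1] local_symbol_mono[OF _ max.cobounded2])
qed simp

section \<open>Exceptional blocks and rows\<close>

text \<open>On a bad block 0 is an arbitrary default: its rows go into the rank part, and its strip
  into the part of small measure.\<close>

definition block_value :: "(real \<Rightarrow> complex) \<Rightarrow> real \<Rightarrow> nat \<Rightarrow> nat \<Rightarrow> complex" where
  "block_value a \<epsilon> s b = (if b \<in> bad_blocks a \<epsilon> s then 0 else a (real b / real s))"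

text \<open>Rows given up to the rank part. Within d of either end of a block the window of
  \<open>local_symbol\<close> leaves the block, and there a block Fourier vector is no longer a pure
  exponential.\<close>

definition bad_rows :: "nat set \<Rightarrow> (nat \<Rightarrow> real \<Rightarrow> complex) \<Rightarrow> real \<Rightarrow> nat \<Rightarrow> nat \<Rightarrow> nat \<Rightarrow> nat set" where
  "bad_rows I a \<epsilon> s L d = {i. s * L \<le> i \<or> i mod L < d \<or> L \<le> i mod L + d \<or>
     (\<exists>l\<in>I. i div L \<in> bad_blocks (a l) \<epsilon> s)}"

text \<open>Fewer than s rows lie beyond the last block, each block loses at most d rows at either
  end, and each bad block loses all its L rows.\<close>

lemma card_bad_rows:
  assumes "finite I" "0 < s" and L: "L = n div s" "0 < L"
  shows "card (bad_rows I a \<epsilon> s L d \<inter> {..<n}) \<le> s + s * (2 * d) + (\<Sum>l\<in>I. card (bad_blocks (a l) \<epsilon> s) * L)"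
proof -
  let ?blk = "\<lambda>b. {b * L..<b * L + L}"
  have sub: "bad_rows I a \<epsilon> s L d \<inter> {..<n} \<subseteq> {s * L..<n} \<union>
     (\<Union>b<s. {b * L..<b * L + d} \<union> {b * L + (L - d)..<b * L + L}) \<union>
     (\<Union>l\<in>I. \<Union>b\<in>bad_blocks (a l) \<epsilon> s. ?blk b)"
  proof
    fix i assume i: "i \<in> bad_rows I a \<epsilon> s L d \<inter> {..<n}"
    have eq: "i = (i div L) * L + i mod L" and r: "i mod L < L" using \<open>0 < L\<close> by simp_all
    show "i \<in> {s * L..<n} \<union> (\<Union>b<s. {b * L..<b * L + d} \<union> {b * L + (L - d)..<b * L + L}) \<union>
     (\<Union>l\<in>I. \<Union>b\<in>bad_blocks (a l) \<epsilon> s. ?blk b)"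
    proof (cases "s * L \<le> i")
      case True
      then show ?thesis using i by auto
    next
      case False
      then have b: "i div L < s" by (simp add: less_mult_imp_div_less not_le)
      have "i \<in> ?blk (i div L)" using eq r by (metis add_less_cancel_left atLeastLessThan_iff le_add1)
      consider "i mod L < d" | "L \<le> i mod L + d" | l where "l \<in> I" "i div L \<in> bad_blocks (a l) \<epsilon> s"
        using i False by (auto simp: bad_rows_def)
      then show ?thesis
      proof cases
        case 1
        then have "i \<in> {(i div L) * L..<(i div L) * L + d}"
          using eq by (metis add_less_cancel_left atLeastLessThan_iff le_add1)
        then show ?thesis using b by blast
      next
        case 2
        then have "L - d \<le> i mod L" by simp
        then have "i \<in> {(i div L) * L + (L - d)..<(i div L) * L + L}"
          using eq r by (metis add_le_cancel_left add_less_cancel_left atLeastLessThan_iff)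
        then show ?thesis using b by blast
      next
        case 3
        then show ?thesis using \<open>i \<in> ?blk (i div L)\<close> by blast
      qed
    qed
  qed
  have "card (bad_rows I a \<epsilon> s L d \<inter> {..<n}) \<le> card ({s * L..<n} \<union>
     (\<Union>b<s. {b * L..<b * L + d} \<union> {b * L + (L - d)..<b * L + L}) \<union>
     (\<Union>l\<in>I. \<Union>b\<in>bad_blocks (a l) \<epsilon> s. ?blk b))"
    using \<open>finite I\<close> by (intro card_mono sub) auto
  also have "\<dots> \<le> card {s * L..<n} + card (\<Union>b<s. {b * L..<b * L + d} \<union> {b * L + (L - d)..<b * L + L})
     + card (\<Union>l\<in>I. \<Union>b\<in>bad_blocks (a l) \<epsilon> s. ?blk b)"
    by (intro order_trans[OF card_Un_le] add_mono card_Un_le order_refl)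
  also have "\<dots> \<le> s + s * (2 * d) + (\<Sum>l\<in>I. card (bad_blocks (a l) \<epsilon> s) * L)"
  proof (intro add_mono)
    have "n - s * L = n mod s" by (simp add: L minus_mult_div_eq_mod)
    then show "card {s * L..<n} \<le> s" using \<open>0 < s\<close> by (simp add: less_imp_le)
    have "card (\<Union>b<s. {b * L..<b * L + d} \<union> {b * L + (L - d)..<b * L + L})
        \<le> (\<Sum>b<s. card ({b * L..<b * L + d} \<union> {b * L + (L - d)..<b * L + L}))"
      by (rule card_UN_le) auto
    also have "\<dots> \<le> (\<Sum>b<s. 2 * d)"
      by (intro sum_mono order_trans[OF card_Un_le]) auto
    finally show "card (\<Union>b<s. {b * L..<b * L + d} \<union> {b * L + (L - d)..<b * L + L}) \<le> s * (2 * d)" by simp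
    have "card (\<Union>l\<in>I. \<Union>b\<in>bad_blocks (a l) \<epsilon> s. ?blk b) \<le> (\<Sum>l\<in>I. card (\<Union>b\<in>bad_blocks (a l) \<epsilon> s. ?blk b))"
      by (rule card_UN_le) (rule \<open>finite I\<close>)
    also have "\<dots> \<le> (\<Sum>l\<in>I. \<Sum>b\<in>bad_blocks (a l) \<epsilon> s. card (?blk b))"
      by (intro sum_mono card_UN_le) auto
    finally show "card (\<Union>l\<in>I. \<Union>b\<in>bad_blocks (a l) \<epsilon> s. ?blk b) \<le> (\<Sum>l\<in>I. card (bad_blocks (a l) \<epsilon> s) * L)"
      by simp
  qed
  finally show ?thesis .
qed

text \<open>Block b starts at row b L, which falls short of b n / s by at most b, and b < s \<le> L
  \<le> n / s. So its samples lie at most one block length to the left of b / s; they do not drift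
  to the right since s L \<le> n.\<close>

lemma sample_point_in_block:
  assumes "0 < s" "L = n div s" "s \<le> L" "i < s * L"
  shows "(real (i div L) - 1) / s \<le> real (Suc i) / n" "real (Suc i) / n \<le> (real (i div L) + 1) / s"
    "real (Suc i) / n \<le> 1"
proof -
  define b where "b = i div L"
  have "0 < L" using assms by linarith
  have sL: "s * L \<le> n" using assms by simp
  have ns: "n < s * L + s"
    using div_mult_mod_eq[of n s] mod_less_divisor[OF \<open>0 < s\<close>, of n]
    unfolding assms(2) mult.commute[of s] by linarith
  have "0 < n" using sL \<open>0 < L\<close> \<open>0 < s\<close> by (metis gr0I le_zero_eq mult_is_0 neq0_conv)
  have i: "i < b * L + L" "b * L \<le> i"
    using div_mult_mod_eq[of i L] mod_less_divisor[OF \<open>0 < L\<close>, of i] unfolding b_def by linarith+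
  have "b < s" using assms(4) by (simp add: b_def less_mult_imp_div_less)
  have "real (Suc i) * s \<le> (real b + 1) * n"
  proof -
    have "Suc i * s \<le> (b * L + L) * s" using i by (intro mult_right_mono) auto
    also have "\<dots> = (b + 1) * (s * L)" by (simp add: algebra_simps)
    also have "\<dots> \<le> (b + 1) * n" using sL by (intro mult_left_mono) auto
    finally have "real (Suc i * s) \<le> real ((b + 1) * n)" by (simp only: of_nat_le_iff)
    then show ?thesis by (simp add: algebra_simps)
  qed
  then show "real (Suc i) / n \<le> (real (i div L) + 1) / s"
    using \<open>0 < n\<close> \<open>0 < s\<close> by (simp add: b_def[symmetric] divide_simps del: of_nat_Suc)
  have "(real b - 1) * n \<le> real (Suc i) * s"
  proof (cases "b = 0")
    case True
    have "- real n \<le> 0" by simp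
    also have "0 \<le> real (Suc i) * s" by simp
    finally show ?thesis using True by simp
  next
    case False
    then obtain c where c: "b = Suc c" by (cases b) auto
    have "c * n \<le> c * (s * L + s)" using ns by (intro mult_left_mono) auto
    also have "\<dots> = c * L * s + c * s" by (simp add: algebra_simps)
    also have "\<dots> \<le> c * L * s + L * s" using c \<open>b < s\<close> \<open>s \<le> L\<close> by simp
    also have "\<dots> = b * L * s" by (simp add: c algebra_simps)
    also have "\<dots> \<le> Suc i * s" using i by (intro mult_right_mono) auto
    finally have "real (c * n) \<le> real (Suc i * s)" by (simp only: of_nat_le_iff)
    then show ?thesis by (simp add: c del: of_nat_Suc) (simp add: algebra_simps)
  qed
  then show "(real (i div L) - 1) / s \<le> real (Suc i) / n"
    using \<open>0 < n\<close> \<open>0 < s\<close> by (simp add: b_def[symmetric] divide_simps del: of_nat_Suc)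
  show "real (Suc i) / n \<le> 1" using assms(4) sL \<open>0 < n\<close> by (simp add: divide_le_eq del: of_nat_Suc)
qed

lemma block_value_error:
  assumes "0 < s" "L = n div s" "s \<le> L" "i < s * L" "i div L \<notin> bad_blocks a \<epsilon> s"
  shows "cmod (a (real (Suc i) / n) - block_value a \<epsilon> s (i div L)) \<le> \<epsilon>"
proof -
  define b where "b = i div L"
  have "b < s" using assms(4) by (simp add: b_def less_mult_imp_div_less)
  then have 1: "real b / s \<in> {0..1}" by (simp add: divide_le_eq)
  have 2: "real (Suc i) / n \<in> {0..1}" using sample_point_in_block(3)[OF assms(1-4)] by simp
  have 3: "(real b - 1) / s \<le> real b / s" "real b / s \<le> (real b + 1) / s"
    by (auto intro!: divide_right_mono)
  have "cmod (a x - a y) \<le> \<epsilon>" if "x \<in> {0..1}" "y \<in> {0..1}"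
    "(real b - 1) / s \<le> x" "x \<le> (real b + 1) / s" "(real b - 1) / s \<le> y" "y \<le> (real b + 1) / s" for x y
    using assms(5) \<open>b < s\<close> that unfolding bad_blocks_def b_def[symmetric] mem_Collect_eq by blast
  from this[OF 2 1 _ _ 3] sample_point_in_block(1,2)[OF assms(1-4)] show ?thesis
    using assms(5) by (simp add: block_value_def b_def[symmetric] del: of_nat_Suc)
qed

text \<open>Away from the bad rows, the block Fourier vectors are exact eigenvectors of the matrix whose
  sampled functions are blockwise constant and whose Toeplitz symbols are trigonometric polynomials.\<close>

lemma glt_block_decomposition:
  fixes a f p :: "nat \<Rightarrow> real \<Rightarrow> complex"
  assumes I: "finite I" and s: "0 < s" "L = n div s" "s \<le> L" and "0 < \<epsilon>"
    and f: "\<And>l. l \<in> I \<Longrightarrow> integrable circle_measure (f l)"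
    and p: "\<And>l. l \<in> I \<Longrightarrow> trig_poly (p l)" and d: "\<And>l. l \<in> I \<Longrightarrow> local_symbol d (p l)"
    and M: "\<And>l b. l \<in> I \<Longrightarrow> b < s \<Longrightarrow> cmod (block_value (a l) \<epsilon> s b) \<le> M" "0 \<le> M"
  defines "B \<equiv> (\<lambda>i k. \<Sum>l\<in>I. a l (real (Suc i) / n) * fourier_coeff (f l) (int i - int k))"
    and "\<mu> \<equiv> (\<lambda>j. if j < s * L
        then \<Sum>l\<in>I. block_value (a l) \<epsilon> s (j div L) * p l (grid_angle L (j mod L)) else 0)"
  shows "\<exists>R T. rank_le n (card (bad_rows I a \<epsilon> s L d \<inter> {..<n})) R \<and>
    trace_le n (n * (\<Sum>l\<in>I. \<epsilon> * (LINT \<theta>|circle_measure. cmod (f l \<theta>))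
        + M * (LINT \<theta>|circle_measure. cmod (f l \<theta> - p l \<theta>)))) T \<and>
    (\<forall>i<n. \<forall>j<n. mprod n B (block_dft s L) i j - block_dft s L i j * \<mu> j = R i j + T i j)"
proof -
  let ?v = "block_dft s L" and ?bad = "bad_rows I a \<epsilon> s L d"
  have "0 < L" using s by linarith
  have sL: "s * L \<le> n" using s by simp
  \<comment> \<open>Both coefficients are 0 on bad rows, where a may be arbitrarily large; these
    rows belong entirely to R. On a good row with block value v, a T(f) is split as (a - v) T(f) + v
    T(f - p) + v T(p), and the first two terms form \<open>T1\<close>.\<close>
  define e where "e = (\<lambda>l i. if i \<in> ?bad then 0 else a l (real (Suc i) / n) - block_value (a l) \<epsilon> s (i div L))"
  define \<alpha> where "\<alpha> = (\<lambda>l i. if i \<in> ?bad then 0 else block_value (a l) \<epsilon> s (i div L))"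
  have good: "i < s * L" "i div L \<notin> bad_blocks (a l) \<epsilon> s" if "i \<notin> ?bad" "l \<in> I" for i l
    using that by (auto simp: bad_rows_def not_le)
  have e: "cmod (e l i) \<le> \<epsilon>" if "l \<in> I" for l i
    using block_value_error[OF s, of i "a l" \<epsilon>] good[of i l] that \<open>0 < \<epsilon>\<close> by (auto simp: e_def)
  have \<alpha>: "cmod (\<alpha> l i) \<le> M" if "l \<in> I" for l i
    using M(1)[OF that, of "i div L"] good(1)[of i l] that M(2)
    by (auto simp: \<alpha>_def less_mult_imp_div_less)
  define T1 where "T1 = (\<lambda>i k. \<Sum>l\<in>I. e l i * fourier_coeff (f l) (int i - int k)
      + \<alpha> l i * fourier_coeff (\<lambda>\<theta>. f l \<theta> - p l \<theta>) (int i - int k))"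
  have T1: "trace_le n (n * (\<Sum>l\<in>I. \<epsilon> * (LINT \<theta>|circle_measure. cmod (f l \<theta>))
        + M * (LINT \<theta>|circle_measure. cmod (f l \<theta> - p l \<theta>)))) T1"
  proof -
    \<comment> \<open>The factor 1 / (2 pi) is given away for a simpler statement.\<close>
    have half: "x / (2 * pi) \<le> x" if "0 \<le> x" for x :: real
    proof -
      have "x / (2 * pi) \<le> x / 1" using that pi_gt3 by (intro divide_left_mono) auto
      then show ?thesis by simp
    qed
    have "trace_le n (\<Sum>l\<in>I. \<epsilon> * (n * ((LINT \<theta>|circle_measure. cmod (f l \<theta>)) / (2 * pi)))
        + M * (n * ((LINT \<theta>|circle_measure. cmod (f l \<theta> - p l \<theta>)) / (2 * pi)))) T1"
      unfolding T1_def using \<open>0 < \<epsilon>\<close> M(2)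
      by (intro trace_le_sum trace_le_add trace_le_diag_left trace_le_toeplitz f p e \<alpha>
           Bochner_Integration.integrable_diff integrable_trig_poly) auto
    then show ?thesis
      by (rule trace_le_mono) (unfold sum_distrib_left, intro sum_mono,
        unfold distrib_left mult.left_commute[of "real n"],
        use \<open>0 < \<epsilon>\<close> M(2) in \<open>intro add_mono mult_left_mono half Bochner_Integration.integral_nonneg; simp\<close>)
  qed
  \<comment> \<open>R is defined as the whole remainder, so only its vanishing outside the bad rows
    has to be shown.\<close>
  define R where "R = (\<lambda>i j. mprod n (\<lambda>i k. B i k - T1 i k) ?v i j - ?v i j * \<mu> j)"
  have R0: "R i j = 0" if "i < n" "j < n" "i \<notin> ?bad" for i j
  proof -
    have ib: "i < s * L" "d \<le> i mod L" "i mod L + d < L"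
      using that by (auto simp: bad_rows_def not_le not_less)
    define \<theta> where "\<theta> = grid_angle L (j mod L)"
    have BT: "B i k - T1 i k = (\<Sum>l\<in>I. block_value (a l) \<epsilon> s (i div L) * fourier_coeff (p l) (int i - int k))" for k
      unfolding B_def T1_def sum_subtractf[symmetric]
    proof (rule sum.cong[OF refl])
      fix l assume l: "l \<in> I"
      have eq: "fourier_coeff (\<lambda>\<theta>. f l \<theta> - p l \<theta>) (int i - int k) = fourier_coeff (f l) (int i - int k) - fourier_coeff (p l) (int i - int k)"
        by (rule fourier_coeff_diff[OF f[OF l] integrable_trig_poly[OF p[OF l]]])
      show "a l (real (Suc i) / n) * fourier_coeff (f l) (int i - int k) - (e l i * fourier_coeff (f l) (int i - int k)
         + \<alpha> l i * fourier_coeff (\<lambda>\<theta>. f l \<theta> - p l \<theta>) (int i - int k))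
         = block_value (a l) \<epsilon> s (i div L) * fourier_coeff (p l) (int i - int k)"
        unfolding eq using that(3) by (simp add: e_def \<alpha>_def algebra_simps del: of_nat_Suc)
    qed
    \<comment> \<open>The amplitude seen by the window. For a column that does not belong to the
      block of row i it is 0, and the window condition holds because the column vanishes
      there.\<close>
    define c :: complex where "c = (if j < s * L \<and> j div L = i div L then 1 / of_real (sqrt (real L)) else 0)"
    have window: "0 \<le> m \<and> m < int n \<and> ?v (nat m) j = c * exp (- \<i> * of_int m * of_real \<theta>)"
      if "\<bar>m - int i\<bar> \<le> int d" for m
    proof -
      define b r where "b = i div L" and "r = i mod L"
      have ibr: "i = b * L + r" by (simp add: b_def r_def)
      have "b < s" using ib by (simp add: b_def less_mult_imp_div_less)
      then have "Suc b * L \<le> s * L" by (intro mult_right_mono) auto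
      then have bL: "b * L + L \<le> s * L" by simp
      have m1: "int (b * L) \<le> m" "m < int (b * L + L)"
        using that ib(2,3) ibr unfolding r_def[symmetric] by linarith+
      then have "0 \<le> m" by linarith
      then obtain k where k: "m = int k" by (metis nonneg_int_cases)
      have k1: "b * L \<le> k" "k < b * L + L" using m1 unfolding k by linarith+
      then have "k div L = b"
        using \<open>0 < L\<close> by (intro div_nat_eqI) (auto simp: mult.commute)
      moreover have "k < s * L" using k1 bL by linarith
      moreover have "k < n" using \<open>k < s * L\<close> sL by linarith
      ultimately show ?thesis
        unfolding k by (auto simp: block_dft_def c_def b_def \<theta>_def)
    qed
    have loc: "(\<Sum>k<n. fourier_coeff (p l) (int i - int k) * ?v k j) = p l \<theta> * ?v i j" if "l \<in> I" for l
      by (rule d[OF that, unfolded local_symbol_def, rule_format, OF \<open>i < n\<close>, of "\<lambda>k. ?v k j" c \<theta>, OF window])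
    have "mprod n (\<lambda>i k. B i k - T1 i k) ?v i j
        = (\<Sum>l\<in>I. block_value (a l) \<epsilon> s (i div L) * (\<Sum>k<n. fourier_coeff (p l) (int i - int k) * ?v k j))"
      unfolding mprod_def BT sum_distrib_left sum_distrib_right
      by (subst sum.swap) (simp add: mult.assoc)
    also have "\<dots> = (\<Sum>l\<in>I. block_value (a l) \<epsilon> s (i div L) * p l \<theta>) * ?v i j"
      unfolding sum_distrib_right by (intro sum.cong refl) (simp add: loc)
    also have "\<dots> = ?v i j * \<mu> j"
      using ib(1) by (auto simp: \<mu>_def \<theta>_def block_dft_def)
    finally show ?thesis by (simp add: R_def)
  qed
  have "rank_le n (card (?bad \<inter> {..<n})) R"
    by (rule rank_le_rows) (use R0 in auto)
  moreover have "trace_le n (n * (\<Sum>l\<in>I. \<epsilon> * (LINT \<theta>|circle_measure. cmod (f l \<theta>))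
        + M * (LINT \<theta>|circle_measure. cmod (f l \<theta> - p l \<theta>)))) (mprod n T1 ?v)"
    by (intro trace_le_mprod_right T1 op_bound_unitary unitary_block_dft \<open>0 < L\<close> sL)
  moreover have "mprod n B ?v i j - ?v i j * \<mu> j = R i j + mprod n T1 ?v i j" for i j
    by (simp add: R_def mprod_def left_diff_distrib sum_subtractf)
  ultimately show ?thesis by blast
qed

lemma sum_eigenvalues_close:
  fixes F :: "complex \<Rightarrow> complex"
  assumes U: "unitary_fun n u" and V: "unitary_fun n v"
    and A: "\<And>i j. i < n \<Longrightarrow> j < n \<Longrightarrow> (\<Sum>k<n. cnj (u k i) * A k j) = \<xi> i * cnj (u j i)"
    and AV: "\<And>i j. i < n \<Longrightarrow> j < n \<Longrightarrow> mprod n A v i j - v i j * \<mu> j = R i j + T i j"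
    and R: "rank_le n r R" and T: "trace_le n \<delta> T"
    and F: "\<And>z w. cmod (F z - F w) \<le> \<eta> + C * chordal2 z w" and "0 \<le> C"
  shows "cmod ((\<Sum>i<n. F (\<xi> i)) - (\<Sum>j<n. F (\<mu> j))) \<le> \<eta> * n + C * (4 * r + 2 * \<delta>)"
proof -
  define w where "w = mprod n (adjm u) v"
  have w: "unitary_fun n w" unfolding w_def by (intro unitary_fun_mprod unitary_fun_adjm U V)
  have row: "(\<Sum>j<n. (cmod (w i j))\<^sup>2) = 1" if "i < n" for i
  proof -
    have "complex_of_real (\<Sum>j<n. (cmod (w i j))\<^sup>2) = (\<Sum>j<n. w i j * cnj (w i j))"
      by (simp add: complex_norm_square del: of_real_power)
    also have "\<dots> = 1" using w that unfolding unitary_fun_def by simp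
    finally show ?thesis by (simp only: of_real_eq_1_iff)
  qed
  have col: "(\<Sum>i<n. (cmod (w i j))\<^sup>2) = 1" if "j < n" for j
  proof -
    have "complex_of_real (\<Sum>i<n. (cmod (w i j))\<^sup>2) = (\<Sum>i<n. cnj (w i j) * w i j)"
      by (simp add: complex_norm_square mult.commute del: of_real_power)
    also have "\<dots> = 1" using w that unfolding unitary_fun_def by simp
    finally show ?thesis by (simp only: of_real_eq_1_iff)
  qed
  \<comment> \<open>Row sums 1 spread F(\<xi> i), and column sums 1 spread F(\<mu> j), over the same
    weights, so the difference can be taken termwise.\<close>
  have "(\<Sum>i<n. F (\<xi> i)) = (\<Sum>i<n. \<Sum>j<n. of_real ((cmod (w i j))\<^sup>2) * F (\<xi> i))"
    by (intro sum.cong refl) (simp add: row flip: sum_distrib_right of_real_sum del: of_real_power)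
  moreover have "(\<Sum>j<n. F (\<mu> j)) = (\<Sum>i<n. \<Sum>j<n. of_real ((cmod (w i j))\<^sup>2) * F (\<mu> j))"
    by (subst sum.swap, intro sum.cong refl) (simp add: col flip: sum_distrib_right of_real_sum del: of_real_power)
  ultimately have "cmod ((\<Sum>i<n. F (\<xi> i)) - (\<Sum>j<n. F (\<mu> j)))
      = cmod (\<Sum>i<n. \<Sum>j<n. of_real ((cmod (w i j))\<^sup>2) * (F (\<xi> i) - F (\<mu> j)))"
    by (simp add: sum_subtractf right_diff_distrib del: of_real_power)
  also have "\<dots> \<le> (\<Sum>i<n. \<Sum>j<n. (cmod (w i j))\<^sup>2 * (\<eta> + C * chordal2 (\<xi> i) (\<mu> j)))"
    by (intro order_trans[OF norm_sum] sum_mono) (auto simp: norm_mult norm_power intro!: mult_left_mono F)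
  also have "\<dots> = \<eta> * (\<Sum>i<n. \<Sum>j<n. (cmod (w i j))\<^sup>2) + C * (\<Sum>i<n. \<Sum>j<n. (cmod (w i j))\<^sup>2 * chordal2 (\<xi> i) (\<mu> j))"
    by (simp add: distrib_left sum.distrib sum_distrib_left mult_ac)
  also have "(\<Sum>i<n. \<Sum>j<n. (cmod (w i j))\<^sup>2) = n" by (simp add: row)
  also have "(\<Sum>i<n. \<Sum>j<n. (cmod (w i j))\<^sup>2 * chordal2 (\<xi> i) (\<mu> j)) \<le> 4 * r + 2 * \<delta>"
    using chordal_distance_sum[OF U V A AV R T] by (simp add: w_def mprod_def adjm_def chordal2_def)
  finally show ?thesis using \<open>0 \<le> C\<close> by (simp add: mult_left_mono)
qed

section \<open>The limit of the block averages\<close>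

lemma div_over_tendsto:
  assumes "0 < s"
  shows "(\<lambda>n. real (n div s) / real n) \<longlonglongrightarrow> 1 / real s"
proof (rule real_tendsto_sandwich)
  show "\<forall>\<^sub>F n in sequentially. 1 / real s - 1 / real n \<le> real (n div s) / real n"
    using eventually_gt_at_top[of 0]
  proof eventually_elim
    case (elim n)
    have "n < (n div s) * s + s"
      using div_mult_mod_eq[of n s] mod_less_divisor[OF assms, of n] by linarith
    then have "real n \<le> real ((n div s) * s + s)" by (simp only: of_nat_le_iff)
    then have "1 / real s \<le> (real (n div s) + 1) / real n" using elim assms by (simp add: field_simps)
    then show ?case by (simp add: add_divide_distrib)
  qed
  show "\<forall>\<^sub>F n in sequentially. real (n div s) / real n \<le> 1 / real s"
    using eventually_gt_at_top[of 0]
  proof eventually_elim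
    case (elim n)
    have "real ((n div s) * s) \<le> real n" by (simp only: of_nat_le_iff div_times_less_eq_dividend)
    then show ?case using elim assms by (simp add: field_simps)
  qed
  have "(\<lambda>n. 1 / real s - 1 / real n) \<longlonglongrightarrow> 1 / real s - 0"
    by (intro tendsto_intros lim_1_over_n)
  then show "(\<lambda>n. 1 / real s - 1 / real n) \<longlonglongrightarrow> 1 / real s" by simp
qed auto

text \<open>With s fixed, each block contributes a Riemann sum over L = n div s grid points with
  weight L / n, which tends to 1 / s; the fewer than s remaining indices contribute F 0 with weight
  tending to 0.\<close>

lemma block_average_tendsto:
  fixes g :: "nat \<Rightarrow> real \<Rightarrow> complex" and F :: "complex \<Rightarrow> complex"
  assumes "0 < s" and g: "\<And>b. continuous_on {-pi..pi} (g b)" and F: "continuous_on UNIV F"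
  shows "(\<lambda>n. (\<Sum>j<n. F (if j < s * (n div s) then g (j div (n div s)) (grid_angle (n div s) (j mod (n div s))) else 0)) / of_nat n)
     \<longlonglongrightarrow> (\<Sum>b<s. (LINT \<theta>|circle_measure. F (g b \<theta>))) / (2 * of_real pi * of_nat s)"
proof -
  define S where "S = (\<lambda>b L. (\<Sum>k<L. F (g b (grid_angle L k))) / of_nat L)"
  have div_top: "filterlim (\<lambda>n. n div s) at_top sequentially"
    unfolding filterlim_at_top
  proof
    fix Z
    show "\<forall>\<^sub>F n in sequentially. Z \<le> n div s"
      using eventually_ge_at_top[of "Z * s"] by eventually_elim (simp add: \<open>0 < s\<close> less_eq_div_iff_mult_less_eq)
  qed
  have lim_S: "S b \<longlonglongrightarrow> (LINT \<theta>|circle_measure. F (g b \<theta>)) / (2 * of_real pi)" for b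
    using riemann_sum_tendsto[of "\<lambda>\<theta>. F (g b \<theta>)"] continuous_on_compose2[OF F g]
    unfolding S_def grid_angle_def by auto
  have "(\<lambda>n. (\<Sum>b<s. of_real (real (n div s) / real n) * S b (n div s)) + of_real (1 - real s * (real (n div s) / real n)) * F 0)
     \<longlonglongrightarrow> (\<Sum>b<s. of_real (1 / real s) * ((LINT \<theta>|circle_measure. F (g b \<theta>)) / (2 * of_real pi))) + of_real (1 - real s * (1 / real s)) * F 0"
    by (intro tendsto_intros div_over_tendsto \<open>0 < s\<close> filterlim_compose[OF lim_S div_top])
  also have "(\<Sum>b<s. of_real (1 / real s) * ((LINT \<theta>|circle_measure. F (g b \<theta>)) / (2 * of_real pi))) + of_real (1 - real s * (1 / real s)) * F 0
     = (\<Sum>b<s. (LINT \<theta>|circle_measure. F (g b \<theta>))) / (2 * of_real pi * of_nat s)"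
    using \<open>0 < s\<close> by (simp add: sum_divide_distrib mult_ac)
  finally show ?thesis
  proof (rule Lim_transform_eventually)
    show "\<forall>\<^sub>F n in sequentially. (\<Sum>b<s. of_real (real (n div s) / real n) * S b (n div s)) + of_real (1 - real s * (real (n div s) / real n)) * F 0
      = (\<Sum>j<n. F (if j < s * (n div s) then g (j div (n div s)) (grid_angle (n div s) (j mod (n div s))) else 0)) / of_nat n"
      using eventually_ge_at_top[of s]
    proof eventually_elim
      case (elim n)
      define L where "L = n div s"
      have "0 < L" using elim \<open>0 < s\<close> by (simp add: L_def div_greater_zero_iff)
      have "0 < n" using elim \<open>0 < s\<close> by simp
      have sL: "s * L \<le> n" by (simp add: L_def)
      let ?\<mu> = "\<lambda>j. if j < s * L then g (j div L) (grid_angle L (j mod L)) else 0"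
      have shift: "(\<Sum>j=m..<m + L. h j) = (\<Sum>k<L. h (m + k))" for m and h :: "nat \<Rightarrow> complex"
        using sum.shift_bounds_nat_ivl[of h 0 m L] by (simp add: add.commute atLeast0LessThan)
      have "(\<Sum>j<n. F (?\<mu> j)) = (\<Sum>j<s * L. F (?\<mu> j)) + (\<Sum>j=s * L..<n. F (?\<mu> j))"
        using sum.atLeastLessThan_concat[of 0 "s * L" n "\<lambda>j. F (?\<mu> j)"] sL by (simp add: atLeast0LessThan)
      also have "(\<Sum>j=s * L..<n. F (?\<mu> j)) = (\<Sum>j=s * L..<n. F 0)" by (intro sum.cong) auto
      also have "\<dots> = of_nat (n - s * L) * F 0" by simp
      also have "(\<Sum>j<s * L. F (?\<mu> j)) = (\<Sum>b<s. \<Sum>j=b * L..<b * L + L. F (?\<mu> j))"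
        by (rule sum.nat_group[symmetric])
      also have "\<dots> = (\<Sum>b<s. of_nat L * S b L)"
      proof (rule sum.cong[OF refl])
        fix b assume "b \<in> {..<s}"
        then have "Suc b * L \<le> s * L" by (intro mult_right_mono) auto
        then have bL: "b * L + L \<le> s * L" by simp
        have "(\<Sum>j=b * L..<b * L + L. F (?\<mu> j)) = (\<Sum>k<L. F (?\<mu> (b * L + k)))"
          by (rule shift)
        also have "\<dots> = (\<Sum>k<L. F (g b (grid_angle L k)))"
          using bL by (intro sum.cong refl) auto
        finally show "(\<Sum>j=b * L..<b * L + L. F (?\<mu> j)) = of_nat L * S b L"
          using \<open>0 < L\<close> by (simp add: S_def)
      qed
      finally have eq: "(\<Sum>j<n. F (?\<mu> j)) = (\<Sum>b<s. of_nat L * S b L) + of_nat (n - s * L) * F 0" .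
      have "of_nat (n - s * L) / of_nat n = (of_real (1 - real s * (real L / real n)) :: complex)"
        using \<open>0 < n\<close> sL by (simp add: of_nat_diff diff_divide_distrib)
      then have "of_nat (n - s * L) * F 0 / of_nat n = of_real (1 - real s * (real L / real n)) * F 0"
        by (metis times_divide_eq_left)
      then show ?case
        unfolding L_def[symmetric] eq add_divide_distrib sum_divide_distrib by simp
    qed
  qed
qed

lemma lmeasurable_glt_domain: "glt_domain \<in> lmeasurable"
  by (intro lmeasurable_compact compact_Times) auto

lemma restrict_glt_domain:
  "integral\<^sup>L (lebesgue_on glt_domain) f = (LINT z|lebesgue. indicator glt_domain z *\<^sub>R f z)"
  "integrable (lebesgue_on glt_domain) f \<longleftrightarrow> integrable lebesgue (\<lambda>z. indicator glt_domain z *\<^sub>R f z)"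
  for f :: "real \<times> real \<Rightarrow> complex"
proof -
  have "glt_domain \<in> sets lebesgue" by (rule fmeasurableD[OF lmeasurable_glt_domain])
  then have "glt_domain \<inter> space lebesgue \<in> sets lebesgue" by simp
  then show "integral\<^sup>L (lebesgue_on glt_domain) f = (LINT z|lebesgue. indicator glt_domain z *\<^sub>R f z)"
    "integrable (lebesgue_on glt_domain) f \<longleftrightarrow> integrable lebesgue (\<lambda>z. indicator glt_domain z *\<^sub>R f z)"
    by (rule integral_restrict_space integrable_restrict_space)+
qed

lemma measure_glt_domain: "measure lebesgue glt_domain = 2 * pi"
proof -
  have "glt_domain = cbox (0, -pi) (1, pi)" by (auto simp: cbox_Pair_eq)
  then show ?thesis by (simp add: measure_completion content_Pair)
qed

section \<open>Comparison with the symbol\<close>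

lemma domain_product_integral:
  fixes h :: "real \<Rightarrow> 'b::euclidean_space" and S :: "real set"
  assumes h: "integrable circle_measure h" and S: "S \<in> sets borel" "S \<subseteq> {0..1}"
  shows "integrable lebesgue (\<lambda>(x, \<theta>). indicator S x *\<^sub>R (indicator {-pi..pi} \<theta> *\<^sub>R h \<theta>))"
    and "(LINT z|lebesgue. (case z of (x, \<theta>) \<Rightarrow> indicator S x *\<^sub>R (indicator {-pi..pi} \<theta> *\<^sub>R h \<theta>)))
      = measure lborel S *\<^sub>R integral\<^sup>L circle_measure h"
proof -
  have "emeasure lborel S \<le> emeasure lborel {0..1::real}" using S by (intro emeasure_mono) auto
  also have "\<dots> < \<infinity>" by simp
  finally have fin: "emeasure lborel S < \<infinity>" .
  have J: "{-pi..pi} \<inter> space lebesgue \<in> sets lebesgue" by simp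
  have int: "integrable lebesgue (\<lambda>\<theta>. indicator {-pi..pi} \<theta> *\<^sub>R h \<theta>)"
    using h unfolding integrable_restrict_space[OF J] .
  show "integrable lebesgue (\<lambda>(x, \<theta>). indicator S x *\<^sub>R (indicator {-pi..pi} \<theta> *\<^sub>R h \<theta>))"
    "(LINT z|lebesgue. (case z of (x, \<theta>) \<Rightarrow> indicator S x *\<^sub>R (indicator {-pi..pi} \<theta> *\<^sub>R h \<theta>)))
      = measure lborel S *\<^sub>R integral\<^sup>L circle_measure h"
    using lebesgue_product_integral[OF int S(1) fin] unfolding integral_restrict_space[OF J] by auto
qed

text \<open>F(\<kappa>) is compared with a function that equals F(g b \<theta>) on the strip over
  block b. \<open>D1\<close> pays for the moduli of continuity and the L1 errors, \<open>D2\<close>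
  for the bad blocks, \<open>D3\<close> for the set where \<open>\<kappa>\<^sub>m\<close> is far
  from \<kappa>.\<close>

lemma glt_symbol_integral_bound:
  fixes a f p :: "nat \<Rightarrow> real \<Rightarrow> complex" and \<kappa> \<kappa>\<^sub>m :: "real \<times> real \<Rightarrow> complex" and F :: "complex \<Rightarrow> complex"
  assumes I: "finite I" and s: "0 < s" and "0 < \<epsilon>" "0 \<le> M" "0 \<le> \<eta>" "0 < C" "0 < K"
    and \<kappa>: "\<kappa> \<in> borel_measurable (lebesgue_on glt_domain)" and \<kappa>\<^sub>m: "\<kappa>\<^sub>m \<in> borel_measurable (lebesgue_on glt_domain)"
    and \<kappa>\<^sub>m_eq: "\<And>x \<theta>. \<kappa>\<^sub>m (x, \<theta>) = (\<Sum>l\<in>I. a l x * f l \<theta>)"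
    and F: "continuous_on UNIV F" and FK: "\<And>z. cmod (F z) \<le> K"
    and FC: "\<And>z w. cmod (F z - F w) \<le> \<eta> + C * cmod (z - w)"
    and f: "\<And>l. l \<in> I \<Longrightarrow> integrable circle_measure (f l)" and p: "\<And>l. l \<in> I \<Longrightarrow> trig_poly (p l)"
    and M: "\<And>l b. l \<in> I \<Longrightarrow> b < s \<Longrightarrow> cmod (block_value (a l) \<epsilon> s b) \<le> M"
  shows "cmod (integral\<^sup>L (lebesgue_on glt_domain) (\<lambda>z. F (\<kappa> z))
      - (\<Sum>b<s. (LINT \<theta>|circle_measure. F (\<Sum>l\<in>I. block_value (a l) \<epsilon> s b * p l \<theta>))) / of_nat s)
    \<le> 6 * pi * \<eta> + C * (\<Sum>l\<in>I. \<epsilon> * (LINT \<theta>|circle_measure. cmod (f l \<theta>))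
        + M * (LINT \<theta>|circle_measure. cmod (f l \<theta> - p l \<theta>)))
      + 4 * pi * K * ((\<Sum>l\<in>I. card (bad_blocks (a l) \<epsilon> s)) / s)
      + 2 * K * measure (lebesgue_on glt_domain) {z \<in> space (lebesgue_on glt_domain). \<eta> / C < dist (\<kappa>\<^sub>m z) (\<kappa> z)}"
proof -
  let ?J = "{-pi..pi}"
  \<comment> \<open>Half-open intervals tile [0,1), so each x lies in exactly one; the line x = 1 is
    left out and has measure 0.\<close>
  define S where "S = (\<lambda>b::nat. {real b / real s..<(real b + 1) / real s})"
  define g where "g = (\<lambda>b \<theta>. \<Sum>l\<in>I. block_value (a l) \<epsilon> s b * p l \<theta>)"
  define H where "H = (\<lambda>\<theta>. \<Sum>l\<in>I. \<epsilon> * cmod (f l \<theta>) + M * cmod (f l \<theta> - p l \<theta>))"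
  define Bad where "Bad = (\<Union>l\<in>I. bad_blocks (a l) \<epsilon> s)"
  define E where "E = {z \<in> space (lebesgue_on glt_domain). \<eta> / C < dist (\<kappa>\<^sub>m z) (\<kappa> z)}"
  have dom: "glt_domain \<in> sets lebesgue" by (rule fmeasurableD[OF lmeasurable_glt_domain])
  interpret dm: finite_measure "lebesgue_on glt_domain"
    by (rule finite_measure_lebesgue_on[OF lmeasurable_glt_domain])
  have finBad: "finite Bad" using I by (simp add: Bad_def)
  have S_sets: "S b \<in> sets borel" for b by (simp add: S_def)
  have S_sub: "S b \<subseteq> {0..1}" if "b < s" for b
  proof
    fix x assume "x \<in> S b"
    moreover have "(real b + 1) / s \<le> 1" "0 \<le> real b / s" using that by (simp_all add: divide_le_eq)
    ultimately show "x \<in> {0..1}" unfolding S_def atLeastLessThan_iff atLeastAtMost_iff by linarith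
  qed
  have S_meas: "measure lborel (S b) = 1 / s" for b
    using s by (simp add: S_def divide_right_mono diff_divide_distrib[symmetric])
  have S_iff: "x \<in> S b \<longleftrightarrow> nat \<lfloor>x * s\<rfloor> = b" if "0 \<le> x" for x b
  proof -
    have "x \<in> S b \<longleftrightarrow> real b \<le> x * s \<and> x * s < real b + 1"
      using s by (auto simp: S_def field_simps)
    also have "\<dots> \<longleftrightarrow> \<lfloor>x * s\<rfloor> = int b" by (auto simp: floor_eq_iff)
    also have "\<dots> \<longleftrightarrow> nat \<lfloor>x * s\<rfloor> = b" using that by auto
    finally show ?thesis .
  qed
  have g_cont: "continuous_on X (g b)" for X b
    unfolding g_def using p by (intro continuous_intros continuous_on_trig_poly) auto
  have Fg_int: "integrable circle_measure (\<lambda>\<theta>. F (g b \<theta>))" for b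
    by (intro continuous_imp_integrable_real continuous_on_compose2[OF F g_cont]) auto
  have fp_int: "integrable circle_measure (\<lambda>\<theta>. cmod (f l \<theta> - p l \<theta>))" if "l \<in> I" for l
    using that by (intro integrable_norm Bochner_Integration.integrable_diff f integrable_trig_poly p)
  have H_terms: "integrable circle_measure (\<lambda>\<theta>. \<epsilon> * cmod (f l \<theta>))"
    "integrable circle_measure (\<lambda>\<theta>. M * cmod (f l \<theta> - p l \<theta>))" if "l \<in> I" for l
    using that by (intro integrable_mult_right integrable_norm f fp_int; simp)+
  have H_int: "integrable circle_measure H"
    unfolding H_def by (intro Bochner_Integration.integrable_sum Bochner_Integration.integrable_add H_terms)
  have H_nonneg: "0 \<le> H \<theta>" for \<theta>
    unfolding H_def using \<open>0 < \<epsilon>\<close> \<open>0 \<le> M\<close> by (intro sum_nonneg add_nonneg_nonneg mult_nonneg_nonneg) auto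
  have H_integral: "integral\<^sup>L circle_measure H = (\<Sum>l\<in>I. \<epsilon> * (LINT \<theta>|circle_measure. cmod (f l \<theta>))
        + M * (LINT \<theta>|circle_measure. cmod (f l \<theta> - p l \<theta>)))"
  proof -
    have "integral\<^sup>L circle_measure H = (\<Sum>l\<in>I. LINT \<theta>|circle_measure. \<epsilon> * cmod (f l \<theta>) + M * cmod (f l \<theta> - p l \<theta>))"
      unfolding H_def by (intro Bochner_Integration.integral_sum Bochner_Integration.integrable_add H_terms)
    also have "\<dots> = (\<Sum>l\<in>I. (LINT \<theta>|circle_measure. \<epsilon> * cmod (f l \<theta>)) + (LINT \<theta>|circle_measure. M * cmod (f l \<theta> - p l \<theta>)))"
      by (intro sum.cong refl Bochner_Integration.integral_add H_terms)
    finally show ?thesis by simp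
  qed
  interpret cm: finite_measure circle_measure by (rule finite_circle_measure)
  define k where "k = (\<lambda>z. indicator glt_domain z *\<^sub>R F (\<kappa> z))"
  define G where "G = (\<lambda>z. \<Sum>b<s. (case z of (x, \<theta>) \<Rightarrow> indicator (S b) x *\<^sub>R (indicator ?J \<theta> *\<^sub>R F (g b \<theta>))))"
  \<comment> \<open>Two of the three \<eta> pay for the passage from \<kappa> to
    \<open>\<kappa>\<^sub>m\<close>, the third for the passage from there to g b.\<close>
  define D1 where "D1 = (\<lambda>(x::real, \<theta>). indicator {0..1} x *\<^sub>R (indicator ?J \<theta> *\<^sub>R (3 * \<eta> + C * H \<theta>)))"
  define D2 where "D2 = (\<lambda>z. \<Sum>b\<in>Bad. (case z of (x, \<theta>) \<Rightarrow> indicator (S b) x *\<^sub>R (indicator ?J \<theta> *\<^sub>R (2 * K))))"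
  define D3 where "D3 = (\<lambda>z. 2 * K * indicator E z)"
  have k_int: "integrable lebesgue k"
  proof -
    have "(\<lambda>z. F (\<kappa> z)) \<in> borel_measurable (lebesgue_on glt_domain)"
      using measurable_compose[OF \<kappa> borel_measurable_continuous_onI[OF F]] .
    then have "integrable (lebesgue_on glt_domain) (\<lambda>z. F (\<kappa> z))"
      by (intro dm.integrable_const_bound[of _ K]) (auto simp: FK)
    then show ?thesis unfolding k_def restrict_glt_domain .
  qed
  have G_int: "integrable lebesgue G"
    unfolding G_def by (intro Bochner_Integration.integrable_sum domain_product_integral Fg_int S_sets S_sub) auto
  have G_integral: "integral\<^sup>L lebesgue G = (\<Sum>b<s. integral\<^sup>L circle_measure (\<lambda>\<theta>. F (g b \<theta>))) / of_nat s"
  proof -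
    have "integral\<^sup>L lebesgue G = (\<Sum>b<s. measure lborel (S b) *\<^sub>R integral\<^sup>L circle_measure (\<lambda>\<theta>. F (g b \<theta>)))"
      unfolding G_def
      by (subst Bochner_Integration.integral_sum, intro domain_product_integral(1) Fg_int S_sets S_sub, simp)
         (intro sum.cong refl domain_product_integral(2) Fg_int S_sets S_sub, simp)
    then show ?thesis by (simp add: S_meas scaleR_conv_of_real sum_divide_distrib)
  qed
  have h1: "integrable circle_measure (\<lambda>\<theta>. 3 * \<eta> + C * H \<theta>)"
    using H_int by (intro Bochner_Integration.integrable_add integrable_mult_right) auto
  have D1_int: "integrable lebesgue D1" and D1_integral: "integral\<^sup>L lebesgue D1 = 6 * pi * \<eta> + C * integral\<^sup>L circle_measure H"
  proof -
    show "integrable lebesgue D1"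
      unfolding D1_def by (rule domain_product_integral[OF h1]) auto
    have "integral\<^sup>L lebesgue D1 = measure lborel {0..1::real} *\<^sub>R (LINT \<theta>|circle_measure. 3 * \<eta> + C * H \<theta>)"
      unfolding D1_def by (rule domain_product_integral[OF h1]) auto
    then show "integral\<^sup>L lebesgue D1 = 6 * pi * \<eta> + C * integral\<^sup>L circle_measure H"
      using H_int measure_circle by (simp add: Bochner_Integration.integral_add)
  qed
  have Bad_less: "b < s" if "b \<in> Bad" for b using that by (auto simp: Bad_def bad_blocks_def)
  have h2: "integrable circle_measure (\<lambda>\<theta>. 2 * K)" by simp
  have D2_int: "integrable lebesgue D2"
    unfolding D2_def using Bad_less
    by (intro Bochner_Integration.integrable_sum domain_product_integral[OF h2] S_sets S_sub)
  have D2_integral: "integral\<^sup>L lebesgue D2 = 4 * pi * K * (card Bad / s)"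
  proof -
    have "integral\<^sup>L lebesgue D2 = (\<Sum>b\<in>Bad. measure lborel (S b) *\<^sub>R (LINT \<theta>|circle_measure. 2 * K))"
      unfolding D2_def
      by (subst Bochner_Integration.integral_sum, intro domain_product_integral(1)[OF h2] S_sets S_sub Bad_less, assumption)
         (intro sum.cong refl domain_product_integral(2)[OF h2] S_sets S_sub Bad_less, assumption)
    then show ?thesis using measure_circle by (simp add: S_meas)
  qed
  have E_dom: "E \<in> sets (lebesgue_on glt_domain)"
    unfolding E_def using \<kappa> \<kappa>\<^sub>m by measurable
  then have E: "E \<subseteq> glt_domain" "E \<in> sets lebesgue"
    using dom by (auto simp: sets_restrict_space_iff)
  have E_meas: "measure lebesgue E = measure (lebesgue_on glt_domain) E"
    using E dom by (simp add: measure_restrict_space)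
  have "E \<in> lmeasurable" using E by (intro fmeasurableI2[OF lmeasurable_glt_domain]) auto
  then have D3_int: "integrable lebesgue D3" and D3_integral: "integral\<^sup>L lebesgue D3 = 2 * K * measure lebesgue E"
    unfolding D3_def by (auto simp: fmeasurable_def intro!: integrable_mult_right)
  have bound: "cmod (k z - G z) \<le> D1 z + D2 z + D3 z" if "fst z \<noteq> 1" for z
  proof -
    obtain x \<theta> where z: "z = (x, \<theta>)" by (cases z)
    have D2_nonneg: "0 \<le> D2 z" and D3_nonneg: "0 \<le> D3 z"
      unfolding D2_def D3_def z using \<open>0 < K\<close> by (auto intro!: sum_nonneg)
    have D1_nonneg: "0 \<le> D1 z"
      unfolding D1_def z using H_nonneg[of \<theta>] \<open>0 \<le> \<eta>\<close> \<open>0 < C\<close> by (auto simp: indicator_def)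
    show ?thesis
    proof (cases "z \<in> glt_domain")
      case False
      have "G z = 0"
        unfolding G_def z
      proof (rule sum.neutral, safe)
        fix b assume "b < s"
        with False S_sub[of b] show "indicator (S b) x *\<^sub>R (indicator ?J \<theta> *\<^sub>R F (g b \<theta>)) = 0"
          unfolding z by (auto simp: indicator_def)
      qed
      then show ?thesis using False D1_nonneg D2_nonneg D3_nonneg by (simp add: k_def)
    next
      case True
      then have x: "0 \<le> x" "x < 1" and \<theta>: "\<theta> \<in> ?J" using that by (auto simp: z)
      define b where "b = nat \<lfloor>x * s\<rfloor>"
      have xb: "x \<in> S b" using S_iff[OF x(1)] by (simp add: b_def)
      have "x * real s < 1 * real s" using x s by (intro mult_strict_right_mono) auto
      then have "\<lfloor>x * s\<rfloor> < int s" by (simp add: floor_less_iff)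
      then have "b < s" using s by (simp add: b_def nat_less_iff)
      have "G z = (\<Sum>c<s. if c = b then F (g b \<theta>) else 0)"
        unfolding G_def z using S_iff[OF x(1)] \<theta> by (intro sum.cong refl) (auto simp: b_def indicator_def)
      then have Gz: "G z = F (g b \<theta>)" using \<open>b < s\<close> by simp
      have kz: "k z = F (\<kappa> z)" using True by (simp add: k_def)
      \<comment> \<open>The threshold \<eta> / C in E makes the linear term of the modulus one more
        \<eta>.\<close>
      have 1: "cmod (F (\<kappa> z) - F (\<kappa>\<^sub>m z)) \<le> 2 * \<eta> + D3 z"
      proof (cases "z \<in> E")
        case True
        have "cmod (F (\<kappa> z) - F (\<kappa>\<^sub>m z)) \<le> K + K"
          by (intro order_trans[OF norm_triangle_ineq4] add_mono FK)
        then show ?thesis using True \<open>0 \<le> \<eta>\<close> by (simp add: D3_def)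
      next
        case False
        then have "dist (\<kappa>\<^sub>m z) (\<kappa> z) \<le> \<eta> / C" using True by (simp add: E_def)
        then have "C * cmod (\<kappa> z - \<kappa>\<^sub>m z) \<le> \<eta>"
          using \<open>0 < C\<close> by (simp add: dist_norm norm_minus_commute field_simps)
        then show ?thesis using FC[of "\<kappa> z" "\<kappa>\<^sub>m z"] D3_nonneg by linarith
      qed
      have 2: "cmod (F (\<kappa>\<^sub>m z) - F (g b \<theta>)) \<le> \<eta> + C * H \<theta> + D2 z"
      proof (cases "b \<in> Bad")
        case True
        have "2 * K = (\<Sum>c\<in>Bad. if c = b then 2 * K else 0)" using True finBad by simp
        also have "\<dots> = D2 z"
          unfolding D2_def z using S_iff[OF x(1)] \<theta> by (intro sum.cong refl) (auto simp: b_def indicator_def)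
        finally have "D2 z = 2 * K" by simp
        moreover have "cmod (F (\<kappa>\<^sub>m z) - F (g b \<theta>)) \<le> K + K"
          by (intro order_trans[OF norm_triangle_ineq4] add_mono FK)
        moreover have "0 \<le> C * H \<theta>" using H_nonneg \<open>0 < C\<close> by simp
        ultimately show ?thesis using \<open>0 \<le> \<eta>\<close> by linarith
      next
        case False
        have bs: "real b / s \<in> {0..1}" using \<open>b < s\<close> by (simp add: divide_le_eq)
        have bx: "(real b - 1) / s \<le> x" "x \<le> (real b + 1) / s"
        proof -
          have "(real b - 1) / s \<le> real b / s" by (intro divide_right_mono) auto
          then show "(real b - 1) / s \<le> x" "x \<le> (real b + 1) / s"
            using xb unfolding S_def atLeastLessThan_iff by linarith+
        qed
        have bb: "(real b - 1) / s \<le> real b / s" "real b / s \<le> (real b + 1) / s"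
          by (auto intro!: divide_right_mono)
        have close: "cmod (a l x - block_value (a l) \<epsilon> s b) \<le> \<epsilon>" if "l \<in> I" for l
        proof -
          have nb: "b \<notin> bad_blocks (a l) \<epsilon> s" using False that by (auto simp: Bad_def)
          have "cmod (a l x - a l y) \<le> \<epsilon>" if "x \<in> {0..1}" "y \<in> {0..1}"
            "(real b - 1) / s \<le> x" "x \<le> (real b + 1) / s" "(real b - 1) / s \<le> y" "y \<le> (real b + 1) / s" for x y
            using nb \<open>b < s\<close> that unfolding bad_blocks_def mem_Collect_eq by blast
          from this[OF _ bs bx bb] x nb show ?thesis by (simp add: block_value_def)
        qed
        have "\<kappa>\<^sub>m z - g b \<theta> = (\<Sum>l\<in>I. (a l x - block_value (a l) \<epsilon> s b) * f l \<theta>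
            + block_value (a l) \<epsilon> s b * (f l \<theta> - p l \<theta>))"
          unfolding z \<kappa>\<^sub>m_eq g_def sum_subtractf[symmetric] by (intro sum.cong refl) (simp add: algebra_simps)
        also have "cmod \<dots> \<le> H \<theta>"
          unfolding H_def using close M \<open>b < s\<close>
          by (intro order_trans[OF norm_sum] sum_mono order_trans[OF norm_triangle_ineq] add_mono)
             (auto simp: norm_mult intro!: mult_right_mono)
        finally have "C * cmod (\<kappa>\<^sub>m z - g b \<theta>) \<le> C * H \<theta>" using \<open>0 < C\<close> by simp
        then show ?thesis using FC[of "\<kappa>\<^sub>m z" "g b \<theta>"] D2_nonneg by linarith
      qed
      have "D1 z = 3 * \<eta> + C * H \<theta>" using x \<theta> by (simp add: D1_def z)
      moreover have "cmod (k z - G z) \<le> cmod (F (\<kappa> z) - F (\<kappa>\<^sub>m z)) + cmod (F (\<kappa>\<^sub>m z) - F (g b \<theta>))"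
        unfolding kz Gz using norm_triangle_ineq[of "F (\<kappa> z) - F (\<kappa>\<^sub>m z)" "F (\<kappa>\<^sub>m z) - F (g b \<theta>)"] by simp
      ultimately show ?thesis using 1 2 by linarith
    qed
  qed
  have ae: "AE z in lebesgue. cmod (k z - G z) \<le> D1 z + D2 z + D3 z"
  proof (rule AE_I')
    have "(1, 0) \<in> (Basis :: (real \<times> real) set)" by (auto simp: Basis_prod_def)
    then have "negligible {z :: real \<times> real. z \<bullet> (1, 0) = 1}" by (rule negligible_standard_hyperplane)
    then show "{z :: real \<times> real. z \<bullet> (1, 0) = 1} \<in> null_sets lebesgue" by (simp add: negligible_iff_null_sets)
    show "{z \<in> space lebesgue. \<not> cmod (k z - G z) \<le> D1 z + D2 z + D3 z} \<subseteq> {z. z \<bullet> (1, 0) = 1}"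
      using bound by (auto simp: inner_prod_def)
  qed
  have "integral\<^sup>L (lebesgue_on glt_domain) (\<lambda>z. F (\<kappa> z)) - (\<Sum>b<s. integral\<^sup>L circle_measure (\<lambda>\<theta>. F (g b \<theta>))) / of_nat s
      = integral\<^sup>L lebesgue (\<lambda>z. k z - G z)"
    using k_int G_int unfolding G_integral[symmetric] restrict_glt_domain k_def[symmetric] by simp
  also have "cmod \<dots> \<le> (LINT z|lebesgue. cmod (k z - G z))"
    by (rule integral_norm_bound)
  also have "\<dots> \<le> (LINT z|lebesgue. D1 z + D2 z + D3 z)"
    using k_int G_int D1_int D2_int D3_int ae by (intro integral_mono_AE) auto
  also have "\<dots> = 6 * pi * \<eta> + C * integral\<^sup>L circle_measure H + 4 * pi * K * (card Bad / s) + 2 * K * measure lebesgue E"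
    using D1_int D2_int D3_int by (simp add: D1_integral D2_integral D3_integral)
  also have "\<dots> \<le> 6 * pi * \<eta> + C * integral\<^sup>L circle_measure H
      + 4 * pi * K * ((\<Sum>l\<in>I. card (bad_blocks (a l) \<epsilon> s)) / s) + 2 * K * measure lebesgue E"
  proof -
    have "card Bad \<le> (\<Sum>l\<in>I. card (bad_blocks (a l) \<epsilon> s))" unfolding Bad_def by (rule card_UN_le[OF I])
    then have "real (card Bad) / s \<le> real (\<Sum>l\<in>I. card (bad_blocks (a l) \<epsilon> s)) / s"
      by (intro divide_right_mono) (simp_all only: of_nat_le_iff of_nat_0_le_iff)
    then show ?thesis using \<open>0 < K\<close> by (intro add_mono mult_left_mono order_refl) auto
  qed
  finally show ?thesis
    unfolding H_integral E_meas unfolding E_def g_def .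
qed

section \<open>The spectral distribution\<close>

lemma glt_sum_entries:
  assumes "i < n" "k < n"
  shows "mat_sum n (\<lambda>l. diag_sampling n (a l) * toeplitz n (f l)) I $$ (i, k)
    = (\<Sum>l\<in>I. a l (real (Suc i) / n) * fourier_coeff (f l) (int i - int k))"
proof -
  have T: "toeplitz n (f l) \<in> carrier_mat n n" for l by (simp add: toeplitz_def)
  have "(diag_sampling n (a l) * toeplitz n (f l)) $$ (i, k)
      = a l (real (Suc i) / n) * fourier_coeff (f l) (int i - int k)" for l
    unfolding diag_sampling_def mat_diag_mult_left[OF T]
    using assms by (simp add: toeplitz_def del: of_nat_Suc)
  then show ?thesis using assms by (simp add: mat_sum_def)
qed

lemma bad_blocks_eventually_small:
  assumes "finite I" "0 < \<epsilon>" "0 < \<tau>"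
    and "\<And>l. l \<in> I \<Longrightarrow> AE x in lebesgue_on {0..1}. continuous (at x within {0..1}) (a l)"
  shows "\<exists>s>0. (\<Sum>l\<in>I. card (bad_blocks (a l) \<epsilon> s)) / real s \<le> \<tau>"
proof -
  have "(\<lambda>s. \<Sum>l\<in>I. card (bad_blocks (a l) \<epsilon> s) / real s) \<longlonglongrightarrow> (\<Sum>l\<in>I. 0)"
    using assms by (intro tendsto_sum bad_blocks_density)
  then have "\<forall>\<^sub>F s in sequentially. (\<Sum>l\<in>I. card (bad_blocks (a l) \<epsilon> s) / real s) < \<tau>"
    using \<open>0 < \<tau>\<close> by (intro order_tendstoD(2)) auto
  then have "\<forall>\<^sub>F s in sequentially. 0 < s \<and> (\<Sum>l\<in>I. card (bad_blocks (a l) \<epsilon> s) / real s) < \<tau>"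
    using eventually_gt_at_top[of 0] by eventually_elim simp
  then obtain s where "0 < s" "(\<Sum>l\<in>I. card (bad_blocks (a l) \<epsilon> s) / real s) < \<tau>"
    using eventually_happens'[OF sequentially_bot] by blast
  then show ?thesis by (intro exI[of _ s]) (simp add: sum_divide_distrib)
qed

lemma trig_poly_family_L1:
  fixes f :: "nat \<Rightarrow> real \<Rightarrow> complex"
  assumes "finite I" "0 \<le> M" "0 < \<tau>" and f: "\<And>l. l \<in> I \<Longrightarrow> integrable circle_measure (f l)"
  shows "\<exists>p. (\<forall>l\<in>I. trig_poly (p l)) \<and> (\<Sum>l\<in>I. M * (LINT \<theta>|circle_measure. cmod (f l \<theta> - p l \<theta>))) \<le> \<tau>"
proof -
  \<comment> \<open>The added ones keep \<delta> positive when M is 0 or the index set is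
    empty.\<close>
  define \<delta> where "\<delta> = \<tau> / ((M + 1) * (real (card I) + 1))"
  have "0 < \<delta>" using assms by (simp add: \<delta>_def)
  then have "\<forall>l\<in>I. \<exists>p. trig_poly p \<and> (LINT \<theta>|circle_measure. cmod (f l \<theta> - p \<theta>)) < \<delta>"
    using trig_poly_L1_dense[OF f] by blast
  then obtain p where p: "\<And>l. l \<in> I \<Longrightarrow> trig_poly (p l)"
      "\<And>l. l \<in> I \<Longrightarrow> (LINT \<theta>|circle_measure. cmod (f l \<theta> - p l \<theta>)) < \<delta>"
    by metis
  have "(\<Sum>l\<in>I. M * (LINT \<theta>|circle_measure. cmod (f l \<theta> - p l \<theta>))) \<le> (\<Sum>l\<in>I. M * \<delta>)"
    using p(2) \<open>0 \<le> M\<close> by (intro sum_mono mult_left_mono) (auto intro: less_imp_le)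
  also have "\<dots> = real (card I) * M * \<delta>" by simp
  also have "\<dots> \<le> (real (card I) + 1) * (M + 1) * \<delta>"
    using \<open>0 \<le> M\<close> \<open>0 < \<delta>\<close> by (intro mult_right_mono mult_mono) auto
  also have "\<dots> = \<tau>" using \<open>0 \<le> M\<close> by (simp add: \<delta>_def add_nonneg_eq_0_iff)
  finally show ?thesis using p(1) by blast
qed

text \<open>The average over the eigenvalues is compared with the average over the \<mu> j; the
  limit Y of the latter, for fixed blocks and polynomials, is then compared with the integral of
  F(\<kappa>).\<close>

lemma glt_normal_eigenvalue_limit:
  fixes F :: "complex \<Rightarrow> complex"
  assumes glt: "glt A \<kappa>" and normal: "\<And>n. normal_mat (A n)"
    and F: "continuous_on UNIV F" and supp: "bounded {z. F z \<noteq> 0}"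
  shows "(\<lambda>n. (1 / of_nat n) * (\<Sum>z\<in>#proots (char_poly (A n)). F z))
    \<longlonglongrightarrow> integral\<^sup>L (lebesgue_on glt_domain) (\<lambda>z. F (\<kappa> z)) / (2 * of_real pi)" (is "?avg \<longlonglongrightarrow> ?X")
proof (rule LIMSEQ_I)
  fix \<rho> :: real assume "0 < \<rho>"
  \<comment> \<open>The three comparisons cost \<eta> + 18 \<open>C\<^sub>1\<close> \<tau>, \<eta>,
    and 3 \<eta> + \<open>C\<^sub>2\<close> \<tau> + 3 K \<tau>. The terms in \<tau> add up to
    another \<eta>, so the total 6 \<eta> is \<rho> / 2.\<close>
  define \<eta> where "\<eta> = \<rho> / 12"
  have "0 < \<eta>" using \<open>0 < \<rho>\<close> by (simp add: \<eta>_def)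
  obtain K where "0 < K" and K: "\<And>z. cmod (F z) \<le> K"
    using compact_support_bounded[OF F supp] by blast
  obtain C\<^sub>1 where "0 < C\<^sub>1" and C\<^sub>1: "\<And>z w. cmod (F z - F w) \<le> \<eta> + C\<^sub>1 * chordal2 z w"
    using compact_support_chordal_modulus[OF F supp \<open>0 < \<eta>\<close>] by blast
  obtain C\<^sub>2 where "0 < C\<^sub>2" and C\<^sub>2: "\<And>z w. cmod (F z - F w) \<le> \<eta> + C\<^sub>2 * cmod (z - w)"
    using compact_support_linear_modulus[OF F supp \<open>0 < \<eta>\<close>] by blast
  \<comment> \<open>The sum of the coefficients of \<tau> in the final budget; 18 = 4 * 3 + 2 * 3
    because rank and trace norm are each at most 3 \<tau> n.\<close>
  define Q where "Q = 18 * C\<^sub>1 + C\<^sub>2 + 3 * K"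
  have "0 < Q" using \<open>0 < C\<^sub>1\<close> \<open>0 < C\<^sub>2\<close> \<open>0 < K\<close> by (simp add: Q_def)
  define \<tau> where "\<tau> = \<eta> / Q"
  have "0 < \<tau>" using \<open>0 < \<eta>\<close> \<open>0 < Q\<close> by (simp add: \<tau>_def)
  have Q\<tau>: "18 * C\<^sub>1 * \<tau> + C\<^sub>2 * \<tau> + 3 * K * \<tau> = \<eta>"
  proof -
    have "18 * C\<^sub>1 * \<tau> + C\<^sub>2 * \<tau> + 3 * K * \<tau> = Q * \<tau>" by (simp add: Q_def algebra_simps)
    then show ?thesis using \<open>0 < Q\<close> by (simp add: \<tau>_def)
  qed
  from glt have A: "A n \<in> carrier_mat n n" for n by (simp add: glt_def matrix_sequence_def)
  from glt have \<kappa>: "\<kappa> \<in> borel_measurable (lebesgue_on glt_domain)" by (simp add: glt_def)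
  from glt[unfolded glt_def, THEN conjunct2, THEN conjunct2]
  obtain N :: "nat \<Rightarrow> nat" and a f :: "nat \<Rightarrow> nat \<Rightarrow> real \<Rightarrow> complex" where
    "(\<forall>m. \<forall>i\<in>{1..N m}. (AE x in lebesgue_on {0..1}. continuous (at x within {0..1}) (a i m))
      \<and> set_integrable lebesgue {-pi..pi} (f i m)) \<and>
    tendsto_in_measure (lebesgue_on glt_domain) (\<lambda>m (x, \<theta>). \<Sum>i = 1..N m. a i m x * f i m \<theta>) \<kappa> \<and>
    acs (\<lambda>n m. mat_sum n (\<lambda>i. diag_sampling n (a i m) * toeplitz n (f i m)) {1..N m}) A"
    by (elim exE) (erule that)
  then have af: "\<And>m i. i \<in> {1..N m} \<Longrightarrow> (AE x in lebesgue_on {0..1}. continuous (at x within {0..1}) (a i m))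
      \<and> set_integrable lebesgue {-pi..pi} (f i m)" and
    tm: "tendsto_in_measure (lebesgue_on glt_domain) (\<lambda>m (x, \<theta>). \<Sum>i = 1..N m. a i m x * f i m \<theta>) \<kappa>" and
    acs: "acs (\<lambda>n m. mat_sum n (\<lambda>i. diag_sampling n (a i m) * toeplitz n (f i m)) {1..N m}) A"
    by simp_all
  from acs[unfolded acs_def, THEN conjunct2, THEN conjunct2] obtain n\<^sub>0 c \<omega> where
    "c \<longlonglongrightarrow> (0::real) \<and> \<omega> \<longlonglongrightarrow> (0::real) \<and> (\<forall>m. \<forall>n\<ge>n\<^sub>0 m. \<exists>R N'. R \<in> carrier_mat n n \<and> N' \<in> carrier_mat n n \<and>
      A n = mat_sum n (\<lambda>i. diag_sampling n (a i m) * toeplitz n (f i m)) {1..N m} + R + N' \<and>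
      real (vec_space.rank n R) \<le> c m * real n \<and> spectral_norm N' \<le> \<omega> m)"
    by (elim exE) (erule that)
  then have c: "c \<longlonglongrightarrow> 0" and \<omega>: "\<omega> \<longlonglongrightarrow> 0" and
    dec: "\<And>m n. n\<^sub>0 m \<le> n \<Longrightarrow> \<exists>R N'. R \<in> carrier_mat n n \<and> N' \<in> carrier_mat n n \<and>
      A n = mat_sum n (\<lambda>i. diag_sampling n (a i m) * toeplitz n (f i m)) {1..N m} + R + N' \<and>
      real (vec_space.rank n R) \<le> c m * real n \<and> spectral_norm N' \<le> \<omega> m"
    by simp_all
  define \<kappa>' where "\<kappa>' = (\<lambda>m (x, \<theta>). \<Sum>i = 1..N m. a i m x * f i m \<theta>)"
  let ?E = "\<lambda>m. {z \<in> space (lebesgue_on glt_domain). \<eta> / C\<^sub>2 < dist (\<kappa>' m z) (\<kappa> z)}"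
  have "0 < \<eta> / C\<^sub>2" using \<open>0 < \<eta>\<close> \<open>0 < C\<^sub>2\<close> by simp
  then have lim: "(\<lambda>m. emeasure (lebesgue_on glt_domain) (?E m)) \<longlonglongrightarrow> 0"
    using tm unfolding tendsto_in_measure_def \<kappa>'_def by blast
  have "\<forall>\<^sub>F m in sequentially. c m < \<tau> \<and> \<omega> m < \<tau> \<and> emeasure (lebesgue_on glt_domain) (?E m) < ennreal \<tau>"
    using c \<omega> lim \<open>0 < \<tau>\<close> by (intro eventually_conj order_tendstoD(2)) auto
  then obtain m where m: "c m < \<tau>" "\<omega> m < \<tau>" "emeasure (lebesgue_on glt_domain) (?E m) < ennreal \<tau>"
    using eventually_happens'[OF sequentially_bot] by blast
  have E: "measure (lebesgue_on glt_domain) (?E m) \<le> \<tau>"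
    unfolding measure_def using m(3) \<open>0 < \<tau>\<close> by (intro enn2real_leI) auto
  have \<kappa>'_meas: "\<kappa>' m \<in> borel_measurable (lebesgue_on glt_domain)"
    using tm unfolding tendsto_in_measure_def \<kappa>'_def by blast
  define I where "I = {1..N m}"
  define b where "b = (\<lambda>l. a l m)"
  define h where "h = (\<lambda>l. f l m)"
  have I: "finite I" by (simp add: I_def)
  have b: "AE x in lebesgue_on {0..1}. continuous (at x within {0..1}) (b l)" if "l \<in> I" for l
    using af that by (auto simp: I_def b_def)
  have h: "integrable circle_measure (h l)" if "l \<in> I" for l
    using af that by (auto simp: I_def h_def circle_integrable_iff)
  \<comment> \<open>The 1 in the denominator covers the case that all L1 norms vanish.\<close>
  define \<epsilon> where "\<epsilon> = \<tau> / (1 + (\<Sum>l\<in>I. LINT \<theta>|circle_measure. cmod (h l \<theta>)))"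
  have hpos: "0 \<le> (\<Sum>l\<in>I. LINT \<theta>|circle_measure. cmod (h l \<theta>))" by (intro sum_nonneg) simp
  then have "0 < \<epsilon>" using \<open>0 < \<tau>\<close> by (simp add: \<epsilon>_def)
  have \<epsilon>h: "(\<Sum>l\<in>I. \<epsilon> * (LINT \<theta>|circle_measure. cmod (h l \<theta>))) \<le> \<tau>"
    unfolding sum_distrib_left[symmetric] \<epsilon>_def using hpos \<open>0 < \<tau>\<close> by (simp add: divide_le_eq mult_left_mono)
  obtain s where "0 < s" and s: "(\<Sum>l\<in>I. card (bad_blocks (b l) \<epsilon> s)) / real s \<le> \<tau>"
    using bad_blocks_eventually_small[OF I \<open>0 < \<epsilon>\<close> \<open>0 < \<tau>\<close>, of b, OF b] by blast
  \<comment> \<open>A sum instead of a maximum needs no case distinction for an empty index set. M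
    is fixed before the polynomials because it multiplies their error.\<close>
  define M where "M = (\<Sum>l\<in>I. \<Sum>k<s. cmod (block_value (b l) \<epsilon> s k))"
  have "0 \<le> M" unfolding M_def by (intro sum_nonneg) auto
  have M: "cmod (block_value (b l) \<epsilon> s k) \<le> M" if "l \<in> I" "k < s" for l k
  proof -
    have "cmod (block_value (b l) \<epsilon> s k) \<le> (\<Sum>k<s. cmod (block_value (b l) \<epsilon> s k))"
      using that by (intro member_le_sum) auto
    also have "\<dots> \<le> M" unfolding M_def using that I by (intro member_le_sum) (auto intro: sum_nonneg)
    finally show ?thesis .
  qed
  obtain p where p: "\<And>l. l \<in> I \<Longrightarrow> trig_poly (p l)"
      and Mp: "(\<Sum>l\<in>I. M * (LINT \<theta>|circle_measure. cmod (h l \<theta> - p l \<theta>))) \<le> \<tau>"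
    using trig_poly_family_L1[OF I \<open>0 \<le> M\<close> \<open>0 < \<tau>\<close>, of h, OF h] by blast
  obtain d where d: "\<And>l. l \<in> I \<Longrightarrow> local_symbol d (p l)"
    using local_symbol_family[OF I, of p, OF p] by blast
  define \<Delta> where "\<Delta> = (\<Sum>l\<in>I. \<epsilon> * (LINT \<theta>|circle_measure. cmod (h l \<theta>))
      + M * (LINT \<theta>|circle_measure. cmod (h l \<theta> - p l \<theta>)))"
  have \<Delta>: "\<Delta> \<le> 2 * \<tau>" using \<epsilon>h Mp by (simp add: \<Delta>_def sum.distrib)
  define g where "g = (\<lambda>k \<theta>. \<Sum>l\<in>I. block_value (b l) \<epsilon> s k * p l \<theta>)"
  have g: "continuous_on {-pi..pi} (g k)" for k
    unfolding g_def using p by (intro continuous_intros continuous_on_trig_poly) auto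
  define \<mu> where "\<mu> = (\<lambda>n j. if j < s * (n div s) then g (j div (n div s)) (grid_angle (n div s) (j mod (n div s))) else 0)"
  define Y where "Y = (\<Sum>k<s. (LINT \<theta>|circle_measure. F (g k \<theta>))) / (2 * of_real pi * of_nat s)"

  have XY: "cmod (?X - Y) \<le> 3 * \<eta> + C\<^sub>2 * \<tau> + 3 * K * \<tau>"
  proof -
    have \<kappa>'_eq: "\<kappa>' m (x, \<theta>) = (\<Sum>l\<in>I. b l x * h l \<theta>)" for x \<theta>
      by (simp add: \<kappa>'_def I_def b_def h_def)
    let ?int = "integral\<^sup>L (lebesgue_on glt_domain) (\<lambda>z. F (\<kappa> z))"
    let ?sum = "(\<Sum>k<s. (LINT \<theta>|circle_measure. F (g k \<theta>))) / of_nat s"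
    have "cmod (?int - ?sum) \<le> 6 * pi * \<eta> + C\<^sub>2 * \<Delta> + 4 * pi * K * ((\<Sum>l\<in>I. card (bad_blocks (b l) \<epsilon> s)) / s)
       + 2 * K * measure (lebesgue_on glt_domain) (?E m)"
      unfolding g_def \<Delta>_def
      by (rule glt_symbol_integral_bound[OF I \<open>0 < s\<close> \<open>0 < \<epsilon>\<close> \<open>0 \<le> M\<close> less_imp_le[OF \<open>0 < \<eta>\<close>] \<open>0 < C\<^sub>2\<close> \<open>0 < K\<close>
           \<kappa> \<kappa>'_meas \<kappa>'_eq F K C\<^sub>2 h p M])
    also have "\<dots> \<le> 6 * pi * \<eta> + C\<^sub>2 * (2 * \<tau>) + 4 * pi * K * \<tau> + 2 * K * \<tau>"
      using \<Delta> s E \<open>0 < C\<^sub>2\<close> \<open>0 < K\<close> by (intro add_mono mult_left_mono order_refl) auto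
    \<comment> \<open>2 \<open>C\<^sub>2\<close> \<tau> and 2 K \<tau> are enlarged by a factor pi
      so that 2 pi becomes a common factor.\<close>
    also have "\<dots> \<le> 2 * pi * (3 * \<eta> + C\<^sub>2 * \<tau> + 3 * K * \<tau>)"
    proof -
      have "1 * (2 * (C\<^sub>2 * \<tau>)) \<le> pi * (2 * (C\<^sub>2 * \<tau>))" "1 * (2 * (K * \<tau>)) \<le> pi * (2 * (K * \<tau>))"
        using pi_gt3 \<open>0 < C\<^sub>2\<close> \<open>0 < K\<close> \<open>0 < \<tau>\<close> by (intro mult_right_mono; simp)+
      then show ?thesis by (simp add: algebra_simps)
    qed
    finally have "cmod (?int - ?sum) / (2 * pi) \<le> 3 * \<eta> + C\<^sub>2 * \<tau> + 3 * K * \<tau>"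
      by (simp add: divide_le_eq mult.commute)
    moreover have "?X - Y = (?int - ?sum) / of_real (2 * pi)"
      by (simp add: Y_def diff_divide_distrib mult.commute)
    ultimately show ?thesis by (simp only: norm_divide norm_of_real) simp
  qed

  have "(\<lambda>n. (\<Sum>j<n. F (\<mu> n j)) / of_nat n) \<longlonglongrightarrow> Y"
    unfolding \<mu>_def Y_def by (rule block_average_tendsto[OF \<open>0 < s\<close> g F])
  then have \<mu>Y: "\<forall>\<^sub>F n in sequentially. dist ((\<Sum>j<n. F (\<mu> n j)) / of_nat n) Y < \<eta>"
    using \<open>0 < \<eta>\<close> by (rule tendstoD)

  \<comment> \<open>The second condition on n gives s \<le> L, which keeps the samples near their
    blocks; the third makes the rows lost at block ends and beyond the last block at most \<tau>
    n.\<close>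
  have A\<mu>: "cmod (?avg n - (\<Sum>j<n. F (\<mu> n j)) / of_nat n) \<le> \<eta> + 18 * C\<^sub>1 * \<tau>"
    if n: "n\<^sub>0 m \<le> n" "s * s \<le> n" "real (s + s * (2 * d)) / \<tau> \<le> real n" for n
  proof -
    define L where "L = n div s"
    have sL: "s \<le> L" using n(2) \<open>0 < s\<close> by (simp add: L_def less_eq_div_iff_mult_less_eq)
    then have "0 < L" using \<open>0 < s\<close> by simp
    have "0 < n" using \<open>0 < L\<close> unfolding L_def by (cases n) auto
    obtain R N' where R: "R \<in> carrier_mat n n" and N': "N' \<in> carrier_mat n n"
      and A_eq: "A n = mat_sum n (\<lambda>i. diag_sampling n (a i m) * toeplitz n (f i m)) {1..N m} + R + N'"
      and rank: "real (vec_space.rank n R) \<le> c m * real n" and norm: "spectral_norm N' \<le> \<omega> m"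
      using dec[OF n(1)] by blast
    obtain u \<xi> where "unitary_fun n u \<and>
        (\<forall>i<n. \<forall>j<n. (\<Sum>k<n. cnj (u k i) * A n $$ (k, j)) = \<xi> i * cnj (u j i)) \<and>
        proots (char_poly (A n)) = mset (map \<xi> [0..<n])"
      using normal_mat_spectral[OF A normal, of n] by (elim exE) (erule that)
    then have u: "unitary_fun n u"
      and u\<xi>: "\<And>i j. i < n \<Longrightarrow> j < n \<Longrightarrow> (\<Sum>k<n. cnj (u k i) * A n $$ (k, j)) = \<xi> i * cnj (u j i)"
      and roots: "proots (char_poly (A n)) = mset (map \<xi> [0..<n])"
      by auto
    let ?v = "block_dft s L"
    have v: "unitary_fun n ?v" by (rule unitary_block_dft[OF \<open>0 < L\<close>]) (simp add: L_def)
    define B where "B = (\<lambda>i k. \<Sum>l\<in>I. b l (real (Suc i) / n) * fourier_coeff (h l) (int i - int k))"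
    let ?bad = "card (bad_rows I b \<epsilon> s L d \<inter> {..<n})"
    have "\<exists>R T. rank_le n ?bad R \<and> trace_le n (n * \<Delta>) T \<and>
       (\<forall>i<n. \<forall>j<n. mprod n B ?v i j - ?v i j * \<mu> n j = R i j + T i j)"
      unfolding B_def \<Delta>_def \<mu>_def g_def L_def[symmetric]
      by (rule glt_block_decomposition[OF I \<open>0 < s\<close> L_def sL \<open>0 < \<epsilon>\<close> h p d M \<open>0 \<le> M\<close>])
    then obtain R\<^sub>1 T\<^sub>1 where "rank_le n ?bad R\<^sub>1 \<and> trace_le n (n * \<Delta>) T\<^sub>1 \<and>
       (\<forall>i<n. \<forall>j<n. mprod n B ?v i j - ?v i j * \<mu> n j = R\<^sub>1 i j + T\<^sub>1 i j)"
      by (elim exE) (erule that)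
    then have R\<^sub>1: "rank_le n ?bad R\<^sub>1" and T\<^sub>1: "trace_le n (n * \<Delta>) T\<^sub>1"
      and RT: "\<And>i j. i < n \<Longrightarrow> j < n \<Longrightarrow> mprod n B ?v i j - ?v i j * \<mu> n j = R\<^sub>1 i j + T\<^sub>1 i j"
      by simp_all
    have A_entry: "A n $$ (i, k) = B i k + R $$ (i, k) + N' $$ (i, k)" if "i < n" "k < n" for i k
    proof -
      have "mat_sum n (\<lambda>i. diag_sampling n (a i m) * toeplitz n (f i m)) {1..N m} \<in> carrier_mat n n"
        by (simp add: mat_sum_def)
      then have "A n $$ (i, k) = mat_sum n (\<lambda>i. diag_sampling n (a i m) * toeplitz n (f i m)) {1..N m} $$ (i, k)
          + R $$ (i, k) + N' $$ (i, k)"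
        unfolding A_eq using that R N' by simp
      then show ?thesis by (simp only: glt_sum_entries[OF that]) (simp add: B_def I_def b_def h_def)
    qed
    define R\<^sub>2 where "R\<^sub>2 = (\<lambda>i j. mprod n (\<lambda>i k. R $$ (i, k)) ?v i j + R\<^sub>1 i j)"
    define T\<^sub>2 where "T\<^sub>2 = (\<lambda>i j. mprod n (\<lambda>i k. N' $$ (i, k)) ?v i j + T\<^sub>1 i j)"
    have AV: "mprod n (\<lambda>i k. A n $$ (i, k)) ?v i j - ?v i j * \<mu> n j = R\<^sub>2 i j + T\<^sub>2 i j" if "i < n" "j < n" for i j
    proof -
      have "mprod n (\<lambda>i k. A n $$ (i, k)) ?v i j
          = mprod n B ?v i j + mprod n (\<lambda>i k. R $$ (i, k)) ?v i j + mprod n (\<lambda>i k. N' $$ (i, k)) ?v i j"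
        using that by (simp add: mprod_def A_entry distrib_right sum.distrib)
      then show ?thesis using RT[OF that] by (simp add: R\<^sub>2_def T\<^sub>2_def)
    qed
    have R\<^sub>2: "rank_le n (vec_space.rank n R + ?bad) R\<^sub>2"
      unfolding R\<^sub>2_def by (intro rank_le_add rank_le_mprod_right rank_le_vec_space_rank R R\<^sub>1)
    have T\<^sub>2: "trace_le n (\<omega> m * n + n * \<Delta>) T\<^sub>2"
      unfolding T\<^sub>2_def
      by (intro trace_le_add trace_le_mprod_right trace_le_op_bound op_bound_spectral_norm N' norm T\<^sub>1
          op_bound_unitary v)
    have combine: "4 * x + 2 * y \<le> 18 * t" if "x \<le> 3 * t" "y \<le> 3 * t" for x y t :: real
      using that by linarith
    \<comment> \<open>One \<tau> n each for the rank in the a.c.s. splitting, for block ends and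
      remainder, and for the bad blocks.\<close>
    have "real (vec_space.rank n R + ?bad) \<le> 3 * (\<tau> * n)"
    proof -
      have "real (vec_space.rank n R) \<le> \<tau> * n"
        using rank m(1) by (meson mult_right_mono of_nat_0_le_iff order_less_imp_le order_trans)
      moreover have "real ?bad \<le> real (s + s * (2 * d)) + real (\<Sum>l\<in>I. card (bad_blocks (b l) \<epsilon> s)) * L"
      proof -
        have "?bad \<le> s + s * (2 * d) + (\<Sum>l\<in>I. card (bad_blocks (b l) \<epsilon> s) * L)"
          by (rule card_bad_rows[OF I \<open>0 < s\<close> L_def \<open>0 < L\<close>])
        then have "real ?bad \<le> real (s + s * (2 * d) + (\<Sum>l\<in>I. card (bad_blocks (b l) \<epsilon> s) * L))"
          by (simp only: of_nat_le_iff)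
        then show ?thesis by (simp add: sum_distrib_right)
      qed
      moreover have "real (s + s * (2 * d)) \<le> \<tau> * n"
        using n(3) \<open>0 < \<tau>\<close> by (simp add: divide_le_eq mult.commute)
      moreover have "real (\<Sum>l\<in>I. card (bad_blocks (b l) \<epsilon> s)) * L \<le> \<tau> * n"
      proof -
        have "real (L * s) \<le> real n" unfolding L_def by (simp only: of_nat_le_iff div_times_less_eq_dividend)
        then have "real L \<le> real n / s" using \<open>0 < s\<close> by (simp add: field_simps)
        then have "real (\<Sum>l\<in>I. card (bad_blocks (b l) \<epsilon> s)) * L \<le> real (\<Sum>l\<in>I. card (bad_blocks (b l) \<epsilon> s)) * (real n / s)"
          by (intro mult_left_mono of_nat_0_le_iff)
        also have "\<dots> = (\<Sum>l\<in>I. card (bad_blocks (b l) \<epsilon> s)) / real s * n" by simp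
        also have "\<dots> \<le> \<tau> * n" using s by (intro mult_right_mono) auto
        finally show ?thesis .
      qed
      ultimately show ?thesis unfolding of_nat_add by linarith
    qed
    \<comment> \<open>\<omega> m accounts for one \<tau> n, \<Delta> for two.\<close>
    moreover have "\<omega> m * n + n * \<Delta> \<le> 3 * (\<tau> * n)"
    proof -
      have "(\<omega> m + \<Delta>) * n \<le> (3 * \<tau>) * n" using m(2) \<Delta> by (intro mult_right_mono) auto
      then show ?thesis by (simp add: algebra_simps)
    qed
    ultimately have "4 * real (vec_space.rank n R + ?bad) + 2 * (\<omega> m * n + n * \<Delta>) \<le> 18 * (\<tau> * n)"
      using combine by blast
    then have "C\<^sub>1 * (4 * real (vec_space.rank n R + ?bad) + 2 * (\<omega> m * n + n * \<Delta>)) \<le> C\<^sub>1 * (18 * (\<tau> * n))"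
      using \<open>0 < C\<^sub>1\<close> by (intro mult_left_mono) auto
    moreover have "cmod ((\<Sum>i<n. F (\<xi> i)) - (\<Sum>j<n. F (\<mu> n j)))
        \<le> \<eta> * n + C\<^sub>1 * (4 * real (vec_space.rank n R + ?bad) + 2 * (\<omega> m * n + n * \<Delta>))"
      by (rule sum_eigenvalues_close[OF u v u\<xi> AV R\<^sub>2 T\<^sub>2 C\<^sub>1 less_imp_le[OF \<open>0 < C\<^sub>1\<close>]])
    ultimately have "cmod ((\<Sum>i<n. F (\<xi> i)) - (\<Sum>j<n. F (\<mu> n j))) \<le> (\<eta> + 18 * C\<^sub>1 * \<tau>) * n"
      by (simp add: algebra_simps)
    then have "cmod ((\<Sum>i<n. F (\<xi> i)) - (\<Sum>j<n. F (\<mu> n j))) / n \<le> \<eta> + 18 * C\<^sub>1 * \<tau>"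
      using \<open>0 < n\<close> by (simp add: divide_le_eq)
    moreover have "?avg n - (\<Sum>j<n. F (\<mu> n j)) / of_nat n = ((\<Sum>i<n. F (\<xi> i)) - (\<Sum>j<n. F (\<mu> n j))) / of_nat n"
    proof -
      have "(\<Sum>z\<in>#proots (char_poly (A n)). F z) = (\<Sum>i<n. F (\<xi> i))"
        unfolding roots by (simp add: sum_unfold_sum_mset atLeast0LessThan multiset.map_comp o_def)
      then show ?thesis by (simp add: diff_divide_distrib)
    qed
    ultimately show ?thesis by (simp add: norm_divide)
  qed

  have "\<forall>\<^sub>F n in sequentially. norm (?avg n - ?X) < \<rho>"
    using \<mu>Y eventually_ge_at_top[of "n\<^sub>0 m"] eventually_ge_at_top[of "s * s"]
      eventually_ge_at_top[of "nat \<lceil>real (s + s * (2 * d)) / \<tau>\<rceil>"]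
  proof eventually_elim
    case (elim n)
    let ?avg\<mu> = "(\<Sum>j<n. F (\<mu> n j)) / of_nat n"
    have "real (s + s * (2 * d)) / \<tau> \<le> real n" using elim(4) by linarith
    from A\<mu>[OF elim(2,3) this] have "cmod (?avg n - ?avg\<mu>) \<le> \<eta> + 18 * C\<^sub>1 * \<tau>" .
    moreover have "cmod (?avg\<mu> - Y) < \<eta>" using elim(1) by (simp add: dist_norm)
    moreover have "cmod (Y - ?X) \<le> 3 * \<eta> + C\<^sub>2 * \<tau> + 3 * K * \<tau>" using XY by (simp add: norm_minus_commute)
    moreover have "cmod (?avg n - ?X) \<le> cmod (?avg n - ?avg\<mu>) + cmod (?avg\<mu> - Y) + cmod (Y - ?X)"
      using norm_triangle_ineq[of "?avg n - ?avg\<mu>" "?avg\<mu> - Y"] norm_triangle_ineq[of "?avg n - Y" "Y - ?X"] by simp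
    moreover have "6 * \<eta> < \<rho>" using \<open>0 < \<rho>\<close> by (simp add: \<eta>_def)
    ultimately show ?case using Q\<tau> by linarith
  qed
  then show "\<exists>no. \<forall>n\<ge>no. norm (?avg n - ?X) < \<rho>"
    by (simp only: eventually_sequentially)
qed

theorem theorem3p3:
  fixes \<kappa> :: "real \<times> real \<Rightarrow> complex" and A :: "nat \<Rightarrow> complex mat"
  assumes "\<kappa> \<in> borel_measurable (lebesgue_on ({0..1} \<times> {-pi..pi}))"
    and "matrix_sequence A"
    and "glt A \<kappa>"
    and "\<And>n. normal_mat (A n)"
  shows "spectral_distribution A ({0..1} \<times> {-pi..pi}) \<kappa>"
  unfolding spectral_distribution_def
proof (intro conjI allI impI)
  show "measure lebesgue glt_domain > 0" by (simp add: measure_glt_domain)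
  fix F :: "complex \<Rightarrow> complex"
  assume "continuous_on UNIV F \<and> bounded {z. F z \<noteq> 0}"
  then have "(\<lambda>n. (1 / of_nat n) * (\<Sum>z\<in>#proots (char_poly (A n)). F z))
    \<longlonglongrightarrow> integral\<^sup>L (lebesgue_on glt_domain) (\<lambda>z. F (\<kappa> z)) / (2 * of_real pi)"
    using assms by (intro glt_normal_eigenvalue_limit) auto
  then show "(\<lambda>n. (1 / of_nat n) * (\<Sum>z\<in>#proots (char_poly (A n)). F z))
    \<longlonglongrightarrow> (1 / of_real (measure lebesgue glt_domain)) * (LINT x:glt_domain|lebesgue. F (\<kappa> x))"
    by (simp add: measure_glt_domain set_lebesgue_integral_def restrict_glt_domain)
qed (use assms lmeasurable_glt_domain in auto)

end
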